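(* Over $\mathsf{ACA}_0^\omega+\mathsf{IND}_1$, each of the following items implies the next one: (i) $\mathsf{QF\text{-}AC}^{0,1}$. (ii) For every positive convergent unordered sum $\sum_{x\in[0,1]}a_x$, there is a sequence of reals $(y_n)_{n\in\mathbb{N}}$ such that $a_y=0$ for every $y\in[0,1]$ not in this sequence. (iii) Every positive convergent unordered sum $\sum_{x\in[0,1]}a_x$ has a modulus of convergence. (iv) $\mathsf{cocode}_1$: every strongly countable set $A\subseteq[0,1]$ can be enumerated.
   Context: Framework: Kohlenbach's higher-order reverse mathematics with base theory $\mathsf{RCA}_0^\omega$. $\mathsf{ACA}_0^\omega$ is $\mathsf{RCA}_0^\omega$ plus $(\exists^2)$: there is $E:\mathbb{N}^\mathbb{N}\to\{0,1\}$ with $(\forall f)[(\exists n)(f(n)=0)\leftrightarrow E(f)=0]$. $\mathsf{QF\text{-}AC}^{0,1}$: for any $Y$ with $(\forall n)(\exists f\in\mathbb{N}^\mathbb{N})(Y(f,n)=0)$ there is $(f_n)_n$ with $(\forall n)(Y(f_n,n)=0)$. $\mathsf{IND}_1$: for any $Y$ such that for every $n$ there is a unique $f\in2^\mathbb{N}$ with $Y(n,f)=0$, for every $n$ there is a finite sequence $w$ of elements of $2^\mathbb{N}$ of length $n$ with $Y(i,w(i))=0$ for $i<n$. An unordered sum is a map $a:[0,1]\to\mathbb{R}$, written $(a_x)_{x\in[0,1]}$ or $\sum_{x\in[0,1]}a_x$; positive means $a_x\ge0$ for all $x$. Let $\mathrm{fin}(\mathbb{R})$ be the set of finite sequences of reals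 without repetitions. The sum converges to $a\in\mathbb{R}$ if for every $k$ there is $I\in\mathrm{fin}(\mathbb{R})$ such that for every $J\in\mathrm{fin}(\mathbb{R})$ with $I\subseteq J$, $|a-\sum_{x\in J}a_x|<2^{-k}$; it is convergent if it converges to some $a$. A modulus of convergence is a sequence $\Phi:\mathbb{N}\to\mathrm{fin}(\mathbb{R})$ such that $I=\Phi(k)$ witnesses the previous condition for every $k$. Subsets of $\mathbb{R}$ are given by characteristic functions; $A\subseteq[0,1]$ is strongly countable if there is $Y:[0,1]\to\mathbb{N}$ injective on $A$ with $(\forall n)(\exists x\in A)(Y(x)=n)$; $A$ can be enumerated if some sequence of reals contains all elements of $A$. *)

theory Defs
  imports Main
begin

text \<open>
  The language of all finite types, the base theory of higher-order reverse mathematics, and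
  derivability in classical many-sorted natural deduction are formalised as syntax. ``Over the
  theory T, item A implies item B'' is rendered as derivability of the formula A \<open>\<longrightarrow>\<close> B from T.
\<close>

section \<open>Finite types, terms, formulas\<close>

datatype ty = Nt | Fn ty ty  (infixr "\<rightarrow>" 75)

abbreviation T1 :: ty where "T1 \<equiv> Nt \<rightarrow> Nt"
abbreviation T2 :: ty where "T2 \<equiv> T1 \<rightarrow> Nt"

type_synonym var = "string \<times> ty"

text \<open>\<open>Kc\<close>, \<open>Sc\<close> are the combinators \<open>\<Pi>\<close>, \<open>\<Sigma>\<close>; \<open>Rec\<close> is the recursor \<open>R\<^sub>0\<close> of type 0.\<close>

datatype cst = Zero | One | Plus | Times | Kc ty ty | Sc ty ty ty | Rec

text \<open>
  Locally nameless syntax: variables that are not bound carry a name and a type (and two such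
  variables with the same name and different types are different); bound variables are de Bruijn
  indices. Hence formulas are identified up to renaming of bound variables.
\<close>

datatype tm = Free var | Bnd nat | Cst cst | App tm tm  (infixl "\<cdot>" 90)

datatype fm = Bot | Eq tm tm  (infix "\<^bold>=" 50) | Less tm tm  (infix "\<^bold><" 50)
  | Imp fm fm  (infixr "\<^bold>\<longrightarrow>" 25) | All ty fm

fun cst_ty :: "cst \<Rightarrow> ty" where
  "cst_ty Zero = Nt"
| "cst_ty One = Nt"
| "cst_ty Plus = Nt \<rightarrow> Nt \<rightarrow> Nt"
| "cst_ty Times = Nt \<rightarrow> Nt \<rightarrow> Nt"
| "cst_ty (Kc \<sigma> \<tau>) = \<sigma> \<rightarrow> \<tau> \<rightarrow> \<sigma>"
| "cst_ty (Sc \<rho> \<sigma> \<tau>) = (\<rho> \<rightarrow> \<sigma> \<rightarrow> \<tau>) \<rightarrow> (\<rho> \<rightarrow> \<sigma>) \<rightarrow> \<rho> \<rightarrow> \<tau>"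
| "cst_ty Rec = (Nt \<rightarrow> Nt \<rightarrow> Nt) \<rightarrow> Nt \<rightarrow> Nt \<rightarrow> Nt"

text \<open>The list \<open>\<Delta>\<close> gives the types of the dangling de Bruijn indices.\<close>

fun tyof :: "ty list \<Rightarrow> tm \<Rightarrow> ty option" where
  "tyof \<Delta> (Free x) = Some (snd x)"
| "tyof \<Delta> (Bnd i) = (if i < length \<Delta> then Some (\<Delta> ! i) else None)"
| "tyof \<Delta> (Cst c) = Some (cst_ty c)"
| "tyof \<Delta> (s \<cdot> t) = (case (tyof \<Delta> s, tyof \<Delta> t) of
      (Some (\<sigma> \<rightarrow> \<tau>), Some \<sigma>') \<Rightarrow> if \<sigma> = \<sigma>' then Some \<tau> else None
    | _ \<Rightarrow> None)"

fun wf :: "ty list \<Rightarrow> fm \<Rightarrow> bool" where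
  "wf \<Delta> Bot \<longleftrightarrow> True"
| "wf \<Delta> (s \<^bold>= t) \<longleftrightarrow> tyof \<Delta> s = Some Nt \<and> tyof \<Delta> t = Some Nt"
| "wf \<Delta> (s \<^bold>< t) \<longleftrightarrow> tyof \<Delta> s = Some Nt \<and> tyof \<Delta> t = Some Nt"
| "wf \<Delta> (\<phi> \<^bold>\<longrightarrow> \<psi>) \<longleftrightarrow> wf \<Delta> \<phi> \<and> wf \<Delta> \<psi>"
| "wf \<Delta> (All \<sigma> \<phi>) \<longleftrightarrow> wf (\<sigma> # \<Delta>) \<phi>"

fun fvt :: "tm \<Rightarrow> var set" where
  "fvt (Free x) = {x}"
| "fvt (Bnd i) = {}"
| "fvt (Cst c) = {}"
| "fvt (s \<cdot> t) = fvt s \<union> fvt t"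

fun fv :: "fm \<Rightarrow> var set" where
  "fv Bot = {}"
| "fv (s \<^bold>= t) = fvt s \<union> fvt t"
| "fv (s \<^bold>< t) = fvt s \<union> fvt t"
| "fv (\<phi> \<^bold>\<longrightarrow> \<psi>) = fv \<phi> \<union> fv \<psi>"
| "fv (All \<sigma> \<phi>) = fv \<phi>"

text \<open>Substitution is only used with terms without dangling indices, so nothing is captured.\<close>

fun substt :: "var \<Rightarrow> tm \<Rightarrow> tm \<Rightarrow> tm" where
  "substt x u (Free y) = (if y = x then u else Free y)"
| "substt x u (Bnd i) = Bnd i"
| "substt x u (Cst c) = Cst c"
| "substt x u (s \<cdot> t) = substt x u s \<cdot> substt x u t"

fun subst :: "var \<Rightarrow> tm \<Rightarrow> fm \<Rightarrow> fm" where
  "subst x u Bot = Bot"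
| "subst x u (s \<^bold>= t) = (substt x u s \<^bold>= substt x u t)"
| "subst x u (s \<^bold>< t) = (substt x u s \<^bold>< substt x u t)"
| "subst x u (\<phi> \<^bold>\<longrightarrow> \<psi>) = (subst x u \<phi> \<^bold>\<longrightarrow> subst x u \<psi>)"
| "subst x u (All \<sigma> \<phi>) = All \<sigma> (subst x u \<phi>)"

fun closet :: "nat \<Rightarrow> var \<Rightarrow> tm \<Rightarrow> tm" where
  "closet k x (Free y) = (if y = x then Bnd k else Free y)"
| "closet k x (Bnd i) = Bnd i"
| "closet k x (Cst c) = Cst c"
| "closet k x (s \<cdot> t) = closet k x s \<cdot> closet k x t"

fun close :: "nat \<Rightarrow> var \<Rightarrow> fm \<Rightarrow> fm" where
  "close k x Bot = Bot"
| "close k x (s \<^bold>= t) = (closet k x s \<^bold>= closet k x t)"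
| "close k x (s \<^bold>< t) = (closet k x s \<^bold>< closet k x t)"
| "close k x (\<phi> \<^bold>\<longrightarrow> \<psi>) = (close k x \<phi> \<^bold>\<longrightarrow> close k x \<psi>)"
| "close k x (All \<sigma> \<phi>) = All \<sigma> (close (Suc k) x \<phi>)"

definition Forall :: "var \<Rightarrow> fm \<Rightarrow> fm" where
  "Forall x \<phi> = All (snd x) (close 0 x \<phi>)"

definition Neg :: "fm \<Rightarrow> fm"  ("\<^bold>\<not> _" [40] 40) where "(\<^bold>\<not> \<phi>) = (\<phi> \<^bold>\<longrightarrow> Bot)"
definition Or :: "fm \<Rightarrow> fm \<Rightarrow> fm"  (infixr "\<^bold>\<or>" 30) where "(\<phi> \<^bold>\<or> \<psi>) = (\<^bold>\<not> \<phi> \<^bold>\<longrightarrow> \<psi>)"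
definition And :: "fm \<Rightarrow> fm \<Rightarrow> fm"  (infixr "\<^bold>\<and>" 35) where "(\<phi> \<^bold>\<and> \<psi>) = (\<^bold>\<not> (\<phi> \<^bold>\<longrightarrow> \<^bold>\<not> \<psi>))"
definition Iff :: "fm \<Rightarrow> fm \<Rightarrow> fm"  (infixr "\<^bold>\<longleftrightarrow>" 25) where
  "(\<phi> \<^bold>\<longleftrightarrow> \<psi>) = ((\<phi> \<^bold>\<longrightarrow> \<psi>) \<^bold>\<and> (\<psi> \<^bold>\<longrightarrow> \<phi>))"
definition Exists :: "var \<Rightarrow> fm \<Rightarrow> fm" where "Exists x \<phi> = (\<^bold>\<not> Forall x (\<^bold>\<not> \<phi>))"

section \<open>Derivability\<close>

inductive derives :: "fm set \<Rightarrow> fm \<Rightarrow> bool"  (infix "\<turnstile>" 20) where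
  Assm: "\<phi> \<in> \<Gamma> \<Longrightarrow> wf [] \<phi> \<Longrightarrow> \<Gamma> \<turnstile> \<phi>"
| ImpI: "insert \<phi> \<Gamma> \<turnstile> \<psi> \<Longrightarrow> wf [] \<phi> \<Longrightarrow> \<Gamma> \<turnstile> \<phi> \<^bold>\<longrightarrow> \<psi>"
| ImpE: "\<Gamma> \<turnstile> \<phi> \<^bold>\<longrightarrow> \<psi> \<Longrightarrow> \<Gamma> \<turnstile> \<phi> \<Longrightarrow> \<Gamma> \<turnstile> \<psi>"
| Classical: "insert (\<^bold>\<not> \<phi>) \<Gamma> \<turnstile> Bot \<Longrightarrow> wf [] \<phi> \<Longrightarrow> \<Gamma> \<turnstile> \<phi>"
| AllI: "\<Gamma> \<turnstile> \<phi> \<Longrightarrow> x \<notin> \<Union> (fv ` \<Gamma>) \<Longrightarrow> \<Gamma> \<turnstile> Forall x \<phi>"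
| AllE: "\<Gamma> \<turnstile> Forall x \<phi> \<Longrightarrow> wf [] \<phi> \<Longrightarrow> tyof [] t = Some (snd x) \<Longrightarrow> \<Gamma> \<turnstile> subst x t \<phi>"
| EqRefl: "tyof [] t = Some Nt \<Longrightarrow> \<Gamma> \<turnstile> t \<^bold>= t"
| EqSubst: "\<Gamma> \<turnstile> s \<^bold>= t \<Longrightarrow> \<Gamma> \<turnstile> subst x s \<phi> \<Longrightarrow> wf [] \<phi> \<Longrightarrow> snd x = Nt \<Longrightarrow> \<Gamma> \<turnstile> subst x t \<phi>"

section \<open>Notation for writing terms and formulas\<close>

text \<open>
  The string is only used to build the formula. Bound names inside the formula-valued definitions
  below with arguments start with a prefix of their own (such as \<open>eq_\<close>), so that they do not
  capture variables occurring in the arguments.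
\<close>

definition forall :: "string \<Rightarrow> ty \<Rightarrow> (tm \<Rightarrow> fm) \<Rightarrow> fm" where
  "forall s \<sigma> F = Forall (s, \<sigma>) (F (Free (s, \<sigma>)))"
definition exists :: "string \<Rightarrow> ty \<Rightarrow> (tm \<Rightarrow> fm) \<Rightarrow> fm" where
  "exists s \<sigma> F = Exists (s, \<sigma>) (F (Free (s, \<sigma>)))"

abbreviation zero :: tm  ("\<^bold>0") where "\<^bold>0 \<equiv> Cst Zero"
abbreviation one :: tm  ("\<^bold>1") where "\<^bold>1 \<equiv> Cst One"
definition plus_tm :: "tm \<Rightarrow> tm \<Rightarrow> tm"  (infixl "\<^bold>+" 65) where "s \<^bold>+ t = Cst Plus \<cdot> s \<cdot> t"
definition times_tm :: "tm \<Rightarrow> tm \<Rightarrow> tm"  (infixl "\<^bold>*" 70) where "s \<^bold>* t = Cst Times \<cdot> s \<cdot> t"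

text \<open>Lambda abstraction defined from the combinators (bracket abstraction).\<close>

definition ty1 :: "tm \<Rightarrow> ty" where "ty1 t = the (tyof [] t)"
definition res_ty :: "ty \<Rightarrow> ty" where "res_ty \<sigma> = (case \<sigma> of _ \<rightarrow> \<tau> \<Rightarrow> \<tau> | Nt \<Rightarrow> Nt)"

definition id_tm :: "ty \<Rightarrow> tm" where
  "id_tm \<sigma> = Cst (Sc \<sigma> (Nt \<rightarrow> \<sigma>) \<sigma>) \<cdot> Cst (Kc \<sigma> (Nt \<rightarrow> \<sigma>)) \<cdot> Cst (Kc \<sigma> Nt)"
definition const_tm :: "ty \<Rightarrow> tm \<Rightarrow> tm" where
  "const_tm \<sigma> t = Cst (Kc (ty1 t) \<sigma>) \<cdot> t"

fun lam :: "var \<Rightarrow> tm \<Rightarrow> tm" where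
  "lam x (s \<cdot> t) = (if x \<notin> fvt (s \<cdot> t) then const_tm (snd x) (s \<cdot> t)
     else Cst (Sc (snd x) (ty1 t) (res_ty (ty1 s))) \<cdot> lam x s \<cdot> lam x t)"
| "lam x t = (if t = Free x then id_tm (snd x) else const_tm (snd x) t)"

definition fn :: "string \<Rightarrow> ty \<Rightarrow> (tm \<Rightarrow> tm) \<Rightarrow> tm" where
  "fn s \<sigma> F = lam (s, \<sigma>) (F (Free (s, \<sigma>)))"

text \<open>Equality at higher types is extensional.\<close>

fun incr :: "tm \<Rightarrow> tm" where
  "incr (Free x) = Free x"
| "incr (Bnd i) = Bnd (Suc i)"
| "incr (Cst c) = Cst c"
| "incr (s \<cdot> t) = incr s \<cdot> incr t"

fun eqt :: "ty \<Rightarrow> tm \<Rightarrow> tm \<Rightarrow> fm" where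
  "eqt Nt s t = (s \<^bold>= t)"
| "eqt (\<sigma> \<rightarrow> \<tau>) s t = All \<sigma> (eqt \<tau> (incr s \<cdot> Bnd 0) (incr t \<cdot> Bnd 0))"

section \<open>The theories\<close>

fun qf :: "fm \<Rightarrow> bool" where
  "qf (\<phi> \<^bold>\<longrightarrow> \<psi>) \<longleftrightarrow> qf \<phi> \<and> qf \<psi>"
| "qf (All \<sigma> \<phi>) \<longleftrightarrow> False"
| "qf _ \<longleftrightarrow> True"

definition sentence :: "fm \<Rightarrow> bool" where
  "sentence \<phi> \<longleftrightarrow> wf [] \<phi> \<and> fv \<phi> = {}"

definition closures :: "fm \<Rightarrow> fm set" where
  "closures \<phi> = {foldr Forall xs \<phi> | xs. sentence (foldr Forall xs \<phi>)}"

text \<open>The axioms for 0, 1, +, \<open>\<times>\<close>, < are those of a discrete ordered semiring in the usual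
  presentation for second-order arithmetic.\<close>

definition basic_axioms :: "fm set" where
  "basic_axioms =
    {forall ''m'' Nt (\<lambda>m. \<^bold>\<not> m \<^bold>+ \<^bold>1 \<^bold>= \<^bold>0),
     forall ''m'' Nt (\<lambda>m. forall ''n'' Nt (\<lambda>n. m \<^bold>+ \<^bold>1 \<^bold>= n \<^bold>+ \<^bold>1 \<^bold>\<longrightarrow> m \<^bold>= n)),
     forall ''m'' Nt (\<lambda>m. m \<^bold>+ \<^bold>0 \<^bold>= m),
     forall ''m'' Nt (\<lambda>m. forall ''n'' Nt (\<lambda>n. m \<^bold>+ (n \<^bold>+ \<^bold>1) \<^bold>= (m \<^bold>+ n) \<^bold>+ \<^bold>1)),
     forall ''m'' Nt (\<lambda>m. m \<^bold>* \<^bold>0 \<^bold>= \<^bold>0),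
     forall ''m'' Nt (\<lambda>m. forall ''n'' Nt (\<lambda>n. m \<^bold>* (n \<^bold>+ \<^bold>1) \<^bold>= (m \<^bold>* n) \<^bold>+ m)),
     forall ''m'' Nt (\<lambda>m. \<^bold>\<not> m \<^bold>< \<^bold>0),
     forall ''m'' Nt (\<lambda>m. forall ''n'' Nt (\<lambda>n. m \<^bold>< n \<^bold>+ \<^bold>1 \<^bold>\<longleftrightarrow> (m \<^bold>< n \<^bold>\<or> m \<^bold>= n)))}"

definition combinator_axioms :: "fm set" where
  "combinator_axioms =
    {forall ''x'' \<sigma> (\<lambda>x. forall ''y'' \<tau> (\<lambda>y. eqt \<sigma> (Cst (Kc \<sigma> \<tau>) \<cdot> x \<cdot> y) x)) | \<sigma> \<tau>. True} \<union>
    {forall ''x'' (\<rho> \<rightarrow> \<sigma> \<rightarrow> \<tau>) (\<lambda>x. forall ''y'' (\<rho> \<rightarrow> \<sigma>) (\<lambda>y. forall ''z'' \<rho> (\<lambda>z.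
       eqt \<tau> (Cst (Sc \<rho> \<sigma> \<tau>) \<cdot> x \<cdot> y \<cdot> z) (x \<cdot> z \<cdot> (y \<cdot> z))))) | \<rho> \<sigma> \<tau>. True}"

definition recursor_axioms :: "fm set" where
  "recursor_axioms =
    {forall ''f'' (Nt \<rightarrow> Nt \<rightarrow> Nt) (\<lambda>f. forall ''m'' Nt (\<lambda>m. Cst Rec \<cdot> f \<cdot> m \<cdot> \<^bold>0 \<^bold>= m)),
     forall ''f'' (Nt \<rightarrow> Nt \<rightarrow> Nt) (\<lambda>f. forall ''m'' Nt (\<lambda>m. forall ''n'' Nt (\<lambda>n.
       Cst Rec \<cdot> f \<cdot> m \<cdot> (n \<^bold>+ \<^bold>1) \<^bold>= f \<cdot> n \<cdot> (Cst Rec \<cdot> f \<cdot> m \<cdot> n))))}"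

definition extensionality_axioms :: "fm set" where
  "extensionality_axioms =
    {forall ''x'' \<rho> (\<lambda>x. forall ''y'' \<rho> (\<lambda>y. forall ''F'' (\<rho> \<rightarrow> \<tau>) (\<lambda>F.
       eqt \<rho> x y \<^bold>\<longrightarrow> eqt \<tau> (F \<cdot> x) (F \<cdot> y)))) | \<rho> \<tau>. True}"

definition QF_induction :: "fm set" where
  "QF_induction = \<Union> {closures
     (subst n \<^bold>0 \<phi> \<^bold>\<and> Forall n (\<phi> \<^bold>\<longrightarrow> subst n (Free n \<^bold>+ \<^bold>1) \<phi>) \<^bold>\<longrightarrow> Forall n \<phi>)
   | n \<phi>. qf \<phi> \<and> wf [] \<phi> \<and> snd n = Nt}"

text \<open>The scheme \<open>QF-AC\<^sup>1\<^sup>,\<^sup>0\<close>.\<close>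

definition QF_AC10 :: "fm set" where
  "QF_AC10 = \<Union> {closures
     (Forall x (Exists n \<phi>) \<^bold>\<longrightarrow> Exists Y (Forall x (subst n (Free Y \<cdot> Free x) \<phi>)))
   | x n Y \<phi>. qf \<phi> \<and> wf [] \<phi> \<and> snd x = T1 \<and> snd n = Nt \<and> snd Y = T2 \<and> Y \<notin> fv \<phi>}"

definition RCA0w :: "fm set" where
  "RCA0w = basic_axioms \<union> combinator_axioms \<union> recursor_axioms \<union> extensionality_axioms
     \<union> QF_induction \<union> QF_AC10"

text \<open>\<open>(\<exists>\<^sup>2)\<close>\<close>

definition exists2 :: fm where
  "exists2 = exists ''E'' T2 (\<lambda>E. forall ''f'' T1 (\<lambda>f.
     (E \<cdot> f \<^bold>= \<^bold>0 \<^bold>\<or> E \<cdot> f \<^bold>= \<^bold>1) \<^bold>\<and>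
     (exists ''n'' Nt (\<lambda>n. f \<cdot> n \<^bold>= \<^bold>0) \<^bold>\<longleftrightarrow> E \<cdot> f \<^bold>= \<^bold>0)))"

definition ACA0w :: "fm set" where
  "ACA0w = insert exists2 RCA0w"

definition QF_AC01 :: fm where
  "QF_AC01 = forall ''Y'' (T1 \<rightarrow> Nt \<rightarrow> Nt) (\<lambda>Y.
     forall ''n'' Nt (\<lambda>n. exists ''f'' T1 (\<lambda>f. Y \<cdot> f \<cdot> n \<^bold>= \<^bold>0)) \<^bold>\<longrightarrow>
     exists ''F'' (Nt \<rightarrow> T1) (\<lambda>F. forall ''n'' Nt (\<lambda>n. Y \<cdot> (F \<cdot> n) \<cdot> n \<^bold>= \<^bold>0)))"

definition binary :: "tm \<Rightarrow> fm" where
  "binary f = forall ''bin_i'' Nt (\<lambda>i. f \<cdot> i \<^bold>= \<^bold>0 \<^bold>\<or> f \<cdot> i \<^bold>= \<^bold>1)"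

text \<open>
  A finite sequence of objects of type 1 is given by a length \<open>n\<close> and an object \<open>w\<close> of
  type \<open>Nt \<rightarrow> T1\<close>, of which only the values \<open>w \<cdot> i\<close> for \<open>i < n\<close> matter.
\<close>

definition IND1 :: fm where
  "IND1 = forall ''Y'' (Nt \<rightarrow> T1 \<rightarrow> Nt) (\<lambda>Y.
     forall ''n'' Nt (\<lambda>n. exists ''f'' T1 (\<lambda>f. binary f \<^bold>\<and> Y \<cdot> n \<cdot> f \<^bold>= \<^bold>0 \<^bold>\<and>
       forall ''g'' T1 (\<lambda>g. binary g \<^bold>\<and> Y \<cdot> n \<cdot> g \<^bold>= \<^bold>0 \<^bold>\<longrightarrow> eqt T1 g f))) \<^bold>\<longrightarrow>
     forall ''n'' Nt (\<lambda>n. exists ''w'' (Nt \<rightarrow> T1) (\<lambda>w. forall ''i'' Nt (\<lambda>i.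
       i \<^bold>< n \<^bold>\<longrightarrow> binary (w \<cdot> i) \<^bold>\<and> Y \<cdot> i \<cdot> (w \<cdot> i) \<^bold>= \<^bold>0))))"

section \<open>Rational numbers\<close>

definition pred_tm :: tm where
  "pred_tm = fn ''m'' Nt (\<lambda>m. Cst Rec \<cdot> fn ''i'' Nt (\<lambda>i. fn ''r'' Nt (\<lambda>r. i)) \<cdot> \<^bold>0 \<cdot> m)"

definition monus_tm :: tm where
  "monus_tm = fn ''m'' Nt (\<lambda>m. fn ''n'' Nt (\<lambda>n.
     Cst Rec \<cdot> fn ''i'' Nt (\<lambda>i. fn ''r'' Nt (\<lambda>r. pred_tm \<cdot> r)) \<cdot> m \<cdot> n))"

abbreviation monus :: "tm \<Rightarrow> tm \<Rightarrow> tm"  (infixl "\<^bold>-" 65) where "s \<^bold>- t \<equiv> monus_tm \<cdot> s \<cdot> t"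

definition pow2_tm :: tm where
  "pow2_tm = fn ''n'' Nt (\<lambda>n.
     Cst Rec \<cdot> fn ''i'' Nt (\<lambda>i. fn ''r'' Nt (\<lambda>r. r \<^bold>+ r)) \<cdot> \<^bold>1 \<cdot> n)"

text \<open>
  Integer square root: the second summand is 1 if \<open>(r+1)\<^sup>2 \<le> i+1\<close> and 0 otherwise. It inverts the
  pairing \<open>(a,b) \<mapsto> (a+b)\<^sup>2 + a\<close>, as \<open>(a+b)\<^sup>2 \<le> (a+b)\<^sup>2 + a < (a+b+1)\<^sup>2\<close>.
\<close>

definition isqrt_tm :: tm where
  "isqrt_tm = fn ''z'' Nt (\<lambda>z. Cst Rec \<cdot> fn ''i'' Nt (\<lambda>i. fn ''r'' Nt (\<lambda>r.
     r \<^bold>+ (\<^bold>1 \<^bold>- ((r \<^bold>+ \<^bold>1) \<^bold>* (r \<^bold>+ \<^bold>1) \<^bold>- (i \<^bold>+ \<^bold>1))))) \<cdot> \<^bold>0 \<cdot> z)"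

definition pair_tm :: tm where
  "pair_tm = fn ''a'' Nt (\<lambda>a. fn ''b'' Nt (\<lambda>b. (a \<^bold>+ b) \<^bold>* (a \<^bold>+ b) \<^bold>+ a))"
definition fst_tm :: tm where
  "fst_tm = fn ''z'' Nt (\<lambda>z. z \<^bold>- isqrt_tm \<cdot> z \<^bold>* (isqrt_tm \<cdot> z))"
definition snd_tm :: tm where
  "snd_tm = fn ''z'' Nt (\<lambda>z. isqrt_tm \<cdot> z \<^bold>- fst_tm \<cdot> z)"

text \<open>
  Every natural number \<open>q\<close> codes a rational number, namely \<open>(qp q - qm q) / qd q\<close>, and every
  rational number \<open>(p - m) / (d + 1)\<close> has the code \<open>mkq p m d\<close>. The number 0 codes 0.
\<close>

definition mkq :: "tm \<Rightarrow> tm \<Rightarrow> tm \<Rightarrow> tm" where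
  "mkq p m d = pair_tm \<cdot> (pair_tm \<cdot> p \<cdot> m) \<cdot> d"
definition qp :: "tm \<Rightarrow> tm" where "qp q = fst_tm \<cdot> (fst_tm \<cdot> q)"
definition qm :: "tm \<Rightarrow> tm" where "qm q = snd_tm \<cdot> (fst_tm \<cdot> q)"
definition qd :: "tm \<Rightarrow> tm" where "qd q = snd_tm \<cdot> q \<^bold>+ \<^bold>1"

definition qless :: "tm \<Rightarrow> tm \<Rightarrow> fm" where
  "qless q r = (qp q \<^bold>* qd r \<^bold>+ qm r \<^bold>* qd q \<^bold>< qp r \<^bold>* qd q \<^bold>+ qm q \<^bold>* qd r)"
definition qleq :: "tm \<Rightarrow> tm \<Rightarrow> fm" where
  "qleq q r = (\<^bold>\<not> qless r q)"

definition qadd_tm :: tm where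
  "qadd_tm = fn ''q'' Nt (\<lambda>q. fn ''r'' Nt (\<lambda>r.
     mkq (qp q \<^bold>* qd r \<^bold>+ qp r \<^bold>* qd q) (qm q \<^bold>* qd r \<^bold>+ qm r \<^bold>* qd q) (qd q \<^bold>* qd r \<^bold>- \<^bold>1)))"
definition qneg_tm :: tm where
  "qneg_tm = fn ''q'' Nt (\<lambda>q. mkq (qm q) (qp q) (snd_tm \<cdot> q))"
definition qabs_tm :: tm where
  "qabs_tm = fn ''q'' Nt (\<lambda>q. mkq ((qp q \<^bold>- qm q) \<^bold>+ (qm q \<^bold>- qp q)) \<^bold>0 (snd_tm \<cdot> q))"

abbreviation qdist :: "tm \<Rightarrow> tm \<Rightarrow> tm" where
  "qdist q r \<equiv> qabs_tm \<cdot> (qadd_tm \<cdot> q \<cdot> (qneg_tm \<cdot> r))"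

text \<open>The rational number \<open>2\<^sup>-\<^sup>n\<close>.\<close>

definition qpow_tm :: tm where
  "qpow_tm = fn ''n'' Nt (\<lambda>n. mkq \<^bold>1 \<^bold>0 (pow2_tm \<cdot> n \<^bold>- \<^bold>1))"

section \<open>Real numbers\<close>

text \<open>
  A real number is a sequence \<open>x\<close> of rational numbers with \<open>\<bar>x n - x (n+i)\<bar> < 2\<^sup>-\<^sup>n\<close>; reals
  \<open>x\<close>, \<open>y\<close> are equal if \<open>\<bar>x n - y n\<bar> \<le> 2 \<sqdot> 2\<^sup>-\<^sup>n\<close> for all \<open>n\<close>.
\<close>

definition isreal :: "tm \<Rightarrow> fm" where
  "isreal x = forall ''re_n'' Nt (\<lambda>n. forall ''re_i'' Nt (\<lambda>i.
     qless (qdist (x \<cdot> n) (x \<cdot> (n \<^bold>+ i))) (qpow_tm \<cdot> n)))"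

definition eqR :: "tm \<Rightarrow> tm \<Rightarrow> fm" where
  "eqR x y = forall ''eq_n'' Nt (\<lambda>n.
     qleq (qdist (x \<cdot> n) (y \<cdot> n)) (qadd_tm \<cdot> (qpow_tm \<cdot> n) \<cdot> (qpow_tm \<cdot> n)))"

definition leqR :: "tm \<Rightarrow> tm \<Rightarrow> fm" where
  "leqR x y = forall ''le_n'' Nt (\<lambda>n.
     qleq (x \<cdot> n) (qadd_tm \<cdot> (y \<cdot> n) \<cdot> (qadd_tm \<cdot> (qpow_tm \<cdot> n) \<cdot> (qpow_tm \<cdot> n))))"

definition lessR :: "tm \<Rightarrow> tm \<Rightarrow> fm" where
  "lessR x y = (\<^bold>\<not> leqR y x)"

definition ratR_tm :: tm where
  "ratR_tm = fn ''q'' Nt (\<lambda>q. fn ''n'' Nt (\<lambda>n. q))"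

definition diffR_tm :: tm where
  "diffR_tm = fn ''x'' T1 (\<lambda>x. fn ''y'' T1 (\<lambda>y. fn ''n'' Nt (\<lambda>n.
     qadd_tm \<cdot> (x \<cdot> (n \<^bold>+ \<^bold>1)) \<cdot> (qneg_tm \<cdot> (y \<cdot> (n \<^bold>+ \<^bold>1))))))"

definition absR_tm :: tm where
  "absR_tm = fn ''x'' T1 (\<lambda>x. fn ''n'' Nt (\<lambda>n. qabs_tm \<cdot> (x \<cdot> n)))"

definition in01 :: "tm \<Rightarrow> fm" where
  "in01 x = (isreal x \<^bold>\<and> leqR (ratR_tm \<cdot> \<^bold>0) x \<^bold>\<and> leqR x (ratR_tm \<cdot> mkq \<^bold>1 \<^bold>0 \<^bold>0))"

section \<open>Unordered sums\<close>

text \<open>A map from \<open>[0,1]\<close> to the reals is a type 1 to 1 functional respecting equality of reals.\<close>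

definition family :: "tm \<Rightarrow> fm" where
  "family a =
     (forall ''fa_x'' T1 (\<lambda>x. in01 x \<^bold>\<longrightarrow> isreal (a \<cdot> x)) \<^bold>\<and>
      forall ''fa_x'' T1 (\<lambda>x. forall ''fa_y'' T1 (\<lambda>y.
        in01 x \<^bold>\<and> in01 y \<^bold>\<and> eqR x y \<^bold>\<longrightarrow> eqR (a \<cdot> x) (a \<cdot> y))))"

definition positive :: "tm \<Rightarrow> fm" where
  "positive a = forall ''po_x'' T1 (\<lambda>x. in01 x \<^bold>\<longrightarrow> leqR (ratR_tm \<cdot> \<^bold>0) (a \<cdot> x))"

text \<open>
  \<open>w\<close>, \<open>m\<close> form a finite sequence of reals without repetitions. Its members lie in \<open>[0,1]\<close>, as
  \<open>a\<close> is only defined there.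
\<close>

definition finseq :: "tm \<Rightarrow> tm \<Rightarrow> fm" where
  "finseq w m = forall ''fi_i'' Nt (\<lambda>i. i \<^bold>< m \<^bold>\<longrightarrow> in01 (w \<cdot> i) \<^bold>\<and>
     forall ''fi_j'' Nt (\<lambda>j. j \<^bold>< i \<^bold>\<longrightarrow> \<^bold>\<not> eqR (w \<cdot> j) (w \<cdot> i)))"

definition contained :: "tm \<Rightarrow> tm \<Rightarrow> tm \<Rightarrow> tm \<Rightarrow> fm" where
  "contained v l w m = forall ''su_i'' Nt (\<lambda>i. i \<^bold>< l \<^bold>\<longrightarrow>
     exists ''su_j'' Nt (\<lambda>j. j \<^bold>< m \<^bold>\<and> eqR (v \<cdot> i) (w \<cdot> j)))"

text \<open>
  The real \<open>a(w(0)) + \<dots> + a(w(m-1))\<close>. Its \<open>n\<close>-th approximation adds the approximations of the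
  summands with index \<open>n + m\<close>, so that the total error stays below \<open>m \<sqdot> 2\<^sup>-\<^sup>n\<^sup>-\<^sup>m < 2\<^sup>-\<^sup>n\<close>.
\<close>

definition sum_tm :: tm where
  "sum_tm = fn ''a'' (T1 \<rightarrow> T1) (\<lambda>a. fn ''w'' (Nt \<rightarrow> T1) (\<lambda>w. fn ''m'' Nt (\<lambda>m. fn ''n'' Nt (\<lambda>n.
     Cst Rec \<cdot> fn ''i'' Nt (\<lambda>i. fn ''r'' Nt (\<lambda>r. qadd_tm \<cdot> r \<cdot> (a \<cdot> (w \<cdot> i) \<cdot> (n \<^bold>+ m))))
       \<cdot> \<^bold>0 \<cdot> m))))"

text \<open>The finite set \<open>I\<close> given by \<open>v\<close>, \<open>l\<close> witnesses convergence of \<open>a\<close> to \<open>b\<close> for \<open>k\<close>.\<close>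

definition witness :: "tm \<Rightarrow> tm \<Rightarrow> tm \<Rightarrow> tm \<Rightarrow> tm \<Rightarrow> fm" where
  "witness a b k v l = (finseq v l \<^bold>\<and>
     forall ''wi_w'' (Nt \<rightarrow> T1) (\<lambda>w. forall ''wi_m'' Nt (\<lambda>m.
       finseq w m \<^bold>\<and> contained v l w m \<^bold>\<longrightarrow>
       lessR (absR_tm \<cdot> (diffR_tm \<cdot> b \<cdot> (sum_tm \<cdot> a \<cdot> w \<cdot> m))) (ratR_tm \<cdot> (qpow_tm \<cdot> k)))))"

definition converges_to :: "tm \<Rightarrow> tm \<Rightarrow> fm" where
  "converges_to a b = (isreal b \<^bold>\<and> forall ''co_k'' Nt (\<lambda>k.
     exists ''co_v'' (Nt \<rightarrow> T1) (\<lambda>v. exists ''co_l'' Nt (\<lambda>l. witness a b k v l))))"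

text \<open>A sequence \<open>\<Phi>\<close> of finite sequences consists of a sequence of objects of type \<open>Nt \<rightarrow> T1\<close> and
  the sequence \<open>L\<close> of their lengths.\<close>

definition modulus :: "tm \<Rightarrow> tm \<Rightarrow> tm \<Rightarrow> tm \<Rightarrow> fm" where
  "modulus a b \<Phi> L = forall ''mo_k'' Nt (\<lambda>k. witness a b k (\<Phi> \<cdot> k) (L \<cdot> k))"

definition item_ii :: fm where
  "item_ii = forall ''a'' (T1 \<rightarrow> T1) (\<lambda>a.
     family a \<^bold>\<and> positive a \<^bold>\<and> exists ''b'' T1 (\<lambda>b. converges_to a b) \<^bold>\<longrightarrow>
     exists ''y'' (Nt \<rightarrow> T1) (\<lambda>y. forall ''n'' Nt (\<lambda>n. isreal (y \<cdot> n)) \<^bold>\<and>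
       forall ''z'' T1 (\<lambda>z. in01 z \<^bold>\<and> forall ''n'' Nt (\<lambda>n. \<^bold>\<not> eqR z (y \<cdot> n)) \<^bold>\<longrightarrow>
         eqR (a \<cdot> z) (ratR_tm \<cdot> \<^bold>0))))"

definition item_iii :: fm where
  "item_iii = forall ''a'' (T1 \<rightarrow> T1) (\<lambda>a. forall ''b'' T1 (\<lambda>b.
     family a \<^bold>\<and> positive a \<^bold>\<and> converges_to a b \<^bold>\<longrightarrow>
     exists ''P'' (Nt \<rightarrow> Nt \<rightarrow> T1) (\<lambda>\<Phi>. exists ''L'' T1 (\<lambda>L. modulus a b \<Phi> L))))"

section \<open>Strongly countable sets\<close>

definition elt :: "tm \<Rightarrow> tm \<Rightarrow> fm" where
  "elt x A = (isreal x \<^bold>\<and> A \<cdot> x \<^bold>= \<^bold>1)"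

text \<open>\<open>A\<close> is the characteristic function of a subset of \<open>[0,1]\<close>; like every function on the
  reals, it respects equality of reals.\<close>

definition subset01 :: "tm \<Rightarrow> fm" where
  "subset01 A =
     (forall ''se_x'' T1 (\<lambda>x. isreal x \<^bold>\<longrightarrow> A \<cdot> x \<^bold>= \<^bold>0 \<^bold>\<or> A \<cdot> x \<^bold>= \<^bold>1) \<^bold>\<and>
      forall ''se_x'' T1 (\<lambda>x. forall ''se_y'' T1 (\<lambda>y.
        isreal x \<^bold>\<and> isreal y \<^bold>\<and> eqR x y \<^bold>\<longrightarrow> A \<cdot> x \<^bold>= A \<cdot> y)) \<^bold>\<and>
      forall ''se_x'' T1 (\<lambda>x. elt x A \<^bold>\<longrightarrow> in01 x))"

definition strongly_countable :: "tm \<Rightarrow> fm" where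
  "strongly_countable A = exists ''st_Y'' T2 (\<lambda>Y.
     forall ''st_x'' T1 (\<lambda>x. forall ''st_y'' T1 (\<lambda>y.
       in01 x \<^bold>\<and> in01 y \<^bold>\<and> eqR x y \<^bold>\<longrightarrow> Y \<cdot> x \<^bold>= Y \<cdot> y)) \<^bold>\<and>
     forall ''st_x'' T1 (\<lambda>x. forall ''st_y'' T1 (\<lambda>y.
       elt x A \<^bold>\<and> elt y A \<^bold>\<and> Y \<cdot> x \<^bold>= Y \<cdot> y \<^bold>\<longrightarrow> eqR x y)) \<^bold>\<and>
     forall ''st_n'' Nt (\<lambda>n. exists ''st_x'' T1 (\<lambda>x. elt x A \<^bold>\<and> Y \<cdot> x \<^bold>= n)))"

definition enumerable :: "tm \<Rightarrow> fm" where
  "enumerable A = exists ''en_z'' (Nt \<rightarrow> T1) (\<lambda>z.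
     forall ''en_n'' Nt (\<lambda>n. isreal (z \<cdot> n)) \<^bold>\<and>
     forall ''en_x'' T1 (\<lambda>x. elt x A \<^bold>\<longrightarrow> exists ''en_n'' Nt (\<lambda>n. eqR x (z \<cdot> n))))"

definition cocode1 :: fm where
  "cocode1 = forall ''A'' T2 (\<lambda>A.
     subset01 A \<^bold>\<and> strongly_countable A \<^bold>\<longrightarrow> enumerable A)"

end

theory Submission
  imports Defs "HOL-Library.Countable_Set" "HOL-Computational_Algebra.Fraction_Field"
begin

text \<open>
  By a Henkin style completeness theorem it is enough to argue in an arbitrary, possibly nonstandard,
  model of \<open>ACA\<^sub>0\<^sup>\<omega> + IND\<^sub>1\<close>. Extensional equality is a congruence, so it can be divided out, and the rational
  numbers of a model form an ordered field. Two facts about a positive sum converging to \<open>b\<close> carry the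
  argument: all finite sums are at most \<open>b\<close>, and a finite set \<open>I\<close> whose sum exceeds \<open>b - 2\<^sup>-\<^sup>k\<^sup>-\<^sup>1\<close>
  witnesses convergence for \<open>k\<close>.

  (i) to (ii): the axiom of choice gives finite sets \<open>J\<^sub>k\<close> with sum above \<open>b - 2\<^sup>-\<^sup>k\<close>. If \<open>y\<close> is in none of
  them, then \<open>a\<^sub>y \<le> 2\<^sup>-\<^sup>k\<close> for every \<open>k\<close>. (ii) to (iii): after removal of repetitions from the
  enumeration, its initial segments have sums tending to \<open>b\<close>, and long enough ones are witnesses.
  (iii) to (iv): let \<open>a\<^sub>x = 2\<close> to the power \<open>-(Y x + 1)\<close> on \<open>A\<close> and \<open>0\<close> elsewhere. By \<open>IND\<^sub>1\<close> there are finite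
  sequences of elements of \<open>A\<close> with \<open>Y\<close>-values \<open>0, \<dots>, n\<close>, so the sum converges to 1; and a modulus \<open>\<Phi>\<close>
  must list \<open>x \<in> A\<close> in \<open>\<Phi>(Y x + 2)\<close>.
\<close>

section \<open>Syntax\<close>

text \<open>A finite sequence of a nonstandard model may have nonstandard length, so HOL's finite
  sums and its induction on \<open>nat\<close> do not apply to it. Sums are therefore defined by
  recursion inside the model (\<open>Sumk\<close>), and induction is used only for predicates given
  by a function of the model (\<open>decid\<close>). The functional \<open>E\<close> of
  \<open>exists2\<close> brings every formula with number quantifiers under this heading, with
  parameters of any type. Together with quantifier-free choice it yields a search operator
  \<open>mu\<close>, which finds numbers with such properties uniformly; this is how the modulus
  arises in the step from (ii) to (iii).

  Being a witness of convergence quantifies over all finite sequences and is out of reach of this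
  comprehension. Positivity removes the obstacle: closeness of one finite sum to \<open>b\<close> is
  arithmetical and, at the price of one factor 2, makes the finite set a witness. Choice is applied
  to closeness only. \<open>IND1\<close> asks for unique elements of Cantor space, while members of
  \<open>A\<close> are unique only up to equality of reals; Dedekind cuts repair this.\<close>

fun opent :: "nat \<Rightarrow> tm \<Rightarrow> tm \<Rightarrow> tm" where
  "opent k u (Free y) = Free y"
| "opent k u (Bnd i) = (if i = k then u else Bnd i)"
| "opent k u (Cst c) = Cst c"
| "opent k u (s \<cdot> t) = opent k u s \<cdot> opent k u t"

text \<open>Only terms without dangling indices are put in, and only for the outermost dangling
  index. So nothing has to be shifted, neither in \<open>u\<close> under a binder nor among the
  remaining indices.\<close>

fun opn :: "nat \<Rightarrow> tm \<Rightarrow> fm \<Rightarrow> fm" where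
  "opn k u Bot = Bot"
| "opn k u (s \<^bold>= t) = (opent k u s \<^bold>= opent k u t)"
| "opn k u (s \<^bold>< t) = (opent k u s \<^bold>< opent k u t)"
| "opn k u (\<phi> \<^bold>\<longrightarrow> \<psi>) = (opn k u \<phi> \<^bold>\<longrightarrow> opn k u \<psi>)"
| "opn k u (All \<sigma> \<phi>) = All \<sigma> (opn (Suc k) u \<phi>)"

fun lct :: "nat \<Rightarrow> tm \<Rightarrow> bool" where
  "lct k (Free x) \<longleftrightarrow> True"
| "lct k (Bnd i) \<longleftrightarrow> i < k"
| "lct k (Cst c) \<longleftrightarrow> True"
| "lct k (s \<cdot> t) \<longleftrightarrow> lct k s \<and> lct k t"

fun lc :: "nat \<Rightarrow> fm \<Rightarrow> bool" where
  "lc k Bot \<longleftrightarrow> True"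
| "lc k (s \<^bold>= t) \<longleftrightarrow> lct k s \<and> lct k t"
| "lc k (s \<^bold>< t) \<longleftrightarrow> lct k s \<and> lct k t"
| "lc k (\<phi> \<^bold>\<longrightarrow> \<psi>) \<longleftrightarrow> lc k \<phi> \<and> lc k \<psi>"
| "lc k (All \<sigma> \<phi>) \<longleftrightarrow> lc (Suc k) \<phi>"

lemma tyof_App_Some:
  "tyof \<Delta> (s \<cdot> t) = Some \<tau> \<longleftrightarrow> (\<exists>\<sigma>. tyof \<Delta> s = Some (\<sigma> \<rightarrow> \<tau>) \<and> tyof \<Delta> t = Some \<sigma>)"
  by (auto split: option.splits ty.splits)

lemma tyof_App: "tyof \<Delta> s = Some (\<sigma> \<rightarrow> \<tau>) \<Longrightarrow> tyof \<Delta> t = Some \<sigma> \<Longrightarrow> tyof \<Delta> (s \<cdot> t) = Some \<tau>"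
  by simp

lemma tyof_lct: "tyof \<Delta> t = Some \<tau> \<Longrightarrow> lct (length \<Delta>) t"
  by (induction t arbitrary: \<tau>) (auto simp: tyof_App_Some simp del: tyof.simps(4) split: if_splits)

lemma tyof_lct0: "tyof [] t = Some \<tau> \<Longrightarrow> lct 0 t"
  using tyof_lct by fastforce

lemma lct_mono: "lct j t \<Longrightarrow> j \<le> k \<Longrightarrow> lct k t"
  by (induction t) auto

lemma wf_lc: "wf \<Delta> \<phi> \<Longrightarrow> lc (length \<Delta>) \<phi>"
  by (induction \<Delta> \<phi> rule: wf.induct) (auto simp: tyof_lct)

lemma wf_lc0: "wf [] \<phi> \<Longrightarrow> lc 0 \<phi>"
  using wf_lc by fastforce

lemma tyof_append_lct: "lct (length \<Delta>) t \<Longrightarrow> tyof (\<Delta> @ \<Delta>') t = tyof \<Delta> t"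
  by (induction t) (auto simp: nth_append)

lemma tyof_Nil_append: "tyof [] t = Some \<tau> \<Longrightarrow> tyof \<Delta> t = Some \<tau>"
  using tyof_append_lct[of "[]" t \<Delta>] tyof_lct0 by fastforce

lemma tyof_opent: "tyof [] u = Some \<sigma> \<Longrightarrow> tyof (\<Delta> @ [\<sigma>]) t = Some \<tau> \<Longrightarrow> tyof \<Delta> (opent (length \<Delta>) u t) = Some \<tau>"
  by (induction t arbitrary: \<tau>)
    (auto simp: nth_append tyof_App_Some simp del: tyof.simps(4) intro: tyof_Nil_append split: if_splits)

lemma wf_opn: "tyof [] u = Some \<sigma> \<Longrightarrow> wf (\<Delta> @ [\<sigma>]) \<phi> \<Longrightarrow> wf \<Delta> (opn (length \<Delta>) u \<phi>)"
proof (induction \<phi> arbitrary: \<Delta>)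
  case (All x1 \<phi>)
  then show ?case using All.IH[of "x1 # \<Delta>"] by simp
qed (auto simp: tyof_opent)

lemma tyof_closet: "lct (length \<Delta>) t \<Longrightarrow> tyof (\<Delta> @ [snd x]) (closet (length \<Delta>) x t) = tyof \<Delta> t"
  by (induction t) (auto simp: nth_append)

lemma wf_close: "wf \<Delta> \<phi> \<Longrightarrow> wf (\<Delta> @ [snd x]) (close (length \<Delta>) x \<phi>)"
proof (induction \<phi> arbitrary: \<Delta>)
  case (All x1 \<phi>)
  then show ?case using All.IH[of "x1 # \<Delta>"] by simp
qed (auto simp: tyof_closet tyof_lct)

lemma wf_Forall: "wf [] \<phi> \<Longrightarrow> wf [] (Forall x \<phi>)"
  using wf_close[of "[]"] by (simp add: Forall_def)

lemma closet_opent: "x \<notin> fvt t \<Longrightarrow> closet k x (opent k (Free x) t) = t"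
  by (induction t) auto

text \<open>The bridge between the two kinds of quantifier: with a fresh \<open>x\<close>,
  \<open>All\<close> is \<open>Forall x\<close> of the opened body, and the rules of
  \<open>derives\<close> are stated for \<open>Forall\<close>.\<close>

lemma close_opn: "x \<notin> fv \<phi> \<Longrightarrow> close k x (opn k (Free x) \<phi>) = \<phi>"
  by (induction \<phi> arbitrary: k) (auto simp: closet_opent)

lemma substt_opent: "x \<notin> fvt t \<Longrightarrow> substt x u (opent k (Free x) t) = opent k u t"
  by (induction t) auto

lemma subst_opn: "x \<notin> fv \<phi> \<Longrightarrow> subst x u (opn k (Free x) \<phi>) = opn k u \<phi>"
  by (induction \<phi> arbitrary: k) (auto simp: substt_opent)

text \<open>Opening the body of a quantifier does not give a subformula, so inductions that
  instantiate quantifiers run over the size.\<close>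

lemma size_opn [simp]: "size (opn k u \<phi>) = size \<phi>"
  by (induction \<phi> arbitrary: k) auto

lemma fvt_closet: "fvt (closet k x t) = fvt t - {x}"
  by (induction t) auto

lemma fv_close: "fv (close k x \<phi>) = fv \<phi> - {x}"
  by (induction \<phi> arbitrary: k) (auto simp: fvt_closet)

lemma fv_Forall [simp]: "fv (Forall x \<phi>) = fv \<phi> - {x}"
  by (simp add: Forall_def fv_close)

lemma finite_fvt [simp]: "finite (fvt t)"
  by (induction t) auto

lemma finite_fv [simp]: "finite (fv \<phi>)"
  by (induction \<phi>) auto

lemma tyof_substt: "tyof [] u = Some (snd x) \<Longrightarrow> tyof \<Delta> (substt x u t) = tyof \<Delta> t"
  by (induction t) (auto dest: tyof_Nil_append[of u _ \<Delta>])

lemma wf_subst: "tyof [] u = Some (snd x) \<Longrightarrow> wf \<Delta> (subst x u \<phi>) = wf \<Delta> \<phi>"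
  by (induction \<phi> arbitrary: \<Delta>) (auto simp: tyof_substt)

lemma substt_same [simp]: "substt x (Free x) t = t"
  by (induction t) auto

lemma subst_same [simp]: "subst x (Free x) \<phi> = \<phi>"
  by (induction \<phi>) auto

lemma fresh_var: "finite (V :: var set) \<Longrightarrow> \<exists>s. (s, \<sigma>) \<notin> V"
proof -
  assume "finite V"
  then have "finite (fst ` V)" by simp
  then obtain s where "s \<notin> fst ` V"
    using ex_new_if_finite infinite_UNIV_listI by blast
  then show ?thesis by force
qed

section \<open>Semantics\<close>

text \<open>
  Every type is interpreted by the whole of \<open>'d\<close>; hence application has to be indexed by the type
  of the function that is applied. The stack \<open>b\<close> holds the values of the dangling indices.
\<close>

record 'd str =
  ap :: "ty \<Rightarrow> 'd \<Rightarrow> 'd \<Rightarrow> 'd"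
  cs :: "cst \<Rightarrow> 'd"
  ls :: "'d \<Rightarrow> 'd \<Rightarrow> bool"

fun sem :: "'d str \<Rightarrow> (var \<Rightarrow> 'd) \<Rightarrow> (ty \<times> 'd) list \<Rightarrow> tm \<Rightarrow> 'd" where
  "sem M e b (Free x) = e x"
| "sem M e b (Bnd i) = snd (b ! i)"
| "sem M e b (Cst c) = cs M c"
| "sem M e b (s \<cdot> t) = ap M (the (tyof (map fst b) s)) (sem M e b s) (sem M e b t)"

fun sat :: "'d str \<Rightarrow> (var \<Rightarrow> 'd) \<Rightarrow> (ty \<times> 'd) list \<Rightarrow> fm \<Rightarrow> bool" where
  "sat M e b Bot \<longleftrightarrow> False"
| "sat M e b (s \<^bold>= t) \<longleftrightarrow> sem M e b s = sem M e b t"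
| "sat M e b (s \<^bold>< t) \<longleftrightarrow> ls M (sem M e b s) (sem M e b t)"
| "sat M e b (\<phi> \<^bold>\<longrightarrow> \<psi>) \<longleftrightarrow> (sat M e b \<phi> \<longrightarrow> sat M e b \<psi>)"
| "sat M e b (All \<sigma> \<phi>) \<longleftrightarrow> (\<forall>d. sat M e ((\<sigma>, d) # b) \<phi>)"

definition valid :: "'d str \<Rightarrow> fm \<Rightarrow> bool" where
  "valid M \<phi> \<longleftrightarrow> (\<forall>e. sat M e [] \<phi>)"

text \<open>All types share one carrier, so agreement at any single function type has to force
  identity. The term model achieves this by numbering the classes of each type separately.\<close>

definition extensional :: "'d str \<Rightarrow> bool" where
  "extensional M \<longleftrightarrow> (\<forall>\<sigma> \<tau> f g. (\<forall>x. ap M (\<sigma> \<rightarrow> \<tau>) f x = ap M (\<sigma> \<rightarrow> \<tau>) g x) \<longrightarrow> f = g)"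

lemma sem_cong: "(\<And>x. x \<in> fvt t \<Longrightarrow> e x = e' x) \<Longrightarrow> sem M e b t = sem M e' b t"
  by (induction t) auto

lemma sat_cong: "(\<And>x. x \<in> fv \<phi> \<Longrightarrow> e x = e' x) \<Longrightarrow> sat M e b \<phi> = sat M e' b \<phi>"
proof (induction \<phi> arbitrary: b)
  case (Eq s t)
  then show ?case using sem_cong[of s e e' M b] sem_cong[of t e e' M b] by auto
next
  case (Less s t)
  then show ?case using sem_cong[of s e e' M b] sem_cong[of t e e' M b] by auto
qed auto

lemma sem_upd_fresh: "x \<notin> fvt t \<Longrightarrow> sem M (e(x := d)) b t = sem M e b t"
  by (rule sem_cong) auto

lemma sat_upd_fresh: "x \<notin> fv \<phi> \<Longrightarrow> sat M (e(x := d)) b \<phi> = sat M e b \<phi>"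
  by (rule sat_cong) auto

lemma sem_closet:
  "lct (length b) t \<Longrightarrow> sem M e (b @ [(snd x, d)]) (closet (length b) x t) = sem M (e(x := d)) b t"
proof (induction t)
  case (App s t)
  then show ?case using tyof_closet[of "map fst b" s x] by simp
qed (auto simp: nth_append)

lemma sat_close:
  "lc (length b) \<phi> \<Longrightarrow> sat M e (b @ [(snd x, d)]) (close (length b) x \<phi>) = sat M (e(x := d)) b \<phi>"
proof (induction \<phi> arbitrary: b)
  case (All \<sigma> \<phi>)
  then show ?case using All.IH[of "(\<sigma>, _) # b"] by simp
qed (auto simp: sem_closet)

lemma sat_Forall: "lc 0 \<phi> \<Longrightarrow> sat M e [] (Forall x \<phi>) \<longleftrightarrow> (\<forall>d. sat M (e(x := d)) [] \<phi>)"
  using sat_close[of "[]" \<phi> M e x] by (simp add: Forall_def)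

lemma sem_append: "lct (length b) t \<Longrightarrow> sem M e (b @ b') t = sem M e b t"
  by (induction t) (auto simp: nth_append tyof_append_lct)

lemma sem_opent:
  assumes "tyof [] u = Some \<sigma>"
  shows "tyof (map fst b @ [\<sigma>]) t = Some \<tau> \<Longrightarrow>
    sem M e (b @ [(\<sigma>, sem M e [] u)]) t = sem M e b (opent (length b) u t)"
proof (induction t arbitrary: \<tau>)
  case (Bnd i)
  then show ?case using sem_append[of "[]" u M e b] tyof_lct0[OF assms] by (auto simp: nth_append split: if_splits)
next
  case (App s t)
  then obtain \<rho> where *: "tyof (map fst b @ [\<sigma>]) s = Some (\<rho> \<rightarrow> \<tau>)" "tyof (map fst b @ [\<sigma>]) t = Some \<rho>"
    by (auto simp: tyof_App_Some simp del: tyof.simps(4))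
  then have "tyof (map fst b) (opent (length b) u s) = Some (\<rho> \<rightarrow> \<tau>)"
    using tyof_opent[OF assms, of "map fst b" s] by simp
  then show ?case using App.IH * by simp
qed auto

lemma sat_opn:
  assumes "tyof [] u = Some \<sigma>"
  shows "wf (map fst b @ [\<sigma>]) \<phi> \<Longrightarrow>
    sat M e (b @ [(\<sigma>, sem M e [] u)]) \<phi> = sat M e b (opn (length b) u \<phi>)"
proof (induction \<phi> arbitrary: b)
  case (All \<rho> \<phi>)
  then show ?case using All.IH[of "(\<rho>, _) # b"] by simp
qed (auto simp: sem_opent[OF assms])

lemma lct_incr: "lct k t \<Longrightarrow> lct (Suc k) (incr t)"
  by (induction t) auto

lemma tyof_incr [simp]: "tyof (\<sigma> # \<Delta>) (incr t) = tyof \<Delta> t"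
  by (induction t) auto

lemma sem_incr [simp]: "sem M e (d # b) (incr t) = sem M e b t"
  by (induction t) auto

lemma fvt_incr [simp]: "fvt (incr t) = fvt t"
  by (induction t) auto

lemma wf_eqt: "tyof \<Delta> s = Some \<sigma> \<Longrightarrow> tyof \<Delta> t = Some \<sigma> \<Longrightarrow> wf \<Delta> (eqt \<sigma> s t)"
  by (induction \<sigma> arbitrary: \<Delta> s t) auto

lemma fv_eqt [simp]: "fv (eqt \<sigma> s t) = fvt s \<union> fvt t"
  by (induction \<sigma> arbitrary: s t) auto

lemma incr_lct: "lct 0 t \<Longrightarrow> incr t = t"
  by (induction t) auto

lemma opent_lct: "lct k t \<Longrightarrow> opent k u t = t"
  by (induction t) auto

lemma opn_eqt:
  "lct (Suc k) s \<Longrightarrow> lct (Suc k) t \<Longrightarrow> lct 0 u \<Longrightarrow>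
    opn k u (eqt \<sigma> s t) = eqt \<sigma> (opent k u s) (opent k u t)"
proof (induction \<sigma> arbitrary: k s t)
  case (Fn \<sigma> \<tau>)
  have *: "opent (Suc k) u (incr v) = incr (opent k u v)" if "lct (Suc k) v" for v
    using that \<open>lct 0 u\<close> by (induction v) (auto simp: incr_lct)
  show ?case using Fn by (simp add: lct_incr *)
qed auto

text \<open>Each arrow of the type costs one use of extensionality. Afterwards the axioms that speak
  of extensional equality serve as plain equations in the model.\<close>

lemma sat_eqt:
  assumes "extensional M"
  shows "tyof (map fst b) s = Some \<sigma> \<Longrightarrow> tyof (map fst b) t = Some \<sigma> \<Longrightarrow>
    sat M e b (eqt \<sigma> s t) \<longleftrightarrow> sem M e b s = sem M e b t"
proof (induction \<sigma> arbitrary: b s t)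
  case (Fn \<sigma> \<tau>)
  have "sat M e b (eqt (\<sigma> \<rightarrow> \<tau>) s t) \<longleftrightarrow>
    (\<forall>d. ap M (\<sigma> \<rightarrow> \<tau>) (sem M e b s) d = ap M (\<sigma> \<rightarrow> \<tau>) (sem M e b t) d)"
    using Fn by simp
  then show ?case using assms unfolding extensional_def by metis
qed simp

section \<open>Completeness\<close>

instance ty :: countable by countable_datatype
instance cst :: countable by countable_datatype
instance tm :: countable by countable_datatype
instance fm :: countable by countable_datatype

lemma wf_Neg [simp]: "wf \<Delta> (\<^bold>\<not> \<phi>) \<longleftrightarrow> wf \<Delta> \<phi>"
  by (simp add: Neg_def)

lemma fv_Neg [simp]: "fv (\<^bold>\<not> \<phi>) = fv \<phi>"
  by (simp add: Neg_def)

section \<open>Provability over a closed theory, and its Henkin extensions\<close>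

locale closed_theory =
  fixes \<Gamma> :: "fm set"
  assumes sentences: "\<gamma> \<in> \<Gamma> \<Longrightarrow> sentence \<gamma>"
begin

text \<open>
  All hypotheses beyond \<open>\<Gamma>\<close> are moved into the formula. As \<open>\<Gamma>\<close> is closed, generalisation is
  unrestricted, and no weakening with new eigenvariables is ever needed.
\<close>

inductive prv :: "fm set \<Rightarrow> fm \<Rightarrow> bool" for S where
  Ax: "\<Gamma> \<turnstile> \<phi> \<Longrightarrow> wf [] \<phi> \<Longrightarrow> prv S \<phi>"
| Hyp: "\<phi> \<in> S \<Longrightarrow> wf [] \<phi> \<Longrightarrow> prv S \<phi>"
| MP: "prv S (\<phi> \<^bold>\<longrightarrow> \<psi>) \<Longrightarrow> prv S \<phi> \<Longrightarrow> prv S \<psi>"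

lemma prv_wf: "prv S \<phi> \<Longrightarrow> wf [] \<phi>"
  by (induction rule: prv.induct) auto

lemma prv_empty: "prv {} \<phi> \<Longrightarrow> \<Gamma> \<turnstile> \<phi>"
  by (induction rule: prv.induct) (auto intro: derives.intros)

lemma prv_mono: "prv S \<phi> \<Longrightarrow> S \<subseteq> S' \<Longrightarrow> prv S' \<phi>"
  by (induction rule: prv.induct) (auto intro: prv.intros)

lemma prv_K: "wf [] \<phi> \<Longrightarrow> wf [] \<psi> \<Longrightarrow> prv S (\<phi> \<^bold>\<longrightarrow> \<psi> \<^bold>\<longrightarrow> \<phi>)"
  by (rule Ax, rule derives.ImpI, rule derives.ImpI, rule derives.Assm) auto

lemma prv_S:
  assumes "wf [] \<phi>" "wf [] \<psi>" "wf [] \<chi>"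
  shows "prv S ((\<phi> \<^bold>\<longrightarrow> \<psi> \<^bold>\<longrightarrow> \<chi>) \<^bold>\<longrightarrow> (\<phi> \<^bold>\<longrightarrow> \<psi>) \<^bold>\<longrightarrow> \<phi> \<^bold>\<longrightarrow> \<chi>)"
proof (rule Ax)
  let ?G = "insert \<phi> (insert (\<phi> \<^bold>\<longrightarrow> \<psi>) (insert (\<phi> \<^bold>\<longrightarrow> \<psi> \<^bold>\<longrightarrow> \<chi>) \<Gamma>))"
  have "?G \<turnstile> \<phi> \<^bold>\<longrightarrow> \<psi> \<^bold>\<longrightarrow> \<chi>" "?G \<turnstile> \<phi> \<^bold>\<longrightarrow> \<psi>" "?G \<turnstile> \<phi>"
    using assms by (auto intro: derives.Assm)
  then have "?G \<turnstile> \<chi>" by (blast intro: derives.ImpE)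
  then show "\<Gamma> \<turnstile> (\<phi> \<^bold>\<longrightarrow> \<psi> \<^bold>\<longrightarrow> \<chi>) \<^bold>\<longrightarrow> (\<phi> \<^bold>\<longrightarrow> \<psi>) \<^bold>\<longrightarrow> \<phi> \<^bold>\<longrightarrow> \<chi>"
    using assms by (auto intro!: derives.ImpI)
qed (use assms in auto)

lemma prv_DN:
  assumes "wf [] \<phi>"
  shows "prv S (\<^bold>\<not> \<^bold>\<not> \<phi> \<^bold>\<longrightarrow> \<phi>)"
proof (rule Ax)
  let ?G = "insert (\<^bold>\<not> \<phi>) (insert (\<^bold>\<not> \<^bold>\<not> \<phi>) \<Gamma>)"
  have "?G \<turnstile> \<^bold>\<not> \<^bold>\<not> \<phi>" "?G \<turnstile> \<^bold>\<not> \<phi>"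
    using assms by (auto intro: derives.Assm)
  then have "?G \<turnstile> Bot" unfolding Neg_def by (blast intro: derives.ImpE)
  then show "\<Gamma> \<turnstile> \<^bold>\<not> \<^bold>\<not> \<phi> \<^bold>\<longrightarrow> \<phi>"
    using assms by (intro derives.ImpI derives.Classical[of \<phi>]) auto
qed (use assms in auto)

lemma prv_refl: "wf [] \<phi> \<Longrightarrow> prv S (\<phi> \<^bold>\<longrightarrow> \<phi>)"
  by (rule Ax, rule derives.ImpI, rule derives.Assm) auto

text \<open>Modus ponens is the only proper rule of \<open>prv\<close>, so the usual argument with
  the axioms K and S works. Generalisation is not a rule, hence there is no side condition on
  variables.\<close>

lemma deduction: "prv (insert \<chi> S) \<phi> \<Longrightarrow> wf [] \<chi> \<Longrightarrow> prv S (\<chi> \<^bold>\<longrightarrow> \<phi>)"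
proof (induction rule: prv.induct)
  case (Ax \<phi>)
  then show ?case using prv_K prv.Ax prv.MP by blast
next
  case (Hyp \<phi>)
  then show ?case using prv_K prv.Hyp prv.MP prv_refl by blast
next
  case (MP \<phi> \<psi>)
  then have "wf [] \<phi>" "wf [] \<psi>" using prv_wf by force+
  then show ?case using MP prv_S[of \<chi> \<phi> \<psi> S] prv.MP by blast
qed

lemma contradiction: "prv (insert (\<^bold>\<not> \<phi>) S) Bot \<Longrightarrow> wf [] \<phi> \<Longrightarrow> prv S \<phi>"
  using deduction[of "\<^bold>\<not> \<phi>" S Bot] prv_DN[of \<phi> S] MP unfolding Neg_def by fastforce

text \<open>\<open>AllE\<close> speaks of named variables. A name fresh for the body turns
  \<open>All\<close> into \<open>Forall\<close>, and substituting for that name is the same as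
  opening.\<close>

lemma prv_inst:
  assumes "prv S (All \<sigma> \<psi>)" "tyof [] t = Some \<sigma>"
  shows "prv S (opn 0 t \<psi>)"
proof -
  have w: "wf [\<sigma>] \<psi>" using prv_wf[OF assms(1)] by simp
  obtain s where s: "(s, \<sigma>) \<notin> fv \<psi>" using fresh_var[of "fv \<psi>"] by auto
  let ?x = "(s, \<sigma>)"
  have eq: "Forall ?x (opn 0 (Free ?x) \<psi>) = All \<sigma> \<psi>"
    by (simp add: Forall_def close_opn s)
  have "wf [] (opn 0 (Free ?x) \<psi>)"
    using w wf_opn[of "Free ?x" \<sigma> "[]" \<psi>] by simp
  then have "insert (All \<sigma> \<psi>) \<Gamma> \<turnstile> subst ?x t (opn 0 (Free ?x) \<psi>)"
    using w assms(2) by (intro derives.AllE) (auto simp: eq intro: derives.Assm)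
  then have "\<Gamma> \<turnstile> All \<sigma> \<psi> \<^bold>\<longrightarrow> opn 0 t \<psi>"
    using w s by (auto simp: subst_opn intro: derives.ImpI)
  moreover have "wf [] (opn 0 t \<psi>)"
    using w assms(2) wf_opn[of t \<sigma> "[]" \<psi>] by simp
  ultimately have "prv S (All \<sigma> \<psi> \<^bold>\<longrightarrow> opn 0 t \<psi>)" using w by (auto intro: Ax)
  then show ?thesis using assms(1) MP by blast
qed

text \<open>Hypotheses without \<open>x\<close> are moved one by one to the left of an implication
  and brought back behind the quantifier. In the base case only closed formulas are left, and
  \<open>AllI\<close> applies.\<close>

lemma generalisation:
  assumes "finite S"
  shows "prv S \<phi> \<Longrightarrow> (\<And>\<chi>. \<chi> \<in> S \<Longrightarrow> wf [] \<chi> \<and> x \<notin> fv \<chi>) \<Longrightarrow> prv S (Forall x \<phi>)"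
  using assms
proof (induction S arbitrary: \<phi> rule: finite_induct)
  case empty
  have "x \<notin> \<Union> (fv ` \<Gamma>)" using sentences by (auto simp: sentence_def)
  then have "\<Gamma> \<turnstile> Forall x \<phi>" using prv_empty[OF empty(1)] by (intro derives.AllI)
  then show ?case using Ax wf_Forall prv_wf empty(1) by blast
next
  case (insert \<chi> S)
  have w: "wf [] \<chi>" "x \<notin> fv \<chi>" "wf [] \<phi>" using insert.prems prv_wf by auto
  have "prv S (\<chi> \<^bold>\<longrightarrow> \<phi>)" using insert.prems deduction by blast
  then have 1: "prv S (Forall x (\<chi> \<^bold>\<longrightarrow> \<phi>))" using insert by auto
  let ?G = "insert \<chi> (insert (Forall x (\<chi> \<^bold>\<longrightarrow> \<phi>)) \<Gamma>)"
  have wF: "wf [] (Forall x (\<chi> \<^bold>\<longrightarrow> \<phi>))" using w by (intro wf_Forall) auto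
  then have "?G \<turnstile> subst x (Free x) (\<chi> \<^bold>\<longrightarrow> \<phi>)" using w
    by (intro derives.AllE) (auto intro: derives.Assm)
  moreover have "?G \<turnstile> \<chi>" using w by (auto intro: derives.Assm)
  ultimately have "?G \<turnstile> \<phi>" by (auto intro: derives.ImpE)
  moreover have "x \<notin> \<Union> (fv ` ?G)" using sentences w by (auto simp: sentence_def)
  ultimately have "?G \<turnstile> Forall x \<phi>" by (rule derives.AllI)
  then have "\<Gamma> \<turnstile> Forall x (\<chi> \<^bold>\<longrightarrow> \<phi>) \<^bold>\<longrightarrow> \<chi> \<^bold>\<longrightarrow> Forall x \<phi>"
    using wF w by (auto intro!: derives.ImpI)
  then have "prv S (Forall x (\<chi> \<^bold>\<longrightarrow> \<phi>) \<^bold>\<longrightarrow> \<chi> \<^bold>\<longrightarrow> Forall x \<phi>)"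
    using wF w wf_Forall[of \<phi> x] by (intro Ax) auto
  then have "prv S (\<chi> \<^bold>\<longrightarrow> Forall x \<phi>)" using 1 MP by blast
  then show ?case using w prv_mono[of S _ "insert \<chi> S"] Hyp[of \<chi> "insert \<chi> S"] MP by blast
qed

definition con :: "fm set \<Rightarrow> bool" where "con S \<longleftrightarrow> \<not> prv S Bot"

definition new_var :: "fm set \<Rightarrow> ty \<Rightarrow> var" where
  "new_var S \<sigma> = (SOME x. x \<notin> \<Union> (fv ` S) \<and> snd x = \<sigma>)"

lemma new_var:
  assumes "finite S"
  shows "new_var S \<sigma> \<notin> \<Union> (fv ` S)" "snd (new_var S \<sigma>) = \<sigma>"
proof -
  have "finite (\<Union> (fv ` S))" using assms by simp
  then obtain s where "(s, \<sigma>) \<notin> \<Union> (fv ` S)" using fresh_var by blast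
  then have "\<exists>x. x \<notin> \<Union> (fv ` S) \<and> snd x = \<sigma>" by fastforce
  from someI_ex[OF this] show "new_var S \<sigma> \<notin> \<Union> (fv ` S)" "snd (new_var S \<sigma>) = \<sigma>"
    unfolding new_var_def by auto
qed

text \<open>Free variables serve as Henkin constants: every stage is finite and there are infinitely
  many names of each type, so the language need not be extended. A negated universal formula enters
  together with a counterexample named by a new variable.\<close>

definition add :: "fm set \<Rightarrow> fm \<Rightarrow> fm set" where
  "add S \<phi> = (if wf [] \<phi> \<and> con (insert \<phi> S) then insert \<phi> S \<union>
     {\<^bold>\<not> opn 0 (Free (new_var (insert \<phi> S) \<sigma>)) \<psi> |\<sigma> \<psi>. \<phi> = (\<^bold>\<not> All \<sigma> \<psi>)} else S)"

lemma add_props: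
  assumes "finite S" "con S" "\<And>\<chi>. \<chi> \<in> S \<Longrightarrow> wf [] \<chi>"
  shows "finite (add S \<phi>) \<and> con (add S \<phi>) \<and> (\<forall>\<chi> \<in> add S \<phi>. wf [] \<chi>) \<and> S \<subseteq> add S \<phi>"
proof (cases "wf [] \<phi> \<and> con (insert \<phi> S)")
  case True
  let ?S = "insert \<phi> S"
  show ?thesis
  proof (cases "\<exists>\<sigma> \<psi>. \<phi> = (\<^bold>\<not> All \<sigma> \<psi>)")
    case all: True
    then obtain \<sigma> \<psi> where \<phi>: "\<phi> = (\<^bold>\<not> All \<sigma> \<psi>)" by (elim exE)
    define x where "x = new_var ?S \<sigma>"
    have x: "x \<notin> \<Union> (fv ` ?S)" "snd x = \<sigma>" using new_var[of ?S \<sigma>] assms(1) by (simp_all add: x_def)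
    have e: "add S \<phi> = insert (\<^bold>\<not> opn 0 (Free x) \<psi>) ?S"
      using True by (auto simp: add_def \<phi> x_def Neg_def)
    have w: "wf [\<sigma>] \<psi>" using True \<phi> by simp
    have wo: "wf [] (opn 0 (Free x) \<psi>)"
      using w wf_opn[of "Free x" \<sigma> "[]" \<psi>] x by simp
    have "con (add S \<phi>)" unfolding con_def
    proof
      assume "prv (add S \<phi>) Bot"
      \<comment> \<open>If the counterexample made the set inconsistent, the instance would be
        provable for a variable that no hypothesis contains, hence the universal formula as well,
        against \<open>\<phi>\<close>.\<close>
      then have "prv ?S (opn 0 (Free x) \<psi>)" using e contradiction wo by auto
      then have "prv ?S (Forall x (opn 0 (Free x) \<psi>))"
        using assms True x by (intro generalisation) auto
      then have "prv ?S (All \<sigma> \<psi>)" using x \<phi> by (simp add: Forall_def close_opn)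
      moreover have "prv ?S (\<^bold>\<not> All \<sigma> \<psi>)" using True \<phi> by (intro Hyp) auto
      ultimately have "prv ?S Bot" unfolding Neg_def using MP by blast
      then show False using True con_def by blast
    qed
    then show ?thesis using e wo assms True by auto
  next
    case False
    then have "add S \<phi> = ?S" using True by (auto simp: add_def)
    then show ?thesis using assms True by auto
  qed
next
  case False
  then show ?thesis using assms by (auto simp: add_def)
qed

primrec stage :: "fm \<Rightarrow> nat \<Rightarrow> fm set" where
  "stage \<chi> 0 = {\<^bold>\<not> \<chi>}"
| "stage \<chi> (Suc n) = add (stage \<chi> n) (from_nat n)"

text \<open>Lindenbaum's construction along the enumeration \<open>from_nat\<close> of all formulas.
  A proof uses finitely many hypotheses, so provability from the union is provability from some
  stage, and consistency survives.\<close>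

lemma Henkin_extension:
  assumes w: "wf [] \<chi>" and nd: "\<not> (\<Gamma> \<turnstile> \<chi>)"
  obtains T where "\<And>\<phi>. prv T \<phi> \<longleftrightarrow> \<phi> \<in> T \<and> wf [] \<phi>" and "Bot \<notin> T" and "(\<^bold>\<not> \<chi>) \<in> T"
    and "\<And>\<phi>. wf [] \<phi> \<Longrightarrow> \<phi> \<in> T \<or> (\<^bold>\<not> \<phi>) \<in> T"
    and "\<And>\<sigma> \<psi>. (\<^bold>\<not> All \<sigma> \<psi>) \<in> T \<Longrightarrow> \<exists>t. tyof [] t = Some \<sigma> \<and> (\<^bold>\<not> opn 0 t \<psi>) \<in> T"
proof -
  let ?s = "stage \<chi>"
  define T where "T = (\<Union>n. ?s n)"
  have st: "finite (?s n) \<and> con (?s n) \<and> (\<forall>\<chi> \<in> ?s n. wf [] \<chi>)" for n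
  proof (induction n)
    case 0
    have "con {\<^bold>\<not> \<chi>}"
      using nd contradiction[of \<chi> "{}"] w prv_empty by (auto simp: con_def)
    then show ?case using w by simp
  next
    case (Suc n)
    then show ?case using add_props[of "?s n"] by simp
  qed
  have step: "?s n \<subseteq> ?s (Suc n)" for n
    using add_props[of "?s n"] st by simp
  have mono: "m \<le> n \<Longrightarrow> ?s m \<subseteq> ?s n" for m n
    using lift_Suc_mono_le[of ?s m n] step by blast
  have sT: "?s n \<subseteq> T" for n by (auto simp: T_def)
  have wT: "wf [] \<phi>" if "\<phi> \<in> T" for \<phi> using that st by (auto simp: T_def)
  have fin: "\<exists>n. prv (?s n) \<phi>" if "prv T \<phi>" for \<phi> using that
  proof (induction rule: prv.induct)
    case (MP \<phi> \<psi>)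
    then obtain m n where "prv (?s m) (\<phi> \<^bold>\<longrightarrow> \<psi>)" "prv (?s n) \<phi>" by blast
    then have "prv (?s (max m n)) (\<phi> \<^bold>\<longrightarrow> \<psi>)" "prv (?s (max m n)) \<phi>"
      using prv_mono mono max.cobounded1 max.cobounded2 by metis+
    then show ?case using prv.MP by blast
  qed (auto simp: T_def intro: prv.intros)
  have cT: "\<not> prv T Bot" using fin st con_def by blast
  \<comment> \<open>A formula is treated at the stage given by its code: it is added there, or the
    formulas already present refute it.\<close>
  have dec: "\<phi> \<in> T \<or> prv T (\<^bold>\<not> \<phi>)" if "wf [] \<phi>" for \<phi>
  proof (cases "con (insert \<phi> (?s (to_nat \<phi>)))")
    case True
    then have "\<phi> \<in> ?s (Suc (to_nat \<phi>))" using that by (simp add: add_def)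
    then show ?thesis using sT by blast
  next
    case False
    then have "prv (?s (to_nat \<phi>)) (\<^bold>\<not> \<phi>)"
      unfolding con_def Neg_def using deduction that by blast
    then show ?thesis using prv_mono[OF _ sT] by blast
  qed
  have cl: "\<phi> \<in> T" if "prv T \<phi>" for \<phi>
  proof (rule ccontr)
    assume "\<phi> \<notin> T"
    then have "prv T (\<^bold>\<not> \<phi>)" using dec prv_wf that by blast
    then show False using that MP cT unfolding Neg_def by blast
  qed
  show thesis
  proof (rule that)
    show "prv T \<phi> \<longleftrightarrow> \<phi> \<in> T \<and> wf [] \<phi>" for \<phi> using cl wT Hyp by blast
    show "Bot \<notin> T" using cT Hyp by auto
    show "(\<^bold>\<not> \<chi>) \<in> T" unfolding T_def using stage.simps(1) by blast
    show "\<phi> \<in> T \<or> (\<^bold>\<not> \<phi>) \<in> T" if "wf [] \<phi>" for \<phi> using dec cl that by blast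
    show "\<exists>t. tyof [] t = Some \<sigma> \<and> (\<^bold>\<not> opn 0 t \<psi>) \<in> T" if a: "(\<^bold>\<not> All \<sigma> \<psi>) \<in> T" for \<sigma> \<psi>
    proof -
      let ?\<phi> = "\<^bold>\<not> All \<sigma> \<psi>"
      define n where "n = to_nat ?\<phi>"
      have w: "wf [] ?\<phi>" using wT a by blast
      have "con (insert ?\<phi> (?s n))" unfolding con_def
        using cT prv_mono[of "insert ?\<phi> (?s n)" Bot T] a sT[of n] by blast
      then have "(\<^bold>\<not> opn 0 (Free (new_var (insert ?\<phi> (?s n)) \<sigma>)) \<psi>) \<in> ?s (Suc n)"
        using w by (auto simp: add_def n_def)
      then have "(\<^bold>\<not> opn 0 (Free (new_var (insert ?\<phi> (?s n)) \<sigma>)) \<psi>) \<in> T" using sT by blast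
      moreover have "finite (insert ?\<phi> (?s n))" using st by simp
      ultimately show ?thesis using new_var(2) by (intro exI conjI) auto
    qed
  qed
qed

end

section \<open>The term model of a Henkin theory\<close>

locale henkin =
  fixes T :: "fm set"
  assumes T_Bot: "Bot \<notin> T"
    and T_Imp: "wf [] \<phi> \<Longrightarrow> wf [] \<psi> \<Longrightarrow> (\<phi> \<^bold>\<longrightarrow> \<psi>) \<in> T \<longleftrightarrow> (\<phi> \<in> T \<longrightarrow> \<psi> \<in> T)"
    and T_All: "wf [\<sigma>] \<psi> \<Longrightarrow> All \<sigma> \<psi> \<in> T \<longleftrightarrow> (\<forall>t. tyof [] t = Some \<sigma> \<longrightarrow> opn 0 t \<psi> \<in> T)"
    and T_refl: "tyof [] t = Some Nt \<Longrightarrow> (t \<^bold>= t) \<in> T"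
    and T_subst: "(s \<^bold>= t) \<in> T \<Longrightarrow> subst x s \<phi> \<in> T \<Longrightarrow> wf [] \<phi> \<Longrightarrow> snd x = Nt \<Longrightarrow>
      tyof [] s = Some Nt \<Longrightarrow> tyof [] t = Some Nt \<Longrightarrow> subst x t \<phi> \<in> T"
    and T_basic: "basic_axioms \<subseteq> T"
    and T_comb: "combinator_axioms \<subseteq> T"
    and T_ext: "extensionality_axioms \<subseteq> T"
begin

lemma T_AllD: "All \<sigma> \<psi> \<in> T \<Longrightarrow> wf [\<sigma>] \<psi> \<Longrightarrow> tyof [] t = Some \<sigma> \<Longrightarrow> opn 0 t \<psi> \<in> T"
  using T_All by blast

text \<open>Universal formulas in \<open>T\<close> are governed by their term instances, so
  extensional equality of functions can be tested argument by argument, with terms as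
  arguments.\<close>

lemma eqt_Fn:
  assumes "tyof [] s = Some (\<sigma> \<rightarrow> \<tau>)" "tyof [] t = Some (\<sigma> \<rightarrow> \<tau>)"
  shows "eqt (\<sigma> \<rightarrow> \<tau>) s t \<in> T \<longleftrightarrow> (\<forall>u. tyof [] u = Some \<sigma> \<longrightarrow> eqt \<tau> (s \<cdot> u) (t \<cdot> u) \<in> T)"
proof -
  have l: "lct k s" "lct k t" for k using assms tyof_lct0 lct_mono by blast+
  have "wf [\<sigma>] (eqt \<tau> (s \<cdot> Bnd 0) (t \<cdot> Bnd 0))"
    using tyof_Nil_append[OF assms(1)] tyof_Nil_append[OF assms(2)] by (intro wf_eqt) auto
  moreover have "opn 0 u (eqt \<tau> (s \<cdot> Bnd 0) (t \<cdot> Bnd 0)) = eqt \<tau> (s \<cdot> u) (t \<cdot> u)"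
    if "tyof [] u = Some \<sigma>" for u
    using tyof_lct0[OF that] by (simp add: opn_eqt opent_lct l)
  ultimately show ?thesis by (simp add: incr_lct l T_All)
qed

lemma eqt_refl: "tyof [] s = Some \<sigma> \<Longrightarrow> eqt \<sigma> s s \<in> T"
  by (induction \<sigma> arbitrary: s) (auto simp: T_refl eqt_Fn simp del: eqt.simps(2))

lemma eqt_sym: "eqt \<sigma> s t \<in> T \<Longrightarrow> tyof [] s = Some \<sigma> \<Longrightarrow> tyof [] t = Some \<sigma> \<Longrightarrow> eqt \<sigma> t s \<in> T"
proof (induction \<sigma> arbitrary: s t)
  case Nt
  obtain x where x: "(x, Nt) \<notin> fvt s" using fresh_var[of "fvt s"] by auto
  have s: "substt (x, Nt) u s = s" for u
    using x by (induction s) auto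
  show ?case using T_subst[of s t "(x, Nt)" "Free (x, Nt) \<^bold>= s"] Nt by (simp add: s T_refl)
qed (auto simp: eqt_Fn simp del: eqt.simps(2))

lemma eqt_trans:
  "eqt \<sigma> s t \<in> T \<Longrightarrow> eqt \<sigma> t u \<in> T \<Longrightarrow> tyof [] s = Some \<sigma> \<Longrightarrow> tyof [] t = Some \<sigma> \<Longrightarrow>
    tyof [] u = Some \<sigma> \<Longrightarrow> eqt \<sigma> s u \<in> T"
proof (induction \<sigma> arbitrary: s t u)
  case Nt
  obtain x where x: "(x, Nt) \<notin> fvt s" using fresh_var[of "fvt s"] by auto
  have s: "substt (x, Nt) u s = s" for u
    using x by (induction s) auto
  show ?case using T_subst[of t u "(x, Nt)" "s \<^bold>= Free (x, Nt)"] Nt by (simp add: s)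
next
  case (Fn \<sigma> \<tau>)
  show ?case using Fn.prems Fn.IH(2) by (simp add: eqt_Fn del: eqt.simps(2)) (meson tyof_App)
qed

lemma closet_incr: "closet (Suc k) x (incr t) = incr (closet k x t)"
  by (induction t) auto

lemma close_eqt: "close k x (eqt \<sigma> s t) = eqt \<sigma> (closet k x s) (closet k x t)"
  by (induction \<sigma> arbitrary: k s t) (auto simp: closet_incr)

text \<open>This is where the extensionality axioms enter: they make extensional equality a
  congruence in the argument position, whereas in the function position \<open>eqt_Fn\<close> does
  so.\<close>

lemma eqt_cong2:
  assumes "tyof [] s = Some \<rho>" "tyof [] t = Some \<rho>" "tyof [] F = Some (\<rho> \<rightarrow> \<tau>)" "eqt \<rho> s t \<in> T"
  shows "eqt \<tau> (F \<cdot> s) (F \<cdot> t) \<in> T"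
proof -
  have l: "lct k s" "lct k t" "lct k F" for k using assms tyof_lct0 lct_mono by blast+
  note ty = assms(1-3)[THEN tyof_Nil_append]
  \<comment> \<open>The axiom in de Bruijn form; its three quantifiers are instantiated from the
    outside inwards.\<close>
  have "All \<rho> (All \<rho> (All (\<rho> \<rightarrow> \<tau>) (eqt \<rho> (Bnd 2) (Bnd 1) \<^bold>\<longrightarrow> eqt \<tau> (Bnd 0 \<cdot> Bnd 2) (Bnd 0 \<cdot> Bnd 1)))) \<in> T"
    using T_ext unfolding extensionality_axioms_def
    by (auto simp: forall_def Forall_def close_eqt numeral_2_eq_2)
  then have "All \<rho> (All (\<rho> \<rightarrow> \<tau>) (eqt \<rho> s (Bnd 1) \<^bold>\<longrightarrow> eqt \<tau> (Bnd 0 \<cdot> s) (Bnd 0 \<cdot> Bnd 1))) \<in> T"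
    using T_AllD[OF _ _ assms(1)] by (fastforce simp: wf_eqt opn_eqt l ty numeral_2_eq_2)
  then have "All (\<rho> \<rightarrow> \<tau>) (eqt \<rho> s t \<^bold>\<longrightarrow> eqt \<tau> (Bnd 0 \<cdot> s) (Bnd 0 \<cdot> t)) \<in> T"
    using T_AllD[OF _ _ assms(2)]
    by (fastforce simp: wf_eqt opn_eqt l opent_lct ty)
  then have "(eqt \<rho> s t \<^bold>\<longrightarrow> eqt \<tau> (F \<cdot> s) (F \<cdot> t)) \<in> T"
    using T_AllD[OF _ _ assms(3)]
    by (fastforce simp: wf_eqt opn_eqt l opent_lct ty)
  then show ?thesis using assms by (simp add: T_Imp wf_eqt)
qed

lemma eqt_cong:
  assumes "tyof [] s = Some (\<rho> \<rightarrow> \<tau>)" "tyof [] s' = Some (\<rho> \<rightarrow> \<tau>)" "tyof [] t = Some \<rho>" "tyof [] t' = Some \<rho>"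
    and "eqt (\<rho> \<rightarrow> \<tau>) s s' \<in> T" "eqt \<rho> t t' \<in> T"
  shows "eqt \<tau> (s \<cdot> t) (s' \<cdot> t') \<in> T"
proof -
  have "eqt \<tau> (s \<cdot> t) (s' \<cdot> t) \<in> T" using assms eqt_Fn by blast
  moreover have "eqt \<tau> (s' \<cdot> t) (s' \<cdot> t') \<in> T" using assms eqt_cong2 by blast
  ultimately show ?thesis using assms eqt_trans tyof_App by blast
qed

lemma eqt_K:
  assumes "tyof [] s = Some \<sigma>" "tyof [] t = Some \<tau>"
  shows "eqt \<sigma> (Cst (Kc \<sigma> \<tau>) \<cdot> s \<cdot> t) s \<in> T"
proof -
  have l: "lct k s" "lct k t" for k using assms tyof_lct0 lct_mono by blast+
  note ty = assms[THEN tyof_Nil_append]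
  have "All \<sigma> (All \<tau> (eqt \<sigma> (Cst (Kc \<sigma> \<tau>) \<cdot> Bnd 1 \<cdot> Bnd 0) (Bnd 1))) \<in> T"
    using T_comb unfolding combinator_axioms_def
    by (auto simp: forall_def Forall_def close_eqt)
  then have "All \<tau> (eqt \<sigma> (Cst (Kc \<sigma> \<tau>) \<cdot> s \<cdot> Bnd 0) s) \<in> T"
    using T_AllD[OF _ _ assms(1)] by (fastforce simp: wf_eqt opn_eqt l ty)
  then show ?thesis
    using T_AllD[OF _ _ assms(2)] by (fastforce simp: wf_eqt opn_eqt l opent_lct ty)
qed

text \<open>Makes each quotient infinite, so that every type can be interpreted by the same carrier.
  At type 0 the successor axioms separate the numerals; at a function type, constant functions with
  different values are different.\<close>

lemma numerals_distinct:
  "\<exists>f :: nat \<Rightarrow> tm. (\<forall>n. tyof [] (f n) = Some \<sigma>) \<and> (\<forall>m n. eqt \<sigma> (f m) (f n) \<in> T \<longrightarrow> m = n)"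
proof (induction \<sigma>)
  case Nt
  define f where "f = rec_nat \<^bold>0 (\<lambda>_ t. t \<^bold>+ \<^bold>1)"
  have f: "f 0 = \<^bold>0" "f (Suc n) = f n \<^bold>+ \<^bold>1" for n by (auto simp: f_def)
  have ty: "tyof [] (f n) = Some Nt" for n by (induction n) (auto simp: f plus_tm_def)
  have l: "lct k (f n)" for k n using ty tyof_lct0 lct_mono by blast
  have "All Nt (Bnd 0 \<^bold>+ \<^bold>1 \<^bold>= \<^bold>0 \<^bold>\<longrightarrow> Bot) \<in> T"
    using T_basic unfolding basic_axioms_def
    by (auto simp: forall_def Forall_def Neg_def plus_tm_def)
  then have "(f n \<^bold>+ \<^bold>1 \<^bold>= \<^bold>0 \<^bold>\<longrightarrow> Bot) \<in> T" for n
    using T_AllD[OF _ _ ty] by (fastforce simp: plus_tm_def)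
  then have 0: "(f n \<^bold>+ \<^bold>1 \<^bold>= \<^bold>0) \<notin> T" for n using T_Bot ty by (auto simp: T_Imp plus_tm_def)
  have "All Nt (All Nt (Bnd 1 \<^bold>+ \<^bold>1 \<^bold>= Bnd 0 \<^bold>+ \<^bold>1 \<^bold>\<longrightarrow> Bnd 1 \<^bold>= Bnd 0)) \<in> T"
    using T_basic unfolding basic_axioms_def
    by (auto simp: forall_def Forall_def Neg_def plus_tm_def)
  then have "All Nt (f m \<^bold>+ \<^bold>1 \<^bold>= Bnd 0 \<^bold>+ \<^bold>1 \<^bold>\<longrightarrow> f m \<^bold>= Bnd 0) \<in> T" for m
    using T_AllD[OF _ _ ty[of m]] by (fastforce simp: plus_tm_def)
  then have "(f m \<^bold>+ \<^bold>1 \<^bold>= f n \<^bold>+ \<^bold>1 \<^bold>\<longrightarrow> f m \<^bold>= f n) \<in> T" for m n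
    using T_AllD[OF _ _ ty[of n]] by (fastforce simp: plus_tm_def opent_lct l tyof_Nil_append[OF ty])
  then have 1: "(f m \<^bold>+ \<^bold>1 \<^bold>= f n \<^bold>+ \<^bold>1) \<in> T \<Longrightarrow> (f m \<^bold>= f n) \<in> T" for m n
    using ty by (auto simp: T_Imp plus_tm_def)
  have "(f m \<^bold>= f n) \<in> T \<Longrightarrow> m = n" for m n
  proof (induction m arbitrary: n)
    case 0
    then have "(f n \<^bold>= \<^bold>0) \<in> T" using eqt_sym[of Nt "f 0" "f n"] ty by (simp add: f(1))
    then show ?case using \<open>\<And>n. (f n \<^bold>+ \<^bold>1 \<^bold>= \<^bold>0) \<notin> T\<close> by (cases n) (auto simp: f)
  next
    case (Suc m)
    then show ?case using 0 1 by (cases n) (auto simp: f)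
  qed
  then show ?case using ty by (intro exI[of _ f]) auto
next
  case (Fn \<sigma> \<tau>)
  then obtain f :: "nat \<Rightarrow> tm" where ty: "\<And>n. tyof [] (f n) = Some \<tau>"
    and f: "\<And>m n. eqt \<tau> (f m) (f n) \<in> T \<Longrightarrow> m = n" by blast
  let ?g = "\<lambda>n. Cst (Kc \<tau> \<sigma>) \<cdot> f n"
  have tg: "tyof [] (?g n) = Some (\<sigma> \<rightarrow> \<tau>)" for n using ty by simp
  have "m = n" if "eqt (\<sigma> \<rightarrow> \<tau>) (?g m) (?g n) \<in> T" for m n
  proof -
    \<comment> \<open>Any term of type \<open>\<sigma>\<close> would do as the argument at which the
      constant functions are compared.\<close>
    let ?u = "Free ([], \<sigma>)"
    have u: "tyof [] ?u = Some \<sigma>" by simp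
    have t: "tyof [] (?g n \<cdot> ?u) = Some \<tau>" for n using ty by simp
    have "eqt \<tau> (?g m \<cdot> ?u) (?g n \<cdot> ?u) \<in> T" using that eqt_Fn[OF tg tg] u by blast
    then have "eqt \<tau> (?g m \<cdot> ?u) (f n) \<in> T" using eqt_K[OF ty u] eqt_trans t ty by blast
    then have "eqt \<tau> (f m) (f n) \<in> T" using eqt_sym[OF eqt_K[OF ty u] t ty] eqt_trans t ty by blast
    then show ?thesis using f by blast
  qed
  then show ?case using tg by (intro exI[of _ ?g]) blast
qed

end

text \<open>A copy of the naturals, because it is to carry the arithmetic of a possibly nonstandard
  model as a class instance, and \<open>nat\<close> already has the standard one.\<close>

datatype elem = Elem nat

context henkin
begin

definition cl :: "ty \<Rightarrow> tm \<Rightarrow> tm set" where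
  "cl \<sigma> t = {s. tyof [] s = Some \<sigma> \<and> eqt \<sigma> t s \<in> T}"
definition Q :: "ty \<Rightarrow> tm set set" where
  "Q \<sigma> = cl \<sigma> ` {t. tyof [] t = Some \<sigma>}"
text \<open>The numbering uses up all naturals, so at every type each element of the carrier is the
  value of some term, and quantifiers may range over the whole carrier.\<close>

definition val :: "ty \<Rightarrow> tm \<Rightarrow> elem" where
  "val \<sigma> t = Elem (to_nat_on (Q \<sigma>) (cl \<sigma> t))"
definition rep :: "ty \<Rightarrow> elem \<Rightarrow> tm" where
  "rep \<sigma> d = (SOME t. tyof [] t = Some \<sigma> \<and> val \<sigma> t = d)"

definition canon :: "elem str" where
  "canon = \<lparr>ap = \<lambda>\<rho> x y. (case \<rho> of Nt \<Rightarrow> x | Fn \<sigma> \<tau> \<Rightarrow> val \<tau> (rep \<rho> x \<cdot> rep \<sigma> y)),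
     cs = \<lambda>c. val (cst_ty c) (Cst c), ls = \<lambda>x y. (rep Nt x \<^bold>< rep Nt y) \<in> T\<rparr>"

lemma cl_eq:
  assumes "tyof [] s = Some \<sigma>" "tyof [] t = Some \<sigma>"
  shows "cl \<sigma> s = cl \<sigma> t \<longleftrightarrow> eqt \<sigma> s t \<in> T"
proof
  assume "cl \<sigma> s = cl \<sigma> t"
  moreover have "t \<in> cl \<sigma> t" using assms eqt_refl by (auto simp: cl_def)
  ultimately show "eqt \<sigma> s t \<in> T" by (auto simp: cl_def)
next
  assume "eqt \<sigma> s t \<in> T"
  then show "cl \<sigma> s = cl \<sigma> t"
    using assms eqt_sym[of \<sigma> s t] eqt_trans[of \<sigma> s t] eqt_trans[of \<sigma> t s] by (auto simp: cl_def)
qed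

lemma bij_Q: "bij_betw (to_nat_on (Q \<sigma>)) (Q \<sigma>) UNIV"
proof (rule to_nat_on_infinite)
  show "countable (Q \<sigma>)" by (simp add: Q_def)
  obtain f :: "nat \<Rightarrow> tm" where f: "\<And>n. tyof [] (f n) = Some \<sigma>" "\<And>m n. eqt \<sigma> (f m) (f n) \<in> T \<Longrightarrow> m = n"
    using numerals_distinct[of \<sigma>] by blast
  then have "inj (\<lambda>n. cl \<sigma> (f n))" by (auto intro!: injI simp: cl_eq)
  moreover have "range (\<lambda>n. cl \<sigma> (f n)) \<subseteq> Q \<sigma>" using f by (auto simp: Q_def)
  ultimately show "infinite (Q \<sigma>)" using range_inj_infinite finite_subset by blast
qed

lemma val_eq:
  assumes "tyof [] s = Some \<sigma>" "tyof [] t = Some \<sigma>"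
  shows "val \<sigma> s = val \<sigma> t \<longleftrightarrow> eqt \<sigma> s t \<in> T"
proof -
  have "cl \<sigma> s \<in> Q \<sigma>" "cl \<sigma> t \<in> Q \<sigma>" using assms by (auto simp: Q_def)
  then have "val \<sigma> s = val \<sigma> t \<longleftrightarrow> cl \<sigma> s = cl \<sigma> t"
    using bij_betw_imp_inj_on[OF bij_Q] by (auto simp: val_def dest: inj_onD)
  then show ?thesis using cl_eq assms by simp
qed

lemma rep: "tyof [] (rep \<sigma> d) = Some \<sigma>" "val \<sigma> (rep \<sigma> d) = d"
proof -
  obtain n where d: "d = Elem n" by (cases d)
  have "n \<in> to_nat_on (Q \<sigma>) ` Q \<sigma>" using bij_betw_imp_surj_on[OF bij_Q] by auto
  then have "\<exists>t. tyof [] t = Some \<sigma> \<and> val \<sigma> t = d" by (auto simp: Q_def val_def d)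
  from someI_ex[OF this] show "tyof [] (rep \<sigma> d) = Some \<sigma>" "val \<sigma> (rep \<sigma> d) = d"
    unfolding rep_def by blast+
qed

lemma rep_val: "tyof [] t = Some \<sigma> \<Longrightarrow> eqt \<sigma> (rep \<sigma> (val \<sigma> t)) t \<in> T"
  using val_eq rep by blast

text \<open>The congruence property makes application independent of the representatives chosen by
  \<open>rep\<close>.\<close>

lemma ap_canon:
  assumes "tyof [] s = Some (\<sigma> \<rightarrow> \<tau>)" "tyof [] t = Some \<sigma>"
  shows "ap canon (\<sigma> \<rightarrow> \<tau>) (val (\<sigma> \<rightarrow> \<tau>) s) (val \<sigma> t) = val \<tau> (s \<cdot> t)"
proof -
  have "eqt \<tau> (rep (\<sigma> \<rightarrow> \<tau>) (val (\<sigma> \<rightarrow> \<tau>) s) \<cdot> rep \<sigma> (val \<sigma> t)) (s \<cdot> t) \<in> T"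
    using assms rep rep_val by (blast intro: eqt_cong)
  moreover have "tyof [] (rep (\<sigma> \<rightarrow> \<tau>) d \<cdot> rep \<sigma> d') = Some \<tau>" "tyof [] (s \<cdot> t) = Some \<tau>" for d d'
    using assms rep by simp_all
  ultimately show ?thesis by (simp add: canon_def val_eq)
qed

lemma extensional_canon: "extensional canon"
  unfolding extensional_def
proof (intro allI impI)
  fix \<sigma> \<tau> f g
  assume *: "\<forall>x. ap canon (\<sigma> \<rightarrow> \<tau>) f x = ap canon (\<sigma> \<rightarrow> \<tau>) g x"
  let ?f = "rep (\<sigma> \<rightarrow> \<tau>) f" and ?g = "rep (\<sigma> \<rightarrow> \<tau>) g"
  have "eqt \<tau> (?f \<cdot> u) (?g \<cdot> u) \<in> T" if u: "tyof [] u = Some \<sigma>" for u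
  proof -
    have "val \<tau> (?f \<cdot> u) = val \<tau> (?g \<cdot> u)"
      using * ap_canon[OF rep(1)[of "\<sigma> \<rightarrow> \<tau>" f] u] ap_canon[OF rep(1)[of "\<sigma> \<rightarrow> \<tau>" g] u] by (simp add: rep)
    moreover have "tyof [] (?f \<cdot> u) = Some \<tau>" "tyof [] (?g \<cdot> u) = Some \<tau>" using u rep by simp_all
    ultimately show ?thesis using val_eq by blast
  qed
  then have "val (\<sigma> \<rightarrow> \<tau>) ?f = val (\<sigma> \<rightarrow> \<tau>) ?g" using val_eq eqt_Fn rep by blast
  then show "f = g" using rep by simp
qed

abbreviation e0 :: "var \<Rightarrow> elem" where "e0 \<equiv> (\<lambda>x. val (snd x) (Free x))"

lemma sem_canon: "tyof [] t = Some \<tau> \<Longrightarrow> sem canon e0 [] t = val \<tau> t"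
proof (induction t arbitrary: \<tau>)
  case (App s t)
  then obtain \<sigma> where "tyof [] s = Some (\<sigma> \<rightarrow> \<tau>)" "tyof [] t = Some \<sigma>"
    by (auto simp: tyof_App_Some simp del: tyof.simps(4))
  then show ?case using App.IH by (simp add: ap_canon)
qed (auto simp: canon_def)

lemma less_cong:
  assumes "(s \<^bold>< t) \<in> T" "(s \<^bold>= s') \<in> T" "(t \<^bold>= t') \<in> T"
    and ty: "tyof [] s = Some Nt" "tyof [] t = Some Nt" "tyof [] s' = Some Nt" "tyof [] t' = Some Nt"
  shows "(s' \<^bold>< t') \<in> T"
proof -
  obtain x where x: "(x, Nt) \<notin> fvt t \<union> fvt s'" using fresh_var[of "fvt t \<union> fvt s'"] by auto
  have [simp]: "substt (x, Nt) u v = v" if "(x, Nt) \<notin> fvt v" for u v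
    using that by (induction v) auto
  have "(s' \<^bold>< t) \<in> T" using T_subst[OF assms(2), of "(x, Nt)" "Free (x, Nt) \<^bold>< t"] x assms by simp
  then show ?thesis using T_subst[OF assms(3), of "(x, Nt)" "s' \<^bold>< Free (x, Nt)"] x assms by simp
qed

text \<open>The truth lemma. A free variable denotes its own class, and an instance of a quantifier
  by an element becomes an instance by a term.\<close>

lemma sat_canon: "wf [] \<phi> \<Longrightarrow> sat canon e0 [] \<phi> \<longleftrightarrow> \<phi> \<in> T"
proof (induction "size \<phi>" arbitrary: \<phi> rule: less_induct)
  case less
  show ?case
  proof (cases \<phi>)
    case Bot
    then show ?thesis using T_Bot by simp
  next
    case (Eq s t)
    then show ?thesis using less sem_canon[of _ Nt] val_eq[of s Nt t] by simp
  next
    case (Less s t)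
    then have ty: "tyof [] s = Some Nt" "tyof [] t = Some Nt" using less by simp_all
    then have "sat canon e0 [] \<phi> \<longleftrightarrow> (rep Nt (val Nt s) \<^bold>< rep Nt (val Nt t)) \<in> T"
      using Less sem_canon[of _ Nt] by (simp add: canon_def)
    also have "\<dots> \<longleftrightarrow> (s \<^bold>< t) \<in> T"
      using less_cong rep_val[OF ty(1)] rep_val[OF ty(2)] rep ty eqt_sym[OF rep_val[OF ty(1)]]
        eqt_sym[OF rep_val[OF ty(2)]] by auto
    finally show ?thesis using Less by simp
  next
    case (Imp \<phi> \<psi>)
    then show ?thesis using less by (simp add: T_Imp)
  next
    case (All \<sigma> \<psi>)
    then have w: "wf [\<sigma>] \<psi>" using less by simp
    have *: "sat canon e0 [(\<sigma>, val \<sigma> t)] \<psi> \<longleftrightarrow> opn 0 t \<psi> \<in> T" if t: "tyof [] t = Some \<sigma>" for t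
    proof -
      have "sat canon e0 [(\<sigma>, val \<sigma> t)] \<psi> \<longleftrightarrow> sat canon e0 [] (opn 0 t \<psi>)"
        using sat_opn[OF t, of "[]" \<psi> canon e0] w sem_canon[OF t] by simp
      also have "\<dots> \<longleftrightarrow> opn 0 t \<psi> \<in> T"
        using w t wf_opn[of t \<sigma> "[]" \<psi>] All less by simp
      finally show ?thesis .
    qed
    have "sat canon e0 [] \<phi> \<longleftrightarrow> (\<forall>d. sat canon e0 [(\<sigma>, d)] \<psi>)" using All by simp
    also have "\<dots> \<longleftrightarrow> (\<forall>t. tyof [] t = Some \<sigma> \<longrightarrow> sat canon e0 [(\<sigma>, val \<sigma> t)] \<psi>)"
      using rep by metis
    also have "\<dots> \<longleftrightarrow> \<phi> \<in> T" using * T_All[OF w] All by simp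
    finally show ?thesis .
  qed
qed

end

text \<open>One fixed carrier suffices, as the language is countable and all quotients are infinite.
  \<open>RCA0w\<close> provides the axioms that the term model rests on: combinators,
  extensionality, and a successor that separates the numerals.\<close>

theorem completeness:
  assumes closed: "\<And>\<gamma>. \<gamma> \<in> \<Gamma> \<Longrightarrow> sentence \<gamma>" and ax: "RCA0w \<subseteq> \<Gamma>" and w: "wf [] \<phi>"
    and models: "\<And>M :: elem str. extensional M \<Longrightarrow> (\<And>\<gamma>. \<gamma> \<in> \<Gamma> \<Longrightarrow> valid M \<gamma>) \<Longrightarrow> valid M \<phi>"
  shows "\<Gamma> \<turnstile> \<phi>"
proof (rule ccontr)
  interpret closed_theory \<Gamma> using closed by unfold_locales
  assume nd: "\<not> (\<Gamma> \<turnstile> \<phi>)"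
  obtain T where prv: "\<And>\<psi>. prv T \<psi> \<longleftrightarrow> \<psi> \<in> T \<and> wf [] \<psi>" and bot: "Bot \<notin> T" and neg: "(\<^bold>\<not> \<phi>) \<in> T"
    and dec: "\<And>\<psi>. wf [] \<psi> \<Longrightarrow> \<psi> \<in> T \<or> (\<^bold>\<not> \<psi>) \<in> T"
    and wit: "\<And>\<sigma> \<psi>. (\<^bold>\<not> All \<sigma> \<psi>) \<in> T \<Longrightarrow> \<exists>t. tyof [] t = Some \<sigma> \<and> (\<^bold>\<not> opn 0 t \<psi>) \<in> T"
    using Henkin_extension[OF w nd] by blast
  have cons: "\<not> (\<psi> \<in> T \<and> (\<^bold>\<not> \<psi>) \<in> T)" if "wf [] \<psi>" for \<psi>
    using MP[of T \<psi> Bot] prv that bot by (auto simp: Neg_def)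
  have GT: "\<Gamma> \<subseteq> T"
  proof
    fix \<gamma> assume "\<gamma> \<in> \<Gamma>"
    then have "prv T \<gamma>" using closed by (intro Ax derives.Assm) (auto simp: sentence_def)
    then show "\<gamma> \<in> T" using prv by blast
  qed
  interpret henkin T
  proof
    show "Bot \<notin> T" by fact
    show "(\<psi> \<^bold>\<longrightarrow> \<chi>) \<in> T \<longleftrightarrow> (\<psi> \<in> T \<longrightarrow> \<chi> \<in> T)" if w: "wf [] \<psi>" "wf [] \<chi>" for \<psi> \<chi>
    proof
      assume "(\<psi> \<^bold>\<longrightarrow> \<chi>) \<in> T"
      then show "\<psi> \<in> T \<longrightarrow> \<chi> \<in> T" using MP[of T \<psi> \<chi>] prv w by auto
    next
      assume *: "\<psi> \<in> T \<longrightarrow> \<chi> \<in> T"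
      show "(\<psi> \<^bold>\<longrightarrow> \<chi>) \<in> T"
      proof (cases "\<chi> \<in> T")
        case True
        then have "prv T (\<psi> \<^bold>\<longrightarrow> \<chi>)" using prv_K[of \<chi> \<psi> T] MP Hyp w by blast
        then show ?thesis using prv by blast
      next
        case False
        then have "(\<^bold>\<not> \<psi>) \<in> T" using * dec w by blast
        then have "prv (insert \<psi> T) (\<^bold>\<not> \<psi>)" "prv (insert \<psi> T) \<psi>" using w by (auto intro: Hyp)
        then have "prv (insert \<psi> T) Bot" unfolding Neg_def by (rule MP)
        then have "prv (insert (\<^bold>\<not> \<chi>) (insert \<psi> T)) Bot" using prv_mono by blast
        then have "prv T (\<psi> \<^bold>\<longrightarrow> \<chi>)" using w contradiction deduction by blast
        then show ?thesis using prv by blast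
      qed
    qed
    show "All \<sigma> \<psi> \<in> T \<longleftrightarrow> (\<forall>t. tyof [] t = Some \<sigma> \<longrightarrow> opn 0 t \<psi> \<in> T)" if w: "wf [\<sigma>] \<psi>" for \<sigma> \<psi>
    proof -
      have wo: "wf [] (opn 0 t \<psi>)" if "tyof [] t = Some \<sigma>" for t
        using wf_opn[OF that, of "[]" \<psi>] w by simp
      show ?thesis
      proof
        assume "All \<sigma> \<psi> \<in> T"
        then have "prv T (All \<sigma> \<psi>)" using w by (auto intro: Hyp)
        then show "\<forall>t. tyof [] t = Some \<sigma> \<longrightarrow> opn 0 t \<psi> \<in> T" using prv_inst prv by blast
      next
        assume *: "\<forall>t. tyof [] t = Some \<sigma> \<longrightarrow> opn 0 t \<psi> \<in> T"
        show "All \<sigma> \<psi> \<in> T"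
        proof (rule ccontr)
          assume "All \<sigma> \<psi> \<notin> T"
          then have "(\<^bold>\<not> All \<sigma> \<psi>) \<in> T" using dec[of "All \<sigma> \<psi>"] w by simp
          then obtain t where "tyof [] t = Some \<sigma>" "(\<^bold>\<not> opn 0 t \<psi>) \<in> T" using wit by blast
          then show False using * cons wo by blast
        qed
      qed
    qed
    show "(t \<^bold>= t) \<in> T" if "tyof [] t = Some Nt" for t
      using Ax[of "t \<^bold>= t" T] prv derives.EqRefl that by simp
    show "subst x t \<psi> \<in> T"
      if "(s \<^bold>= t) \<in> T" "subst x s \<psi> \<in> T" "wf [] \<psi>" "snd x = Nt" "tyof [] s = Some Nt" "tyof [] t = Some Nt"
      for s t x \<psi>
    proof -
      have ws: "wf [] (subst x s \<psi>)" "wf [] (subst x t \<psi>)" "wf [] (s \<^bold>= t)" using that by (auto simp: wf_subst)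
      let ?G = "insert (subst x s \<psi>) (insert (s \<^bold>= t) \<Gamma>)"
      have "?G \<turnstile> s \<^bold>= t" "?G \<turnstile> subst x s \<psi>" using ws by (auto intro: derives.Assm)
      then have "?G \<turnstile> subst x t \<psi>" using that derives.EqSubst by blast
      then have "\<Gamma> \<turnstile> (s \<^bold>= t) \<^bold>\<longrightarrow> subst x s \<psi> \<^bold>\<longrightarrow> subst x t \<psi>"
        using ws by (auto intro!: derives.ImpI)
      then have "prv T ((s \<^bold>= t) \<^bold>\<longrightarrow> subst x s \<psi> \<^bold>\<longrightarrow> subst x t \<psi>)" using ws by (auto intro: Ax)
      moreover have "prv T (s \<^bold>= t)" "prv T (subst x s \<psi>)" using that ws by (auto intro: Hyp)
      ultimately have "prv T (subst x t \<psi>)" using MP by blast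
      then show ?thesis using prv by blast
    qed
    show "basic_axioms \<subseteq> T" "combinator_axioms \<subseteq> T" "extensionality_axioms \<subseteq> T"
      using GT ax by (auto simp: RCA0w_def)
  qed
  have "valid canon \<phi>"
  proof (rule models)
    show "extensional canon" by (rule extensional_canon)
    show "valid canon \<gamma>" if "\<gamma> \<in> \<Gamma>" for \<gamma>
    proof -
      have g: "wf [] \<gamma>" "fv \<gamma> = {}" "\<gamma> \<in> T" using that closed GT by (auto simp: sentence_def)
      then have "sat canon e0 [] \<gamma>" using sat_canon by blast
      then have "sat canon e [] \<gamma>" for e using sat_cong[of \<gamma> e e0 canon "[]"] g(2) by simp
      then show ?thesis unfolding valid_def by blast
    qed
  qed
  then have "\<phi> \<in> T" using sat_canon[OF w] by (auto simp: valid_def)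
  then show False using cons neg w by blast
qed

section \<open>Evaluating terms and formulas\<close>

lemma sem_substt:
  "tyof [] u = Some (snd x) \<Longrightarrow> sem M e b (substt x u t) = sem M (e(x := sem M e [] u)) b t"
proof (induction t)
  case (Free y)
  then show ?case using sem_append[of "[]" u M e b] tyof_lct0 by auto
qed (auto simp: tyof_substt)

lemma sat_subst:
  "tyof [] u = Some (snd x) \<Longrightarrow> sat M e b (subst x u \<phi>) = sat M (e(x := sem M e [] u)) b \<phi>"
  by (induction \<phi> arbitrary: b) (auto simp: sem_substt)

lemma sat_Neg [simp]: "sat M e b (\<^bold>\<not> \<phi>) \<longleftrightarrow> \<not> sat M e b \<phi>"
  by (simp add: Neg_def)
lemma sat_And [simp]: "sat M e b (\<phi> \<^bold>\<and> \<psi>) \<longleftrightarrow> sat M e b \<phi> \<and> sat M e b \<psi>"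
  by (simp add: And_def)
lemma sat_Or [simp]: "sat M e b (\<phi> \<^bold>\<or> \<psi>) \<longleftrightarrow> sat M e b \<phi> \<or> sat M e b \<psi>"
  by (auto simp: Or_def)
lemma sat_Iff [simp]: "sat M e b (\<phi> \<^bold>\<longleftrightarrow> \<psi>) \<longleftrightarrow> (sat M e b \<phi> \<longleftrightarrow> sat M e b \<psi>)"
  by (auto simp: Iff_def)

lemma lc_connectives [simp]:
  "lc k (\<^bold>\<not> \<phi>) \<longleftrightarrow> lc k \<phi>" "lc k (\<phi> \<^bold>\<and> \<psi>) \<longleftrightarrow> lc k \<phi> \<and> lc k \<psi>" "lc k (\<phi> \<^bold>\<or> \<psi>) \<longleftrightarrow> lc k \<phi> \<and> lc k \<psi>"
  "lc k (\<phi> \<^bold>\<longleftrightarrow> \<psi>) \<longleftrightarrow> lc k \<phi> \<and> lc k \<psi>"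
  by (auto simp: Neg_def And_def Or_def Iff_def)

lemma wf_connectives [simp]:
  "wf k (\<phi> \<^bold>\<and> \<psi>) \<longleftrightarrow> wf k \<phi> \<and> wf k \<psi>" "wf k (\<phi> \<^bold>\<or> \<psi>) \<longleftrightarrow> wf k \<phi> \<and> wf k \<psi>"
  "wf k (\<phi> \<^bold>\<longleftrightarrow> \<psi>) \<longleftrightarrow> wf k \<phi> \<and> wf k \<psi>"
  by (auto simp: Neg_def And_def Or_def Iff_def)

lemma fv_connectives [simp]:
  "fv (\<phi> \<^bold>\<and> \<psi>) = fv \<phi> \<union> fv \<psi>" "fv (\<phi> \<^bold>\<or> \<psi>) = fv \<phi> \<union> fv \<psi>" "fv (\<phi> \<^bold>\<longleftrightarrow> \<psi>) = fv \<phi> \<union> fv \<psi>"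
  by (auto simp: Neg_def And_def Or_def Iff_def)

lemma qf_connectives [simp]:
  "qf (\<^bold>\<not> \<phi>) \<longleftrightarrow> qf \<phi>" "qf (\<phi> \<^bold>\<and> \<psi>) \<longleftrightarrow> qf \<phi> \<and> qf \<psi>" "qf (\<phi> \<^bold>\<or> \<psi>) \<longleftrightarrow> qf \<phi> \<and> qf \<psi>"
  by (auto simp: Neg_def And_def Or_def)

lemma lct_closet: "lct k t \<Longrightarrow> lct (Suc k) (closet k x t)"
  by (induction t) auto

lemma lc_close: "lc k \<phi> \<Longrightarrow> lc (Suc k) (close k x \<phi>)"
  by (induction \<phi> arbitrary: k) (auto simp: lct_closet)

lemma lc_Forall: "lc 0 \<phi> \<Longrightarrow> lc 0 (Forall x \<phi>)"
  by (simp add: Forall_def lc_close)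

lemma sat_Exists: "lc 0 \<phi> \<Longrightarrow> sat M e [] (Exists x \<phi>) \<longleftrightarrow> (\<exists>d. sat M (e(x := d)) [] \<phi>)"
  by (simp add: Exists_def sat_Forall)

lemma lc_Exists: "lc 0 \<phi> \<Longrightarrow> lc 0 (Exists x \<phi>)"
  by (simp add: Exists_def lc_Forall)

lemma fv_Exists [simp]: "fv (Exists x \<phi>) = fv \<phi> - {x}"
  by (simp add: Exists_def)

lemma wf_Exists: "wf [] \<phi> \<Longrightarrow> wf [] (Exists x \<phi>)"
  by (simp add: Exists_def wf_Forall)

text \<open>With these rules the simplifier turns a sentence of the language into the HOL statement
  that it expresses in the model.\<close>

lemma quantifier_simps [simp]:
  "lc 0 (F (Free (s, \<sigma>))) \<Longrightarrow> sat M e [] (forall s \<sigma> F) \<longleftrightarrow> (\<forall>d. sat M (e((s, \<sigma>) := d)) [] (F (Free (s, \<sigma>))))"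
  "lc 0 (F (Free (s, \<sigma>))) \<Longrightarrow> sat M e [] (exists s \<sigma> F) \<longleftrightarrow> (\<exists>d. sat M (e((s, \<sigma>) := d)) [] (F (Free (s, \<sigma>))))"
  "lc 0 (F (Free (s, \<sigma>))) \<Longrightarrow> lc 0 (forall s \<sigma> F)"
  "lc 0 (F (Free (s, \<sigma>))) \<Longrightarrow> lc 0 (exists s \<sigma> F)"
  "wf [] (F (Free (s, \<sigma>))) \<Longrightarrow> wf [] (forall s \<sigma> F)"
  "wf [] (F (Free (s, \<sigma>))) \<Longrightarrow> wf [] (exists s \<sigma> F)"
  "fv (forall s \<sigma> F) = fv (F (Free (s, \<sigma>))) - {(s, \<sigma>)}"
  "fv (exists s \<sigma> F) = fv (F (Free (s, \<sigma>))) - {(s, \<sigma>)}"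
  by (simp_all add: forall_def exists_def sat_Forall sat_Exists lc_Forall lc_Exists wf_Forall wf_Exists)

lemma lc_eqt: "lct k s \<Longrightarrow> lct k t \<Longrightarrow> lc k (eqt \<sigma> s t)"
  by (induction \<sigma> arbitrary: k s t) (auto simp: lct_incr)

lemma plus_times_simps [simp]:
  "tyof \<Delta> s = Some Nt \<Longrightarrow> tyof \<Delta> t = Some Nt \<Longrightarrow> tyof \<Delta> (s \<^bold>+ t) = Some Nt"
  "tyof \<Delta> s = Some Nt \<Longrightarrow> tyof \<Delta> t = Some Nt \<Longrightarrow> tyof \<Delta> (s \<^bold>* t) = Some Nt"
  "fvt (s \<^bold>+ t) = fvt s \<union> fvt t" "fvt (s \<^bold>* t) = fvt s \<union> fvt t"
  "lct k (s \<^bold>+ t) \<longleftrightarrow> lct k s \<and> lct k t" "lct k (s \<^bold>* t) \<longleftrightarrow> lct k s \<and> lct k t"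
  by (auto simp: plus_tm_def times_tm_def)

lemma lct_lam: "lct 0 t \<Longrightarrow> lct 0 (lam x t)"
  by (induction t) (auto simp: const_tm_def id_tm_def)

lemma lct_fn [simp]: "lct 0 (F (Free (s, \<sigma>))) \<Longrightarrow> lct 0 (fn s \<sigma> F)"
  by (simp add: fn_def lct_lam)

lemma tyof_lam: "tyof [] t = Some \<tau> \<Longrightarrow> tyof [] (lam x t) = Some (snd x \<rightarrow> \<tau>)"
proof (induction t arbitrary: \<tau>)
  case (App s t)
  then obtain \<sigma> where "tyof [] s = Some (\<sigma> \<rightarrow> \<tau>)" "tyof [] t = Some \<sigma>"
    by (auto simp: tyof_App_Some simp del: tyof.simps(4))
  then show ?case using App.IH by (simp add: const_tm_def ty1_def res_ty_def)
qed (auto simp: const_tm_def id_tm_def ty1_def)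

lemma tyof_fn [simp]:
  "tyof [] (F (Free (s, \<sigma>))) \<noteq> None \<Longrightarrow> tyof [] (fn s \<sigma> F) = Some (\<sigma> \<rightarrow> the (tyof [] (F (Free (s, \<sigma>)))))"
  unfolding fn_def using tyof_lam by fastforce

lemma fvt_fn [simp]: "fvt (fn s \<sigma> F) = fvt (F (Free (s, \<sigma>))) - {(s, \<sigma>)}"
proof -
  have "fvt (lam x t) = fvt t - {x}" for x t
    by (induction t) (auto simp: const_tm_def id_tm_def)
  then show ?thesis by (simp add: fn_def)
qed

lemma sentence_closure: "wf [] \<phi> \<Longrightarrow> \<exists>xs. sentence (foldr Forall xs \<phi>)"
proof -
  assume w: "wf [] \<phi>"
  obtain xs where "set xs = fv \<phi>" using finite_list[OF finite_fv] by blast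
  moreover have "wf [] (foldr Forall xs \<phi>) \<and> fv (foldr Forall xs \<phi>) = fv \<phi> - set xs"
    using w by (induction xs) (auto simp: wf_Forall)
  ultimately have "sentence (foldr Forall xs \<phi>)" by (simp add: sentence_def)
  then show ?thesis by (rule exI)
qed

text \<open>The schemes contain closed instances only. Stripping the closing quantifiers again makes
  an instance available with parameters from the model.\<close>

lemma valid_closures:
  assumes "\<And>\<gamma>. \<gamma> \<in> closures \<phi> \<Longrightarrow> valid M \<gamma>" and w: "wf [] \<phi>"
  shows "sat M e [] \<phi>"
proof -
  obtain xs where "sentence (foldr Forall xs \<phi>)" using sentence_closure w by blast
  then have "valid M (foldr Forall xs \<phi>)" using assms by (auto simp: closures_def)
  then have "valid M \<phi>"
  proof (induction xs)
    case (Cons x xs)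
    have "wf [] (foldr Forall xs \<phi>)" using w by (induction xs) (auto simp: wf_Forall)
    then have "lc 0 (foldr Forall xs \<phi>)" using wf_lc0 by blast
    then have "sat M e [] (foldr Forall xs \<phi>)" for e
      using Cons.prems by (auto simp: valid_def sat_Forall dest!: spec[of _ e] spec[of _ "e x"])
    then show ?case using Cons.IH by (simp add: valid_def)
  qed simp
  then show ?thesis by (simp add: valid_def)
qed

section \<open>Typing the terms and formulas of the language\<close>

text \<open>Only quantifiers are restricted to numbers. Free variables of every type may occur, so
  arithmetical comprehension will have parameters of all types.\<close>

fun arith :: "fm \<Rightarrow> bool" where
  "arith (\<phi> \<^bold>\<longrightarrow> \<psi>) \<longleftrightarrow> arith \<phi> \<and> arith \<psi>"
| "arith (All \<sigma> \<phi>) \<longleftrightarrow> \<sigma> = Nt \<and> arith \<phi>"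
| "arith _ \<longleftrightarrow> True"

lemma arith_close [simp]: "arith (close k x \<phi>) \<longleftrightarrow> arith \<phi>"
  by (induction \<phi> arbitrary: k) auto

lemma arith_opn [simp]: "arith (opn k u \<phi>) \<longleftrightarrow> arith \<phi>"
  by (induction \<phi> arbitrary: k) auto

lemma arith_simps [simp]:
  "arith (\<^bold>\<not> \<phi>) \<longleftrightarrow> arith \<phi>" "arith (\<phi> \<^bold>\<and> \<psi>) \<longleftrightarrow> arith \<phi> \<and> arith \<psi>"
  "arith (\<phi> \<^bold>\<or> \<psi>) \<longleftrightarrow> arith \<phi> \<and> arith \<psi>" "arith (\<phi> \<^bold>\<longleftrightarrow> \<psi>) \<longleftrightarrow> arith \<phi> \<and> arith \<psi>"
  "arith (forall s \<sigma> F) \<longleftrightarrow> \<sigma> = Nt \<and> arith (F (Free (s, \<sigma>)))"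
  "arith (exists s \<sigma> F) \<longleftrightarrow> \<sigma> = Nt \<and> arith (F (Free (s, \<sigma>)))"
  by (auto simp: Neg_def And_def Or_def Iff_def forall_def exists_def Exists_def Forall_def)

lemma pred_tm_syntax [simp]: "tyof [] pred_tm = Some (Nt \<rightarrow> Nt)" "fvt pred_tm = {}" "lct 0 pred_tm"
  by (auto simp: pred_tm_def)
lemma monus_tm_syntax [simp]: "tyof [] monus_tm = Some (Nt \<rightarrow> Nt \<rightarrow> Nt)" "fvt monus_tm = {}" "lct 0 monus_tm"
  by (auto simp: monus_tm_def)

lemma isqrt_tm_syntax [simp]: "tyof [] isqrt_tm = Some (Nt \<rightarrow> Nt)" "fvt isqrt_tm = {}" "lct 0 isqrt_tm"
  by (auto simp: isqrt_tm_def)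

lemma pair_tm_syntax [simp]: "tyof [] pair_tm = Some (Nt \<rightarrow> Nt \<rightarrow> Nt)" "fvt pair_tm = {}" "lct 0 pair_tm"
  by (auto simp: pair_tm_def)

lemma fst_tm_syntax [simp]: "tyof [] fst_tm = Some (Nt \<rightarrow> Nt)" "fvt fst_tm = {}" "lct 0 fst_tm"
  by (auto simp: fst_tm_def)

lemma snd_tm_syntax [simp]: "tyof [] snd_tm = Some (Nt \<rightarrow> Nt)" "fvt snd_tm = {}" "lct 0 snd_tm"
  by (auto simp: snd_tm_def)

lemma q_syntax [simp]:
  "tyof [] t = Some Nt \<Longrightarrow> tyof [] (qp t) = Some Nt" "tyof [] t = Some Nt \<Longrightarrow> tyof [] (qm t) = Some Nt"
  "tyof [] t = Some Nt \<Longrightarrow> tyof [] (qd t) = Some Nt"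
  "fvt (qp t) = fvt t" "fvt (qm t) = fvt t" "fvt (qd t) = fvt t"
  "lct 0 (qp t) = lct 0 t" "lct 0 (qm t) = lct 0 t" "lct 0 (qd t) = lct 0 t"
  by (auto simp: qp_def qm_def qd_def)

lemma mkq_syntax [simp]:
  "tyof [] p = Some Nt \<Longrightarrow> tyof [] m = Some Nt \<Longrightarrow> tyof [] d = Some Nt \<Longrightarrow> tyof [] (mkq p m d) = Some Nt"
  "fvt (mkq p m d) = fvt p \<union> fvt m \<union> fvt d" "lct 0 (mkq p m d) \<longleftrightarrow> lct 0 p \<and> lct 0 m \<and> lct 0 d"
  by (auto simp: mkq_def)

lemma qadd_tm_syntax [simp]: "tyof [] qadd_tm = Some (Nt \<rightarrow> Nt \<rightarrow> Nt)" "fvt qadd_tm = {}" "lct 0 qadd_tm"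
  by (auto simp: qadd_tm_def)

lemma qneg_tm_syntax [simp]: "tyof [] qneg_tm = Some (Nt \<rightarrow> Nt)" "fvt qneg_tm = {}" "lct 0 qneg_tm"
  by (auto simp: qneg_tm_def)

lemma qabs_tm_syntax [simp]: "tyof [] qabs_tm = Some (Nt \<rightarrow> Nt)" "fvt qabs_tm = {}" "lct 0 qabs_tm"
  by (auto simp: qabs_tm_def)

lemma pow2_tm_syntax [simp]: "tyof [] pow2_tm = Some (Nt \<rightarrow> Nt)" "fvt pow2_tm = {}" "lct 0 pow2_tm"
  by (auto simp: pow2_tm_def)

lemma qpow_tm_syntax [simp]: "tyof [] qpow_tm = Some (Nt \<rightarrow> Nt)" "fvt qpow_tm = {}" "lct 0 qpow_tm"
  by (auto simp: qpow_tm_def)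

lemma ratR_tm_syntax [simp]: "tyof [] ratR_tm = Some (Nt \<rightarrow> T1)" "fvt ratR_tm = {}" "lct 0 ratR_tm"
  by (auto simp: ratR_tm_def)

lemma diffR_tm_syntax [simp]: "tyof [] diffR_tm = Some (T1 \<rightarrow> T1 \<rightarrow> T1)" "fvt diffR_tm = {}" "lct 0 diffR_tm"
  by (auto simp: diffR_tm_def)

lemma absR_tm_syntax [simp]: "tyof [] absR_tm = Some (T1 \<rightarrow> T1)" "fvt absR_tm = {}" "lct 0 absR_tm"
  by (auto simp: absR_tm_def)

lemma sum_tm_syntax [simp]: "tyof [] sum_tm = Some ((T1 \<rightarrow> T1) \<rightarrow> (Nt \<rightarrow> T1) \<rightarrow> Nt \<rightarrow> T1)" "fvt sum_tm = {}" "lct 0 sum_tm"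
  by (auto simp: sum_tm_def)

lemma qless_syntax [simp]:
  "tyof [] q = Some Nt \<Longrightarrow> tyof [] r = Some Nt \<Longrightarrow> wf [] (qless q r)"
  "lc 0 (qless q r) \<longleftrightarrow> lct 0 q \<and> lct 0 r"
  "fv (qless q r) = fvt q \<union> fvt r"
  "arith (qless q r)"
  by (auto simp: qless_def)

lemma qleq_syntax [simp]:
  "tyof [] q = Some Nt \<Longrightarrow> tyof [] r = Some Nt \<Longrightarrow> wf [] (qleq q r)"
  "lc 0 (qleq q r) \<longleftrightarrow> lct 0 q \<and> lct 0 r"
  "fv (qleq q r) = fvt q \<union> fvt r"
  "arith (qleq q r)"
  by (auto simp: qleq_def)

lemma isreal_syntax [simp]:
  "lct 0 t \<Longrightarrow> lc 0 (isreal t)"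
  "fv (isreal t) = fvt t - {(''re_n'', Nt), (''re_i'', Nt)}"
  "arith (isreal t)"
  "tyof [] t = Some T1 \<Longrightarrow> wf [] (isreal t)"
  by (auto simp: isreal_def tyof_lct0)

lemma eqR_syntax [simp]:
  "lct 0 s \<Longrightarrow> lct 0 t \<Longrightarrow> lc 0 (eqR s t)"
  "fv (eqR s t) = fvt s \<union> fvt t - {(''eq_n'', Nt)}"
  "arith (eqR s t)"
  "tyof [] s = Some T1 \<Longrightarrow> tyof [] t = Some T1 \<Longrightarrow> wf [] (eqR s t)"
  by (auto simp: eqR_def tyof_lct0)

lemma leqR_syntax [simp]:
  "lct 0 s \<Longrightarrow> lct 0 t \<Longrightarrow> lc 0 (leqR s t)"
  "fv (leqR s t) = fvt s \<union> fvt t - {(''le_n'', Nt)}"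
  "arith (leqR s t)"
  "tyof [] s = Some T1 \<Longrightarrow> tyof [] t = Some T1 \<Longrightarrow> wf [] (leqR s t)"
  by (auto simp: leqR_def tyof_lct0)

lemma lessR_syntax [simp]:
  "lct 0 s \<Longrightarrow> lct 0 t \<Longrightarrow> lc 0 (lessR s t)"
  "fv (lessR s t) = fvt s \<union> fvt t - {(''le_n'', Nt)}"
  "arith (lessR s t)"
  "tyof [] s = Some T1 \<Longrightarrow> tyof [] t = Some T1 \<Longrightarrow> wf [] (lessR s t)"
  by (auto simp: lessR_def)

lemma in01_syntax [simp]:
  "lct 0 t \<Longrightarrow> lc 0 (in01 t)"
  "fv (in01 t) = fvt t - {(''re_n'', Nt), (''re_i'', Nt)} \<union> (fvt t - {(''le_n'', Nt)})"
  "arith (in01 t)"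
  "tyof [] t = Some T1 \<Longrightarrow> wf [] (in01 t)"
  by (auto simp: in01_def)

lemma finseq_syntax [simp]:
  "lct 0 s \<Longrightarrow> lct 0 t \<Longrightarrow> lc 0 (finseq s t)"
  "arith (finseq s t)"
  "tyof [] s = Some (Nt \<rightarrow> T1) \<Longrightarrow> tyof [] t = Some Nt \<Longrightarrow> wf [] (finseq s t)"
  by (auto simp: finseq_def tyof_lct0)

lemma contained_syntax [simp]:
  "lct 0 s \<Longrightarrow> lct 0 t \<Longrightarrow> lct 0 s' \<Longrightarrow> lct 0 t' \<Longrightarrow> lc 0 (contained s t s' t')"
  by (auto simp: contained_def)

lemma witness_syntax [simp]:
  "lct 0 a \<Longrightarrow> lct 0 b \<Longrightarrow> lct 0 k \<Longrightarrow> lct 0 u \<Longrightarrow> lct 0 l \<Longrightarrow> lc 0 (witness a b k u l)"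
  by (auto simp: witness_def)

lemma family_syntax [simp]:
  "lct 0 a \<Longrightarrow> lc 0 (family a)"
  "lct 0 a \<Longrightarrow> lc 0 (positive a)"
  by (auto simp: family_def Defs.positive_def)

lemma converges_syntax [simp]:
  "lct 0 a \<Longrightarrow> lct 0 b \<Longrightarrow> lc 0 (converges_to a b)"
  by (auto simp: converges_to_def)

lemma binary_syntax [simp]:
  "lct 0 t \<Longrightarrow> lc 0 (binary t)"
  by (auto simp: binary_def)

lemma wf_items: "wf [] QF_AC01" "wf [] item_ii" "wf [] item_iii" "wf [] cocode1"
  by (simp_all add: QF_AC01_def item_ii_def item_iii_def cocode1_def modulus_def witness_def converges_to_def
      family_def Defs.positive_def contained_def subset01_def strongly_countable_def enumerable_def elt_def)

section \<open>Arithmetic in models\<close>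

locale aca_model =
  fixes M :: "'d str"
  assumes ext: "extensional M"
    and ACA: "\<And>\<gamma>. \<gamma> \<in> ACA0w \<Longrightarrow> valid M \<gamma>"
begin

lemma RCA: "\<gamma> \<in> RCA0w \<Longrightarrow> valid M \<gamma>"
  using ACA by (simp add: ACA0w_def)

lemma ap_ext: "(\<And>x. ap M (\<sigma> \<rightarrow> \<tau>) f x = ap M (\<sigma> \<rightarrow> \<tau>) g x) \<Longrightarrow> f = g"
  using ext unfolding extensional_def by blast

lemma ap_K [simp]: "ap M (\<tau> \<rightarrow> \<sigma>) (ap M (\<sigma> \<rightarrow> \<tau> \<rightarrow> \<sigma>) (cs M (Kc \<sigma> \<tau>)) x) y = x"
proof -
  have "valid M (forall ''x'' \<sigma> (\<lambda>x. forall ''y'' \<tau> (\<lambda>y. eqt \<sigma> (Cst (Kc \<sigma> \<tau>) \<cdot> x \<cdot> y) x)))"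
    by (rule RCA) (unfold RCA0w_def combinator_axioms_def, blast)
  then show ?thesis by (simp add: valid_def lc_eqt sat_eqt[OF ext])
qed

lemma ap_S [simp]:
  "ap M (\<rho> \<rightarrow> \<tau>) (ap M ((\<rho> \<rightarrow> \<sigma>) \<rightarrow> \<rho> \<rightarrow> \<tau>) (ap M ((\<rho> \<rightarrow> \<sigma> \<rightarrow> \<tau>) \<rightarrow> (\<rho> \<rightarrow> \<sigma>) \<rightarrow> \<rho> \<rightarrow> \<tau>) (cs M (Sc \<rho> \<sigma> \<tau>)) x) y) z =
    ap M (\<sigma> \<rightarrow> \<tau>) (ap M (\<rho> \<rightarrow> \<sigma> \<rightarrow> \<tau>) x z) (ap M (\<rho> \<rightarrow> \<sigma>) y z)"
proof -
  have "valid M (forall ''x'' (\<rho> \<rightarrow> \<sigma> \<rightarrow> \<tau>) (\<lambda>x. forall ''y'' (\<rho> \<rightarrow> \<sigma>) (\<lambda>y. forall ''z'' \<rho> (\<lambda>z.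
       eqt \<tau> (Cst (Sc \<rho> \<sigma> \<tau>) \<cdot> x \<cdot> y \<cdot> z) (x \<cdot> z \<cdot> (y \<cdot> z))))))"
    by (rule RCA) (unfold RCA0w_def combinator_axioms_def, blast)
  then show ?thesis by (simp add: valid_def lc_eqt sat_eqt[OF ext])
qed

text \<open>The combinator equations give bracket abstraction its beta rule, so that every
  well-typed term with parameters defines a function of the model.\<close>

lemma sem_lam:
  "tyof [] t = Some \<tau> \<Longrightarrow> ap M (snd x \<rightarrow> \<tau>) (sem M e [] (lam x t)) d = sem M (e(x := d)) [] t"
proof (induction t arbitrary: \<tau>)
  case (App s t)
  then obtain \<sigma> where *: "tyof [] s = Some (\<sigma> \<rightarrow> \<tau>)" "tyof [] t = Some \<sigma>"
    by (auto simp: tyof_App_Some simp del: tyof.simps(4))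
  show ?case
  proof (cases "x \<in> fvt (s \<cdot> t)")
    case True
    then show ?thesis using App.IH * by (simp add: ty1_def res_ty_def tyof_lam)
  next
    case False
    then have "sem M e [] (s \<cdot> t) = sem M (e(x := d)) [] (s \<cdot> t)" by (rule sem_upd_fresh[symmetric])
    moreover have "ap M (snd x \<rightarrow> \<tau>) (sem M e [] (lam x (s \<cdot> t))) d = sem M e [] (s \<cdot> t)"
      using False * by (simp add: ty1_def const_tm_def)
    ultimately show ?thesis by (rule trans[rotated])
  qed
qed (auto simp: const_tm_def id_tm_def ty1_def)

lemma sem_fn [simp]:
  "tyof [] (F (Free (s, \<sigma>))) = Some \<tau> \<Longrightarrow>
    ap M (\<sigma> \<rightarrow> \<tau>) (sem M e [] (fn s \<sigma> F)) d = sem M (e((s, \<sigma>) := d)) [] (F (Free (s, \<sigma>)))"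
  unfolding fn_def using sem_lam[of "F (Free (s, \<sigma>))" \<tau> "(s, \<sigma>)"] by simp

abbreviation ap1 :: "'d \<Rightarrow> 'd \<Rightarrow> 'd"  (infixl "\<bullet>" 90) where
  "f \<bullet> n \<equiv> ap M (Nt \<rightarrow> Nt) f n"
abbreviation ap2 :: "'d \<Rightarrow> 'd \<Rightarrow> 'd \<Rightarrow> 'd" where
  "ap2 f m n \<equiv> ap M (Nt \<rightarrow> Nt) (ap M (Nt \<rightarrow> Nt \<rightarrow> Nt) f m) n"

definition rec :: "'d \<Rightarrow> 'd \<Rightarrow> 'd \<Rightarrow> 'd" where
  "rec f m n = ap M (Nt \<rightarrow> Nt) (ap M (Nt \<rightarrow> Nt \<rightarrow> Nt) (ap M ((Nt \<rightarrow> Nt \<rightarrow> Nt) \<rightarrow> Nt \<rightarrow> Nt \<rightarrow> Nt) (cs M Rec) f) m) n"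

lemmas rec_fold [simp] = rec_def [symmetric]

definition "zr = cs M Zero"
definition "on = cs M One"
definition "pl a b = ap2 (cs M Plus) a b"
definition "tm a b = ap2 (cs M Times) a b"

lemmas const_fold [simp] = zr_def [symmetric] on_def [symmetric]

lemma sem_plus_times [simp]:
  "tyof (map fst b) s = Some Nt \<Longrightarrow> sem M e b (s \<^bold>+ t) = pl (sem M e b s) (sem M e b t)"
  "tyof (map fst b) s = Some Nt \<Longrightarrow> sem M e b (s \<^bold>* t) = tm (sem M e b s) (sem M e b t)"
  by (simp_all add: plus_tm_def times_tm_def pl_def tm_def)

lemma rec_simps [simp]: "rec f m zr = m" "rec f m (pl n on) = ap2 f n (rec f m n)"
proof -
  have "valid M (forall ''f'' (Nt \<rightarrow> Nt \<rightarrow> Nt) (\<lambda>f. forall ''m'' Nt (\<lambda>m. Cst Rec \<cdot> f \<cdot> m \<cdot> \<^bold>0 \<^bold>= m)))"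
    by (rule RCA) (auto simp: RCA0w_def recursor_axioms_def)
  then show "rec f m zr = m" by (simp add: valid_def)
  have "valid M (forall ''f'' (Nt \<rightarrow> Nt \<rightarrow> Nt) (\<lambda>f. forall ''m'' Nt (\<lambda>m. forall ''n'' Nt (\<lambda>n.
       Cst Rec \<cdot> f \<cdot> m \<cdot> (n \<^bold>+ \<^bold>1) \<^bold>= f \<cdot> n \<cdot> (Cst Rec \<cdot> f \<cdot> m \<cdot> n)))))"
    by (rule RCA) (auto simp: RCA0w_def recursor_axioms_def)
  then show "rec f m (pl n on) = ap2 f n (rec f m n)" by (simp add: valid_def)
qed

lemma basic: "\<gamma> \<in> basic_axioms \<Longrightarrow> sat M e [] \<gamma>"
  using RCA by (auto simp: RCA0w_def valid_def)

lemma pl_on_neq [simp]: "pl m on \<noteq> zr"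
  using basic[of "forall ''m'' Nt (\<lambda>m. \<^bold>\<not> m \<^bold>+ \<^bold>1 \<^bold>= \<^bold>0)"] by (simp add: basic_axioms_def)
lemma pl_zr [simp]: "pl m zr = m"
  using basic[of "forall ''m'' Nt (\<lambda>m. m \<^bold>+ \<^bold>0 \<^bold>= m)"] by (simp add: basic_axioms_def)
lemma pl_Suc: "pl m (pl n on) = pl (pl m n) on"
  using basic[of "forall ''m'' Nt (\<lambda>m. forall ''n'' Nt (\<lambda>n. m \<^bold>+ (n \<^bold>+ \<^bold>1) \<^bold>= (m \<^bold>+ n) \<^bold>+ \<^bold>1))"]
  by (simp add: basic_axioms_def)
lemma tm_zr [simp]: "tm m zr = zr"
  using basic[of "forall ''m'' Nt (\<lambda>m. m \<^bold>* \<^bold>0 \<^bold>= \<^bold>0)"] by (simp add: basic_axioms_def)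
lemma tm_Suc: "tm m (pl n on) = pl (tm m n) m"
  using basic[of "forall ''m'' Nt (\<lambda>m. forall ''n'' Nt (\<lambda>n. m \<^bold>* (n \<^bold>+ \<^bold>1) \<^bold>= (m \<^bold>* n) \<^bold>+ m))"]
  by (simp add: basic_axioms_def)
lemma ls_zr [simp]: "\<not> ls M m zr"
  using basic[of "forall ''m'' Nt (\<lambda>m. \<^bold>\<not> m \<^bold>< \<^bold>0)"] by (simp add: basic_axioms_def)
lemma ls_Suc: "ls M m (pl n on) \<longleftrightarrow> ls M m n \<or> m = n"
  using basic[of "forall ''m'' Nt (\<lambda>m. forall ''n'' Nt (\<lambda>n. m \<^bold>< n \<^bold>+ \<^bold>1 \<^bold>\<longleftrightarrow> (m \<^bold>< n \<^bold>\<or> m \<^bold>= n)))"]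
  by (simp add: basic_axioms_def)

text \<open>The induction variable sits in the assignment next to the parameters. Only
  quantifier-free formulas are available at this point, so the laws below are phrased with explicit
  terms in place of existential quantifiers.\<close>

lemma qf_induct:
  assumes "sat M (e(x := zr)) [] \<phi>" "\<And>n. sat M (e(x := n)) [] \<phi> \<Longrightarrow> sat M (e(x := pl n on)) [] \<phi>"
    and "qf \<phi>" "wf [] \<phi>" "snd x = Nt"
  shows "sat M (e(x := n)) [] \<phi>"
proof -
  let ?\<psi> = "subst x \<^bold>0 \<phi> \<^bold>\<and> Forall x (\<phi> \<^bold>\<longrightarrow> subst x (Free x \<^bold>+ \<^bold>1) \<phi>) \<^bold>\<longrightarrow> Forall x \<phi>"
  have ty: "tyof [] \<^bold>0 = Some (snd x)" "tyof [] (Free x \<^bold>+ \<^bold>1) = Some (snd x)" using assms by auto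
  have w: "wf [] (subst x \<^bold>0 \<phi>)" "wf [] (subst x (Free x \<^bold>+ \<^bold>1) \<phi>)"
    using assms ty wf_subst by blast+
  have "closures ?\<psi> \<subseteq> QF_induction"
    unfolding QF_induction_def using assms(3-5) by (intro Union_upper CollectI exI[of _ x] exI[of _ \<phi>]) simp
  then have "closures ?\<psi> \<subseteq> RCA0w" by (auto simp: RCA0w_def)
  have "sat M e [] ?\<psi>"
  proof (rule valid_closures)
    show "valid M \<gamma>" if "\<gamma> \<in> closures ?\<psi>" for \<gamma>
      using RCA that \<open>closures ?\<psi> \<subseteq> RCA0w\<close> by blast
  qed (use assms w in \<open>auto intro!: wf_Forall\<close>)
  moreover have "lc 0 \<phi>" "lc 0 (subst x (Free x \<^bold>+ \<^bold>1) \<phi>)" using assms w wf_lc0 by blast+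
  ultimately show ?thesis
    using assms ty by (simp add: sat_Forall sat_subst)
qed

section \<open>Laws of the ordered semiring\<close>

abbreviation "vA \<equiv> (''a'', Nt)"
abbreviation "vB \<equiv> (''b'', Nt)"
abbreviation "vN \<equiv> (''n'', Nt)"
abbreviation "env a b n \<equiv> (\<lambda>_. zr)(vA := a, vB := b, vN := n)"

lemma pl_zr_left [simp]: "pl zr n = n"
proof -
  have "sat M (env zr zr n) [] (\<^bold>0 \<^bold>+ Free vN \<^bold>= Free vN)"
    by (rule qf_induct) (simp_all add: pl_Suc)
  then show ?thesis by simp
qed

lemma pl_Suc_left: "pl (pl a on) n = pl (pl a n) on"
proof -
  have "sat M (env a zr n) [] (Free vA \<^bold>+ \<^bold>1 \<^bold>+ Free vN \<^bold>= Free vA \<^bold>+ Free vN \<^bold>+ \<^bold>1)"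
    by (rule qf_induct) (simp_all add: pl_Suc)
  then show ?thesis by simp
qed

lemma pl_comm: "pl a n = pl n a"
proof -
  have "sat M (env a zr n) [] (Free vA \<^bold>+ Free vN \<^bold>= Free vN \<^bold>+ Free vA)"
    by (rule qf_induct) (simp_all add: pl_Suc pl_Suc_left)
  then show ?thesis by simp
qed

lemma pl_assoc: "pl (pl a b) n = pl a (pl b n)"
proof -
  have "sat M (env a b n) [] (Free vA \<^bold>+ Free vB \<^bold>+ Free vN \<^bold>= Free vA \<^bold>+ (Free vB \<^bold>+ Free vN))"
    by (rule qf_induct) (simp_all add: pl_Suc)
  then show ?thesis by simp
qed

lemma pl_left_comm: "pl a (pl b n) = pl b (pl a n)"
  using pl_assoc pl_comm by metis

lemmas pl_ac = pl_assoc pl_comm pl_left_comm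

lemma tm_zr_left [simp]: "tm zr n = zr"
proof -
  have "sat M (env zr zr n) [] (\<^bold>0 \<^bold>* Free vN \<^bold>= \<^bold>0)"
    by (rule qf_induct) (simp_all add: tm_Suc)
  then show ?thesis by simp
qed

lemma tm_pl_left: "tm (pl a b) n = pl (tm a n) (tm b n)"
proof -
  have "sat M (env a b n) [] ((Free vA \<^bold>+ Free vB) \<^bold>* Free vN \<^bold>= Free vA \<^bold>* Free vN \<^bold>+ Free vB \<^bold>* Free vN)"
    by (rule qf_induct) (simp_all add: tm_Suc pl_ac)
  then show ?thesis by simp
qed

lemma tm_on_left [simp]: "tm on n = n"
proof -
  have "sat M (env zr zr n) [] (\<^bold>1 \<^bold>* Free vN \<^bold>= Free vN)"
    by (rule qf_induct) (simp_all add: tm_Suc)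
  then show ?thesis by simp
qed

lemma tm_comm: "tm a n = tm n a"
proof -
  have "sat M (env a zr n) [] (Free vA \<^bold>* Free vN \<^bold>= Free vN \<^bold>* Free vA)"
    by (rule qf_induct) (simp_all add: tm_Suc tm_pl_left)
  then show ?thesis by simp
qed

lemma tm_on [simp]: "tm n on = n"
  by (simp add: tm_comm[of n])

lemma tm_assoc: "tm (tm a b) n = tm a (tm b n)"
proof -
  have *: "tm a (pl b c) = pl (tm a b) (tm a c)" for a b c
    using tm_pl_left[of b c a] by (simp add: tm_comm)
  have "sat M (env a b n) [] (Free vA \<^bold>* Free vB \<^bold>* Free vN \<^bold>= Free vA \<^bold>* (Free vB \<^bold>* Free vN))"
    by (rule qf_induct) (simp_all add: tm_Suc *)
  then show ?thesis by simp
qed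

definition "pr n = ap M (Nt \<rightarrow> Nt) (sem M (\<lambda>_. zr) [] pred_tm) n"
definition "mn a b = ap2 (sem M (\<lambda>_. zr) [] monus_tm) a b"

lemma sem_pred [simp]: "sem M e [] pred_tm \<bullet> n = pr n"
  unfolding pr_def using sem_cong[of pred_tm e "\<lambda>_. zr" M "[]"] by simp
lemma sem_monus [simp]: "ap2 (sem M e [] monus_tm) a b = mn a b"
  unfolding mn_def using sem_cong[of monus_tm e "\<lambda>_. zr" M "[]"] by simp

lemma pr_simps [simp]: "pr zr = zr" "pr (pl n on) = n"
  by (simp_all add: pr_def pred_tm_def)

lemma mn_simps [simp]: "mn a zr = a" "mn a (pl b on) = pr (mn a b)"
  by (simp_all add: mn_def monus_tm_def sem_upd_fresh)

lemma mn_on [simp]: "mn a on = pr a"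
  using mn_simps(2)[of a zr] by (simp del: mn_simps(2))

lemma mn_Suc_Suc: "mn (pl a on) (pl n on) = mn a n"
proof -
  have "sat M (env a zr n) [] ((Free vA \<^bold>+ \<^bold>1) \<^bold>- (Free vN \<^bold>+ \<^bold>1) \<^bold>= Free vA \<^bold>- Free vN)"
    by (rule qf_induct) (simp_all)
  then show ?thesis by simp
qed

lemma mn_add [simp]: "mn (pl a n) n = a"
proof -
  have "sat M (env a zr n) [] ((Free vA \<^bold>+ Free vN) \<^bold>- Free vN \<^bold>= Free vA)"
    by (rule qf_induct) (simp_all add: pl_Suc mn_Suc_Suc del: mn_simps(2))
  then show ?thesis by simp
qed

lemma mn_zr_left [simp]: "mn zr n = zr"
proof -
  have "sat M (env zr zr n) [] (\<^bold>0 \<^bold>- Free vN \<^bold>= \<^bold>0)"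
    by (rule qf_induct) simp_all
  then show ?thesis by simp
qed

lemma mn_pl: "mn a (pl b n) = mn (mn a b) n"
proof -
  have "sat M (env a b n) [] (Free vA \<^bold>- (Free vB \<^bold>+ Free vN) \<^bold>= Free vA \<^bold>- Free vB \<^bold>- Free vN)"
    by (rule qf_induct) (simp_all add: pl_Suc)
  then show ?thesis by simp
qed

lemma pl_cancel [simp]: "pl a n = pl b n \<longleftrightarrow> a = b" "pl n a = pl n b \<longleftrightarrow> a = b"
  using mn_add pl_comm by metis+

lemma zr_or_Suc: "n = zr \<or> (\<exists>m. n = pl m on)"
proof -
  have "sat M (env zr zr n) [] (Free vN \<^bold>= \<^bold>0 \<^bold>\<or> Free vN \<^bold>= pred_tm \<cdot> Free vN \<^bold>+ \<^bold>1)"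
    by (rule qf_induct) simp_all
  then show ?thesis by auto
qed

text \<open>The axioms describe \<open><\<close> only by its behaviour at 0 and successors. Cut-off
  subtraction is the explicit term that connects it with addition.\<close>

lemma ls_imp_pl: "ls M a n \<Longrightarrow> n = pl a (mn n a)"
proof -
  have *: "mn (pl a k) a = k" for a k using mn_add[of k a] by (simp add: pl_comm)
  have "sat M (env a zr n) [] (Free vA \<^bold>< Free vN \<^bold>\<longrightarrow> Free vN \<^bold>= Free vA \<^bold>+ (Free vN \<^bold>- Free vA))"
  proof (rule qf_induct)
    fix n
    assume "sat M (env a zr n) [] (Free vA \<^bold>< Free vN \<^bold>\<longrightarrow> Free vN \<^bold>= Free vA \<^bold>+ (Free vN \<^bold>- Free vA))"
    then have IH: "n = pl a (mn n a)" if "ls M a n" using that by simp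
    have "pl n on = pl a (mn (pl n on) a)" if l: "ls M a (pl n on)"
    proof -
      obtain k where "n = pl a k" using l IH ls_Suc pl_zr by metis
      then show ?thesis using *[of a "pl k on"] by (simp add: pl_Suc)
    qed
    then show "sat M (env a zr (pl n on)) [] (Free vA \<^bold>< Free vN \<^bold>\<longrightarrow> Free vN \<^bold>= Free vA \<^bold>+ (Free vN \<^bold>- Free vA))"
      by simp
  qed simp_all
  then show "ls M a n \<Longrightarrow> n = pl a (mn n a)" by simp
qed

lemma pl_on_neq_self [simp]: "pl n on \<noteq> n" "n \<noteq> pl n on" "pl n (pl k on) \<noteq> n"
  using pl_cancel(2)[of n on zr] pl_on_neq[of zr] pl_cancel(2)[of n "pl k on" zr] by auto

lemma ls_irrefl: "\<not> ls M n n"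
proof -
  have "sat M (env zr zr n) [] (\<^bold>\<not> Free vN \<^bold>< Free vN)"
  proof (rule qf_induct)
    fix n
    have "\<not> ls M (pl n on) n"
    proof
      assume "ls M (pl n on) n"
      then have "n = pl (pl n on) (mn n (pl n on))" by (rule ls_imp_pl)
      then have "n = pl n (pl (mn n (pl n on)) on)" by (simp add: pl_ac)
      then show False using pl_on_neq_self(3) by metis
    qed
    then show "sat M (env zr zr (pl n on)) [] (\<^bold>\<not> Free vN \<^bold>< Free vN)" by (simp add: ls_Suc)
  qed simp_all
  then show ?thesis by simp
qed

lemma ls_pl: "ls M a (pl (pl a n) on)"
proof -
  have "sat M (env a zr n) [] (Free vA \<^bold>< Free vA \<^bold>+ Free vN \<^bold>+ \<^bold>1)"
    by (rule qf_induct) (simp_all add: pl_Suc ls_Suc)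
  then show ?thesis by simp
qed

lemma ls_iff: "ls M a b \<longleftrightarrow> (\<exists>k. b = pl (pl a k) on)"
proof
  assume a: "ls M a b"
  then have b: "b = pl a (mn b a)" by (rule ls_imp_pl)
  then have "mn b a \<noteq> zr" using a ls_irrefl by auto
  then show "\<exists>k. b = pl (pl a k) on" using b zr_or_Suc[of "mn b a"] pl_Suc by metis
qed (auto simp: ls_pl)

lemma ls_linear: "ls M a n \<or> a = n \<or> ls M n a"
proof -
  have "sat M (env a zr n) [] (Free vA \<^bold>< Free vN \<^bold>\<or> Free vA \<^bold>= Free vN \<^bold>\<or> Free vN \<^bold>< Free vA)"
  proof (rule qf_induct)
    show "sat M (env a zr zr) [] (Free vA \<^bold>< Free vN \<^bold>\<or> Free vA \<^bold>= Free vN \<^bold>\<or> Free vN \<^bold>< Free vA)"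
      using zr_or_Suc[of a] by (auto simp: ls_iff)
    fix n
    assume "sat M (env a zr n) [] (Free vA \<^bold>< Free vN \<^bold>\<or> Free vA \<^bold>= Free vN \<^bold>\<or> Free vN \<^bold>< Free vA)"
    then consider "ls M a n" | "a = n" | k where "a = pl (pl n k) on" by (auto simp: ls_iff)
    then have "ls M a (pl n on) \<or> a = pl n on \<or> ls M (pl n on) a"
    proof cases
      case 3
      then show ?thesis using zr_or_Suc[of k] by (auto simp: ls_iff pl_ac)
    qed (auto simp: ls_Suc)
    then show "sat M (env a zr (pl n on)) [] (Free vA \<^bold>< Free vN \<^bold>\<or> Free vA \<^bold>= Free vN \<^bold>\<or> Free vN \<^bold>< Free vA)"
      by simp
  qed simp_all
  then show ?thesis by simp
qed

lemma ls_trans: "ls M a b \<Longrightarrow> ls M b c \<Longrightarrow> ls M a c"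
  unfolding ls_iff using pl_assoc pl_Suc by metis

definition "le a b \<longleftrightarrow> ls M a b \<or> a = b"

lemma le_iff: "le a b \<longleftrightarrow> (\<exists>k. b = pl a k)"
  unfolding le_def ls_iff using zr_or_Suc pl_Suc pl_zr by metis

end

context aca_model
begin

lemma mn_pl_left [simp]: "mn (pl a b) a = b"
  using mn_add[of b a] by (simp add: pl_comm)

lemma mn_le: "le a b \<Longrightarrow> mn a b = zr"
proof -
  have "mn a (pl a k) = zr" for k using mn_add[of zr a] by (simp add: mn_pl)
  then show "le a b \<Longrightarrow> mn a b = zr" by (auto simp: le_iff)
qed

lemma le_linear: "le a b \<or> le b a"
  using ls_linear by (auto simp: le_def)

text \<open>Stated as the class predicate, so that the library on ordered semirings and the
  arithmetic procedures apply once a carrier type has these operations as its instance.\<close>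

lemma class_arith: "class.discrete_linordered_semidom pl mn le (ls M) zr tm on"
proof unfold_locales
  fix a b c
  show "pl (pl a b) c = pl a (pl b c)" "tm (tm a b) c = tm a (tm b c)" "pl a b = pl b a" "tm a b = tm b a"
    by (fact pl_assoc tm_assoc pl_comm tm_comm)+
  show "pl zr a = a" "tm on a = a" "mn (pl a b) a = b" "mn (mn a b) c = mn a (pl b c)" "tm zr a = zr" "tm a zr = zr"
    by (simp_all add: mn_pl)
  show "tm (pl a b) c = pl (tm a c) (tm b c)" by (rule tm_pl_left)
  show "zr \<noteq> on" using pl_on_neq[of zr] by simp
  have d: "tm a (pl b c) = pl (tm a b) (tm a c)" for a b c
    using tm_pl_left[of b c a] by (simp add: tm_comm)
  show "tm a (pl b c) = pl (tm a b) (tm a c)" by (rule d)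
  show "tm a (mn b c) = mn (tm a b) (tm a c)"
  proof (cases "le b c")
    case True
    moreover have "le (tm a b) (tm a c)" using True d by (auto simp: le_iff)
    ultimately show ?thesis by (simp add: mn_le)
  next
    case False
    then obtain k where "b = pl c k" using le_linear le_iff by blast
    then show ?thesis by (simp add: d)
  qed
  show "tm a b \<noteq> zr" if nz: "a \<noteq> zr" "b \<noteq> zr"
  proof -
    obtain a' b' where "a = pl a' on" "b = pl b' on" using zr_or_Suc[of a] zr_or_Suc[of b] nz by blast
    then show ?thesis by (simp add: d tm_pl_left flip: pl_assoc)
  qed
  show "ls M a b \<longleftrightarrow> le a b \<and> \<not> le b a" using ls_irrefl ls_trans by (auto simp: le_def)
  show "le a a" by (simp add: le_def)
  show "le a b \<Longrightarrow> le b c \<Longrightarrow> le a c" using ls_trans by (auto simp: le_def)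
  show "le a b \<Longrightarrow> le b a \<Longrightarrow> a = b" using ls_trans ls_irrefl by (auto simp: le_def)
  show "le a b \<or> le b a" by (rule le_linear)
  show "le a b \<Longrightarrow> le (pl c a) (pl c b)" by (auto simp: le_iff pl_assoc)
  show "ls M a b \<Longrightarrow> ls M zr c \<Longrightarrow> ls M (tm c a) (tm c b)"
  proof -
    assume "ls M a b" "ls M zr c"
    then obtain j k where "b = pl (pl a j) on" "c = pl k on" by (auto simp: ls_iff)
    then have "tm c b = pl (pl (tm c a) (pl (pl (tm k j) j) k)) on" by (simp add: d tm_pl_left pl_ac)
    then show ?thesis by (auto simp: ls_iff)
  qed
  show "ls M zr on" using ls_iff[of zr on] by (metis pl_zr_left)
  show "le b a \<Longrightarrow> pl (mn a b) b = a" by (auto simp: le_iff pl_comm)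
  show "ls M a b \<longleftrightarrow> le (pl a on) b" by (auto simp: le_iff ls_iff pl_ac)
qed

end

section \<open>A type for the numbers of a model\<close>

text \<open>
  Linear arithmetic wants the numbers of a model to form an instance of a type class, which cannot be
  done for all models at once. So one model is singled out, namely a counterexample to the theorem; if
  there is none, the standard operations take its place.
\<close>

definition claims :: "fm set" where
  "claims = {QF_AC01 \<^bold>\<longrightarrow> item_ii, item_ii \<^bold>\<longrightarrow> item_iii, item_iii \<^bold>\<longrightarrow> cocode1}"

definition counterexample :: "elem str \<Rightarrow> bool" where
  "counterexample M \<longleftrightarrow> extensional M \<and> (\<forall>\<gamma> \<in> ACA0w \<union> {IND1}. valid M \<gamma>) \<and> (\<exists>\<phi> \<in> claims. \<not> valid M \<phi>)"

definition the_model :: "elem str" where "the_model = (SOME M. counterexample M)"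

instantiation elem :: discrete_linordered_semidom
begin

definition "zero_elem = (if aca_model the_model then aca_model.zr the_model else Elem 0)"
definition "one_elem = (if aca_model the_model then aca_model.on the_model else Elem 1)"
definition "plus_elem a b = (if aca_model the_model then aca_model.pl the_model a b
  else case (a, b) of (Elem m, Elem n) \<Rightarrow> Elem (m + n))"
definition "times_elem a b = (if aca_model the_model then aca_model.tm the_model a b
  else case (a, b) of (Elem m, Elem n) \<Rightarrow> Elem (m * n))"
definition "minus_elem a b = (if aca_model the_model then aca_model.mn the_model a b
  else case (a, b) of (Elem m, Elem n) \<Rightarrow> Elem (m - n))"
definition "less_eq_elem a b = (if aca_model the_model then aca_model.le the_model a b
  else case (a, b) of (Elem m, Elem n) \<Rightarrow> m \<le> n)"
definition "less_elem a b = (if aca_model the_model then ls the_model a b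
  else case (a, b) of (Elem m, Elem n) \<Rightarrow> m < n)"

lemmas elem_ops = zero_elem_def one_elem_def plus_elem_def times_elem_def minus_elem_def
  less_eq_elem_def less_elem_def

lemma class_elem: "class.discrete_linordered_semidom (+) (-) (\<le>) (<) 0 (*) (1 :: elem)"
proof (cases "aca_model the_model")
  case True
  then have "(+) = aca_model.pl the_model" "(-) = aca_model.mn the_model" "(\<le>) = aca_model.le the_model"
    "(<) = ls the_model" "0 = aca_model.zr the_model" "(*) = aca_model.tm the_model" "1 = aca_model.on the_model"
    by (auto simp: elem_ops fun_eq_iff)
  then show ?thesis using aca_model.class_arith[OF True] by simp
next
  case False
  note [simp] = elem_ops[unfolded if_not_P[OF False]]
  show ?thesis
    by unfold_locales (auto split: elem.splits simp: algebra_simps diff_mult_distrib2)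
qed

instance by (rule discrete_linordered_semidom.intro_of_class) (fact class_elem)

end

text \<open>A model whose own arithmetic is that of the type class of its carrier. For the
  singled-out model this holds by the choice of the instance for \<open>elem\<close>.\<close>

locale nmodel = aca_model M for M :: "'d :: discrete_linordered_semidom str" +
  assumes ops: "aca_model.zr M = 0" "aca_model.on M = 1" "aca_model.pl M = (+)" "aca_model.tm M = (*)"
    "aca_model.mn M = (-)" "ls M = (<)"

lemma nmodel_the_model: "aca_model the_model \<Longrightarrow> nmodel the_model"
  by (intro nmodel.intro nmodel_axioms.intro) (auto simp: elem_ops fun_eq_iff)

lemma fvt_opent: "fvt (opent k u t) \<subseteq> fvt u \<union> fvt t"
  by (induction t) auto

lemma fv_opn: "fv (opn k u \<phi>) \<subseteq> fvt u \<union> fv \<phi>"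
proof (induction \<phi> arbitrary: k)
  case (Eq s t)
  then show ?case using fvt_opent[of k u s] fvt_opent[of k u t] by auto
next
  case (Less s t)
  then show ?case using fvt_opent[of k u s] fvt_opent[of k u t] by auto
next
  case (Imp \<phi> \<psi>)
  show ?case using Imp[of k] by auto
next
  case (All \<sigma> \<phi>)
  show ?case using All[of "Suc k"] by auto
qed auto

section \<open>Arithmetical comprehension\<close>

context nmodel
begin

lemmas [simp] = ops

lemma nonneg [simp]: "0 \<le> (n :: 'd)"
proof -
  have "(\<le>) = le" using ops by (auto simp: fun_eq_iff le_def less_le)
  moreover have "le zr n" by (auto simp: le_iff)
  ultimately show ?thesis by simp
qed

lemma not_neg [simp]: "\<not> n < (0 :: 'd)" "n \<le> 0 \<longleftrightarrow> n = (0 :: 'd)" "0 < n \<longleftrightarrow> n \<noteq> (0 :: 'd)"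
  using nonneg by (auto simp: not_less order.antisym less_le)

lemma diff_zero [simp]: "a \<le> b \<Longrightarrow> a - b = (0 :: 'd)"
  using mn_le[of a b] by (simp add: le_def le_less)

lemma less_Suc: "m < n + 1 \<longleftrightarrow> m < n \<or> m = (n :: 'd)"
  using ls_Suc by simp

lemma rec_Suc [simp]: "rec f m 0 = m" "rec f m (n + 1) = ap2 f n (rec f m n)"
  using rec_simps by simp_all

lemma zero_or_Suc: "n = 0 \<or> (\<exists>m. n = m + (1 :: 'd))"
  using zr_or_Suc by simp

definition "E = (SOME E. \<forall>f. (ap M T2 E f = 0 \<or> ap M T2 E f = 1) \<and> ((\<exists>n. f \<bullet> n = 0) \<longleftrightarrow> ap M T2 E f = 0))"

lemma E: "ap M T2 E f = (if \<exists>n. f \<bullet> n = 0 then 0 else 1)"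
proof -
  have "valid M exists2" by (rule ACA) (simp add: ACA0w_def)
  then have "\<exists>E. \<forall>f. (ap M T2 E f = 0 \<or> ap M T2 E f = 1) \<and> ((\<exists>n. f \<bullet> n = 0) \<longleftrightarrow> ap M T2 E f = 0)"
    by (simp add: exists2_def valid_def)
  from someI_ex[OF this] show ?thesis unfolding E_def[symmetric] by auto
qed

text \<open>Feferman's search operator, which returns a zero of \<open>f\<close> if there is
  one.\<close>

definition "mu = (SOME Y. \<forall>f. (\<exists>n. f \<bullet> n = 0) \<longrightarrow> f \<bullet> ap M T2 Y f = 0)"

text \<open>With \<open>E\<close> as a parameter, "if \<open>E f\<close> is 0 then
  \<open>f n\<close> is 0" is quantifier-free, and for every \<open>f\<close> some \<open>n\<close>
  satisfies it; \<open>QF_AC10\<close> picks the \<open>n\<close> as a function of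
  \<open>f\<close>.\<close>

lemma mu: "f \<bullet> n = 0 \<Longrightarrow> f \<bullet> ap M T2 mu f = 0"
proof -
  let ?E = "(''E'', T2)" and ?f = "(''f'', T1)" and ?n = "(''n'', Nt)" and ?Y = "(''Y'', T2)"
  let ?\<phi> = "Free ?E \<cdot> Free ?f \<^bold>= \<^bold>0 \<^bold>\<longrightarrow> Free ?f \<cdot> Free ?n \<^bold>= \<^bold>0"
  let ?\<psi> = "Forall ?f (Exists ?n ?\<phi>) \<^bold>\<longrightarrow> Exists ?Y (Forall ?f (subst ?n (Free ?Y \<cdot> Free ?f) ?\<phi>))"
  have "closures ?\<psi> \<subseteq> QF_AC10" unfolding QF_AC10_def
    by (intro Union_upper CollectI exI[of _ ?f] exI[of _ ?n] exI[of _ ?Y] exI[of _ ?\<phi>]) simp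
  then have "closures ?\<psi> \<subseteq> RCA0w" by (auto simp: RCA0w_def)
  then have "sat M ((\<lambda>_. 0)(?E := E)) [] ?\<psi>"
    using RCA by (intro valid_closures) (auto intro!: wf_Forall wf_Exists)
  moreover have ite: "((if P then 0 else 1) = (0 :: 'd)) = P" for P by simp
  ultimately have "\<exists>Y. \<forall>f. (\<exists>n. f \<bullet> n = 0) \<longrightarrow> f \<bullet> ap M T2 Y f = 0"
    by (simp add: sat_Forall sat_Exists lc_Forall lc_Exists E ite)
  from someI_ex[OF this] show "f \<bullet> n = 0 \<Longrightarrow> f \<bullet> ap M T2 mu f = 0" unfolding mu_def[symmetric] by blast
qed

text \<open>Truth values become numbers, 0 for true: connectives turn into arithmetic and number
  quantifiers into applications of \<open>E\<close>. As \<open>E\<close> is an element and not a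
  term, it enters as the value of a variable \<open>v\<close>.\<close>

lemma char_term:
  assumes "snd v = T2"
  shows "arith \<phi> \<Longrightarrow> wf [] \<phi> \<Longrightarrow> v \<notin> fv \<phi> \<Longrightarrow> \<exists>t. tyof [] t = Some Nt \<and> fvt t \<subseteq> insert v (fv \<phi>) \<and>
    (\<forall>e. e v = E \<longrightarrow> sem M e [] t = (if sat M e [] \<phi> then 0 else 1))"
proof (induction "size \<phi>" arbitrary: \<phi> rule: less_induct)
  case less
  show ?case
  proof (cases \<phi>)
    case Bot
    then show ?thesis by (intro exI[of _ "\<^bold>1"]) simp
  next
    case (Eq s t)
    \<comment> \<open>\<open>1 - (1 - d)\<close> is the sign of \<open>d\<close>, and
      \<open>d\<close>, the sum of both cut-off differences, vanishes exactly if
      \<open>a = b\<close>.\<close>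
    have *: "(1 :: 'd) - (1 - (a - b + (b - a))) = (if a = b then 0 else 1)" for a b :: 'd
    proof (cases a b rule: linorder_cases)
      case less
      then have "a - b + (b - a) \<ge> 1" using less_iff_succ_less_eq[of a b] le_add_diff_inverse2[of a b]
        by (simp add: less_le) (metis add.commute add_le_imp_le_right le_add_diff_inverse2)
      then show ?thesis using less by simp
    next
      case greater
      then have "a - b + (b - a) \<ge> 1" using less_iff_succ_less_eq[of b a] le_add_diff_inverse2[of b a]
        by (simp add: less_le) (metis add.commute add_le_imp_le_right le_add_diff_inverse2)
      then show ?thesis using greater by simp
    qed simp
    show ?thesis using less.prems Eq
      by (intro exI[of _ "\<^bold>1 \<^bold>- (\<^bold>1 \<^bold>- ((s \<^bold>- t) \<^bold>+ (t \<^bold>- s)))"]) (auto simp: *)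
  next
    case (Less s t)
    have *: "(1 :: 'd) - (b - a) = (if a < b then 0 else 1)" for a b :: 'd
    proof (cases "a < b")
      case True
      then have "b - a \<ge> 1" using less_iff_succ_less_eq[of a b]
        by (simp add: less_le) (metis add.commute add_le_imp_le_right le_add_diff_inverse2)
      then show ?thesis using True by simp
    qed simp
    show ?thesis using less.prems Less
      by (intro exI[of _ "\<^bold>1 \<^bold>- (t \<^bold>- s)"]) (auto simp: *)
  next
    case (Imp \<phi>1 \<phi>2)
    obtain t1 where t1: "tyof [] t1 = Some Nt" "fvt t1 \<subseteq> insert v (fv \<phi>1)"
      "\<And>e. e v = E \<Longrightarrow> sem M e [] t1 = (if sat M e [] \<phi>1 then 0 else 1)"
      using less.hyps[of \<phi>1] less.prems Imp by auto
    obtain t2 where t2: "tyof [] t2 = Some Nt" "fvt t2 \<subseteq> insert v (fv \<phi>2)"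
      "\<And>e. e v = E \<Longrightarrow> sem M e [] t2 = (if sat M e [] \<phi>2 then 0 else 1)"
      using less.hyps[of \<phi>2] less.prems Imp by auto
    \<comment> \<open>The product is 1 exactly if the premise has value 0 and the conclusion has
      value 1.\<close>
    show ?thesis
      by (rule exI[of _ "t2 \<^bold>* (\<^bold>1 \<^bold>- t1)"]) (use t1 t2 Imp in auto)
  next
    case (All \<sigma> \<psi>)
    obtain s where s: "(s, Nt) \<notin> insert v (fv \<psi>)" using fresh_var[of "insert v (fv \<psi>)"] by auto
    let ?x = "(s, Nt)"
    have \<psi>: "wf [Nt] \<psi>" "arith \<psi>" "\<sigma> = Nt" using less.prems All by auto
    have fo: "fv (opn 0 (Free ?x) \<psi>) \<subseteq> insert ?x (fv \<psi>)" using fv_opn[of 0 "Free ?x" \<psi>] by simp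
    have w: "wf [] (opn 0 (Free ?x) \<psi>)" using wf_opn[of "Free ?x" Nt "[]" \<psi>] \<psi> by simp
    obtain t where t: "tyof [] t = Some Nt" "fvt t \<subseteq> insert v (fv (opn 0 (Free ?x) \<psi>))"
      "\<And>e. e v = E \<Longrightarrow> sem M e [] t = (if sat M e [] (opn 0 (Free ?x) \<psi>) then 0 else 1)"
      using less.hyps[of "opn 0 (Free ?x) \<psi>"] less.prems All w \<psi> fo s assms by auto
    have "Forall ?x (opn 0 (Free ?x) \<psi>) = \<phi>" using All s \<psi> by (simp add: Forall_def close_opn)
    then have sat: "sat M e [] \<phi> \<longleftrightarrow> (\<forall>d. sat M (e(?x := d)) [] (opn 0 (Free ?x) \<psi>))" for e
      using sat_Forall[OF wf_lc0[OF w]] by metis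
    \<comment> \<open>\<open>?l\<close> vanishes exactly at the counterexamples, so \<open>E\<close>
      yields 0 if one exists, and the outer subtraction from 1 turns that into falsity.\<close>
    let ?l = "fn s Nt (\<lambda>_. \<^bold>1 \<^bold>- t)"
    have l: "sem M e [] ?l \<bullet> d = (if sat M (e(?x := d)) [] (opn 0 (Free ?x) \<psi>) then 1 else 0)"
      if "e v = E" for e d
    proof -
      have "(e(?x := d)) v = E" using that s by auto
      then show ?thesis using t by simp
    qed
    show ?thesis
    proof (intro exI[of _ "\<^bold>1 \<^bold>- Free v \<cdot> ?l"] conjI allI impI)
      show "tyof [] (\<^bold>1 \<^bold>- Free v \<cdot> ?l) = Some Nt" using t assms by simp
      show "fvt (\<^bold>1 \<^bold>- Free v \<cdot> ?l) \<subseteq> insert v (fv \<phi>)" using t fo All by auto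
      show "sem M e [] (\<^bold>1 \<^bold>- Free v \<cdot> ?l) = (if sat M e [] \<phi> then 0 else 1)" if e: "e v = E" for e
      proof -
        have "sem M e [] (\<^bold>1 \<^bold>- Free v \<cdot> ?l) = 1 - ap M T2 E (sem M e [] ?l)"
          using t assms e by simp
        then show ?thesis using e by (simp add: E l sat del: sem_fn)
      qed
    qed
  qed
qed

lemma fresh2:
  assumes "finite (V :: var set)"
  shows "\<exists>v w. v \<notin> V \<and> w \<notin> V \<and> v \<noteq> w \<and> snd v = T2 \<and> snd w = T2"
proof -
  obtain s where "(s, T2) \<notin> V" using fresh_var[OF assms] by blast
  moreover obtain t where "(t, T2) \<notin> insert (s, T2) V" 
    using fresh_var[of "insert (s, T2) V" T2] assms by auto
  ultimately show ?thesis by (intro exI[of _ "(s, T2)"] exI[of _ "(t, T2)"]) auto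
qed

lemma lam_ap [simp]:
  "tyof [] t = Some \<tau> \<Longrightarrow> snd x = \<sigma> \<Longrightarrow> ap M (\<sigma> \<rightarrow> \<tau>) (sem M e [] (lam x t)) d = sem M (e(x := d)) [] t"
  using sem_lam by blast

text \<open>The two arguments may be of any type, since abstraction is unrestricted. Coding truth by
  0 agrees with \<open>QF_AC01\<close> and \<open>IND1\<close>.\<close>

lemma comprehension2:
  assumes "arith \<phi>" "wf [] \<phi>" "x \<noteq> y"
  obtains F where "\<And>c d. ap M (snd y \<rightarrow> Nt) (ap M (snd x \<rightarrow> snd y \<rightarrow> Nt) F c) d =
    (if sat M (e(x := c, y := d)) [] \<phi> then 0 else 1)"
proof -
  have "finite ({x, y} \<union> fv \<phi>)" by simp
  from fresh2[OF this] obtain v where v: "v \<notin> {x, y} \<union> fv \<phi>" "snd v = T2" by blast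
  obtain t where t: "tyof [] t = Some Nt"
      "\<And>e. e v = E \<Longrightarrow> sem M e [] t = (if sat M e [] \<phi> then 0 else 1)"
    using char_term[OF v(2) assms(1,2)] v(1) by blast
  show thesis
  proof (rule that[of "sem M (e(v := E)) [] (lam x (lam y t))"])
    fix c d
    have "(e(v := E, x := c, y := d)) v = E" using v by simp
    moreover have "e(v := E, x := c, y := d) = (e(x := c, y := d))(v := E)" using v by (auto simp: fun_eq_iff)
    ultimately show "ap M (snd y \<rightarrow> Nt) (ap M (snd x \<rightarrow> snd y \<rightarrow> Nt)
        (sem M (e(v := E)) [] (lam x (lam y t))) c) d = (if sat M (e(x := c, y := d)) [] \<phi> then 0 else 1)"
      using t v tyof_lam[OF t(1)] sat_upd_fresh[of v \<phi> M "e(x := c, y := d)"] by simp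
  qed
qed

lemma comprehension:
  assumes "arith \<phi>" "wf [] \<phi>"
  obtains F where "\<And>d. ap M (snd x \<rightarrow> Nt) F d = (if sat M (e(x := d)) [] \<phi> then 0 else 1)"
proof -
  obtain s where s: "(s, Nt) \<notin> insert x (fv \<phi>)" using fresh_var[of "insert x (fv \<phi>)"] by auto
  let ?y = "(s, Nt)"
  obtain F where F: "\<And>c d. ap M (snd x \<rightarrow> Nt) (ap M (snd ?y \<rightarrow> snd x \<rightarrow> Nt) F c) d =
    (if sat M (e(?y := c, x := d)) [] \<phi> then 0 else 1)"
    using comprehension2[of \<phi> ?y x e] assms s by auto
  show thesis
  proof (rule that)
    fix d
    have "e(?y := 0, x := d) = (e(x := d))(?y := 0)" using s by (auto simp: fun_eq_iff)
    then show "ap M (snd x \<rightarrow> Nt) (ap M (snd ?y \<rightarrow> snd x \<rightarrow> Nt) F 0) d = (if sat M (e(x := d)) [] \<phi> then 0 else 1)"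
      using F[of 0 d] s by (simp add: sat_upd_fresh)
  qed
qed

text \<open>The number is found by applying \<open>mu\<close> to the characteristic function of
  \<open>\<phi>\<close> in \<open>z\<close>, uniformly in the arguments \<open>x\<close> and
  \<open>y\<close>.\<close>

lemma choice2:
  assumes "arith \<phi>" "wf [] \<phi>" "x \<noteq> y" "z \<notin> {x, y}" "snd z = Nt"
  obtains G where "\<And>c d n. sat M (e(x := c, y := d, z := n)) [] \<phi> \<Longrightarrow>
    sat M (e(x := c, y := d, z := ap M (snd y \<rightarrow> Nt) (ap M (snd x \<rightarrow> snd y \<rightarrow> Nt) G c) d)) [] \<phi>"
proof -
  have "finite ({x, y, z} \<union> fv \<phi>)" by simp
  from fresh2[OF this] obtain v w where v: "v \<notin> {x, y, z} \<union> fv \<phi>" "snd v = T2"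
    "w \<notin> {x, y, z} \<union> fv \<phi>" "snd w = T2" "v \<noteq> w" by blast
  obtain t where t: "tyof [] t = Some Nt" "fvt t \<subseteq> insert v (fv \<phi>)"
      "\<And>e. e v = E \<Longrightarrow> sem M e [] t = (if sat M e [] \<phi> then 0 else 1)"
    using char_term[OF v(2) assms(1,2)] v(1) by blast
  define s where "s = Free w \<cdot> lam z t"
  have ty: "tyof [] s = Some Nt" using tyof_lam[OF t(1), of z] v assms by (simp add: s_def)
  let ?e = "e(v := E, w := mu)"
  show thesis
  proof (rule that[of "sem M ?e [] (lam x (lam y s))"])
    fix c d n
    assume n: "sat M (e(x := c, y := d, z := n)) [] \<phi>"
    let ?e' = "?e(x := c, y := d)"
    have l: "sem M ?e' [] (lam z t) \<bullet> m = (if sat M (e(x := c, y := d, z := m)) [] \<phi> then 0 else 1)" for m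
    proof -
      have "(?e'(z := m)) v = E" using v by simp
      moreover have "?e'(z := m) = (e(x := c, y := d, z := m))(v := E, w := mu)" using v by (auto simp: fun_eq_iff)
      ultimately show ?thesis using t v assms
        by (simp add: sat_upd_fresh del: fun_upd_apply)
    qed
    have "sem M ?e' [] (lam z t) \<bullet> n = 0" using l n by simp
    from mu[OF this] have "sat M (e(x := c, y := d, z := ap M T2 mu (sem M ?e' [] (lam z t)))) [] \<phi>"
      using l by (simp split: if_splits)
    moreover have "sem M ?e' [] s = ap M T2 mu (sem M ?e' [] (lam z t))" using v by (simp add: s_def)
    moreover have "ap M (snd y \<rightarrow> Nt) (ap M (snd x \<rightarrow> snd y \<rightarrow> Nt) (sem M ?e [] (lam x (lam y s))) c) d =
        sem M ?e' [] s"
      using tyof_lam[OF ty, of y] ty by (simp del: fun_upd_apply)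
    ultimately show "sat M (e(x := c, y := d, z := ap M (snd y \<rightarrow> Nt) (ap M (snd x \<rightarrow> snd y \<rightarrow> Nt)
        (sem M ?e [] (lam x (lam y s))) c) d)) [] \<phi>" by simp
  qed
qed

lemma choice:
  assumes "arith \<phi>" "wf [] \<phi>" "z \<noteq> x" "snd z = Nt"
  obtains G where "\<And>d n. sat M (e(x := d, z := n)) [] \<phi> \<Longrightarrow> sat M (e(x := d, z := ap M (snd x \<rightarrow> Nt) G d)) [] \<phi>"
proof -
  obtain s where s: "(s, Nt) \<notin> insert z (insert x (fv \<phi>))" using fresh_var[of "insert z (insert x (fv \<phi>))"] by auto
  let ?y = "(s, Nt)"
  obtain G where G: "\<And>c d n. sat M (e(?y := c, x := d, z := n)) [] \<phi> \<Longrightarrow>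
      sat M (e(?y := c, x := d, z := ap M (snd x \<rightarrow> Nt) (ap M (snd ?y \<rightarrow> snd x \<rightarrow> Nt) G c) d)) [] \<phi>"
    using choice2[of \<phi> ?y x z e] assms s by auto
  have eq: "sat M (e(?y := 0, x := d, z := n)) [] \<phi> \<longleftrightarrow> sat M (e(x := d, z := n)) [] \<phi>" for d n
  proof -
    have "e(?y := 0, x := d, z := n) = (e(x := d, z := n))(?y := 0)" using s by (auto simp: fun_eq_iff)
    then show ?thesis using s by (simp add: sat_upd_fresh)
  qed
  show thesis using G[of 0] unfolding eq by (rule that)
qed

text \<open>The predicates that the model itself can decide. In a nonstandard model induction fails
  for arbitrary HOL predicates.\<close>

definition decid :: "('d \<Rightarrow> bool) \<Rightarrow> bool" where
  "decid P \<longleftrightarrow> (\<exists>F. \<forall>n. F \<bullet> n = 0 \<longleftrightarrow> P n)"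

lemma decidI:
  assumes "\<And>n. P n \<longleftrightarrow> sat M (e(x := n)) [] \<phi>" "arith \<phi>" "wf [] \<phi>" "snd x = Nt"
  shows "decid P"
proof -
  obtain F where "\<And>d. ap M (snd x \<rightarrow> Nt) F d = (if sat M (e(x := d)) [] \<phi> then 0 else 1)"
    using comprehension assms by blast
  then show ?thesis using assms by (auto simp: decid_def intro!: exI[of _ F] split: if_splits)
qed

text \<open>With the deciding function as a parameter, the induction formula is the equation
  \<open>F n = 0\<close>, so quantifier-free induction reaches every arithmetical predicate.\<close>

lemma int_induct [case_names decid 0 Suc]:
  assumes "decid P" "P 0" "\<And>n. P n \<Longrightarrow> P (n + 1)"
  shows "P n"
proof -
  obtain F where F: "\<And>n. F \<bullet> n = 0 \<longleftrightarrow> P n" using assms by (auto simp: decid_def)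
  let ?F = "(''F'', T1)"
  have "sat M ((\<lambda>_. 0)(?F := F, vN := n)) [] (Free ?F \<cdot> Free vN \<^bold>= \<^bold>0)"
    by (rule qf_induct) (simp_all add: F assms)
  then show ?thesis by (simp add: F)
qed

end

section \<open>The ring of differences of an ordered semiring\<close>

\<comment> \<open>Numerators \<open>p - m\<close> of rational codes are formal differences of
  numbers. Fractions of such differences form the ordered field in which the rationals of a model
  are evaluated.\<close>
quotient_type (overloaded) 'a diff = "'a :: linordered_semidom \<times> 'a" /
  "\<lambda>x y. fst x + snd y = fst y + snd x" morphisms Rep_diff Abs_diff
proof (rule equivpI)
  show "reflp (\<lambda>x y. fst x + snd y = fst y + snd (x :: 'a \<times> 'a))" by (simp add: reflp_def)
  show "symp (\<lambda>x y. fst x + snd y = fst y + snd (x :: 'a \<times> 'a))" by (simp add: symp_def)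
  show "transp (\<lambda>x y. fst x + snd y = fst y + snd (x :: 'a \<times> 'a))"
  proof (rule transpI)
    fix x y z :: "'a \<times> 'a"
    assume *: "fst x + snd y = fst y + snd x" "fst y + snd z = fst z + snd y"
    have "fst x + snd z + snd y = fst z + snd x + snd y"
      using * by (metis add.assoc add.commute)
    then show "fst x + snd z = fst z + snd x" by simp
  qed
qed

instantiation diff :: (linordered_semidom) linordered_idom
begin

lift_definition zero_diff :: "'a diff" is "(0, 0)" .
lift_definition one_diff :: "'a diff" is "(1, 0)" .
lift_definition plus_diff :: "'a diff \<Rightarrow> 'a diff \<Rightarrow> 'a diff" is "\<lambda>x y. (fst x + fst y, snd x + snd y)"
  by simp (metis add.assoc add.commute)
lift_definition uminus_diff :: "'a diff \<Rightarrow> 'a diff" is "\<lambda>x. (snd x, fst x)"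
  by (simp add: add.commute)
definition minus_diff :: "'a diff \<Rightarrow> 'a diff \<Rightarrow> 'a diff" where "x - y = x + - y" for x y :: "'a diff"

lift_definition times_diff :: "'a diff \<Rightarrow> 'a diff \<Rightarrow> 'a diff" is
  "\<lambda>x y. (fst x * fst y + snd x * snd y, fst x * snd y + snd x * fst y)"
proof -
  fix x x' y y' :: "'a \<times> 'a"
  obtain a b where x: "x = (a, b)" by (cases x)
  obtain a' b' where x': "x' = (a', b')" by (cases x')
  obtain c d where y: "y = (c, d)" by (cases y)
  obtain c' d' where y': "y' = (c', d')" by (cases y')
  assume "fst x + snd x' = fst x' + snd x" "fst y + snd y' = fst y' + snd y"
  then have h: "a + b' = a' + b" "c + d' = c' + d" by (simp_all add: x x' y y')
  \<comment> \<open>Adding the mixed products of \<open>a'\<close>, \<open>b'\<close> with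
    \<open>c\<close>, \<open>d\<close> to both sides makes both hypotheses applicable; they cancel
    afterwards.\<close>
  have "a * c + b * d + (a' * d' + b' * c') + (b' * c + a' * d + a' * c + b' * d) =
      (a + b') * c + (a' + b) * d + a' * (c + d') + b' * (c' + d)" by (simp add: algebra_simps)
  also have "\<dots> = (a' + b) * c + (a + b') * d + a' * (c' + d) + b' * (c + d')" by (simp only: h)
  also have "\<dots> = a' * c' + b' * d' + (a * d + b * c) + (b' * c + a' * d + a' * c + b' * d)"
    by (simp add: algebra_simps)
  finally show "fst (fst x * fst y + snd x * snd y, fst x * snd y + snd x * fst y) +
       snd (fst x' * fst y' + snd x' * snd y', fst x' * snd y' + snd x' * fst y') =
       fst (fst x' * fst y' + snd x' * snd y', fst x' * snd y' + snd x' * fst y') +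
       snd (fst x * fst y + snd x * snd y, fst x * snd y + snd x * fst y)"
    by (simp add: x x' y y')
qed

lift_definition less_eq_diff :: "'a diff \<Rightarrow> 'a diff \<Rightarrow> bool" is "\<lambda>x y. fst x + snd y \<le> fst y + snd x"
proof -
  fix x x' y y' :: "'a \<times> 'a"
  assume h: "fst x + snd x' = fst x' + snd x" "fst y + snd y' = fst y' + snd y"
  have "fst x + snd y + (snd x' + snd y') = (fst x + snd x') + (snd y + snd y')" by (simp only: ac_simps)
  also have "\<dots> = (fst x' + snd x) + (snd y + snd y')" by (simp only: h)
  finally have "fst x + snd y + (snd x' + snd y') = fst x' + snd y' + (snd x + snd y)" by (simp only: ac_simps)
  moreover have "fst y + snd x + (snd x' + snd y') = (fst y + snd y') + (snd x + snd x')" by (simp only: ac_simps)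
  then have "fst y + snd x + (snd x' + snd y') = (fst y' + snd y) + (snd x + snd x')" by (simp only: h)
  then have "fst y + snd x + (snd x' + snd y') = fst y' + snd x' + (snd x + snd y)" by (simp only: ac_simps)
  ultimately show "(fst x + snd y \<le> fst y + snd x) = (fst x' + snd y' \<le> fst y' + snd x')"
    by (metis add_le_cancel_right)
qed

definition less_diff :: "'a diff \<Rightarrow> 'a diff \<Rightarrow> bool" where "x < y \<longleftrightarrow> x \<le> y \<and> \<not> y \<le> x" for x y :: "'a diff"
definition abs_diff :: "'a diff \<Rightarrow> 'a diff" where "\<bar>x\<bar> = (if x < 0 then - x else x)" for x :: "'a diff"
definition sgn_diff :: "'a diff \<Rightarrow> 'a diff" where
  "sgn x = (if x = 0 then 0 else if 0 < x then 1 else - 1)" for x :: "'a diff"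

instance
proof
  fix x y z :: "'a diff"
  show "x + y + z = x + (y + z)" "x + y = y + x" "0 + x = x" "- x + x = 0" "x * y * z = x * (y * z)"
    "x * y = y * x" "1 * x = x" "(x + y) * z = x * z + y * z" "0 \<noteq> (1 :: 'a diff)"
    by (transfer; simp add: algebra_simps)+
  show "x + y - x = y" "x - y - z = x - (y + z)" "0 * x = 0" "x * 0 = 0"
    unfolding minus_diff_def by (transfer; simp add: algebra_simps)+
  show "x - y = x + - y" "x < y \<longleftrightarrow> x \<le> y \<and> \<not> y \<le> x" "\<bar>x\<bar> = (if x < 0 then - x else x)"
    "sgn x = (if x = 0 then 0 else if 0 < x then 1 else - 1)"
    by (fact minus_diff_def less_diff_def abs_diff_def sgn_diff_def)+
  show "x \<le> x" by transfer simp
  show "x \<le> y \<or> y \<le> x" by transfer (rule linear)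
  show "x \<le> y \<Longrightarrow> y \<le> x \<Longrightarrow> x = y" by transfer (rule order.antisym)
  show "x \<le> y \<Longrightarrow> z + x \<le> z + y"
  proof transfer
    fix x y z :: "'a \<times> 'a"
    assume "fst x + snd y \<le> fst y + snd x"
    then have "fst z + snd z + (fst x + snd y) \<le> fst z + snd z + (fst y + snd x)" by (rule add_left_mono)
    then show "fst (fst z + fst x, snd z + snd x) + snd (fst z + fst y, snd z + snd y)
        \<le> fst (fst z + fst y, snd z + snd y) + snd (fst z + fst x, snd z + snd x)"
      by (simp only: fst_conv snd_conv ac_simps)
  qed
  show "x \<le> y \<Longrightarrow> y \<le> z \<Longrightarrow> x \<le> z"
  proof transfer
    fix x y z :: "'a \<times> 'a"
    assume "fst x + snd y \<le> fst y + snd x" "fst y + snd z \<le> fst z + snd y"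
    then have "fst x + snd y + (fst y + snd z) \<le> fst y + snd x + (fst z + snd y)" by (rule add_mono)
    then have "fst x + snd z + (fst y + snd y) \<le> fst z + snd x + (fst y + snd y)" by (simp add: ac_simps)
    then show "fst x + snd z \<le> fst z + snd x" by simp
  qed
  show "x < y \<Longrightarrow> 0 < z \<Longrightarrow> z * x < z * y" unfolding less_diff_def
  proof (transfer, clarsimp simp: not_le)
    fix a b c d p q :: 'a
    assume 1: "a + d < c + b" and 2: "q < p"
    \<comment> \<open>The positive factor \<open>(p, q)\<close> is the number
      \<open>k = p - q\<close>. Strictness comes from multiplying by \<open>k\<close>; the remaining
      terms are the same on both sides.\<close>
    obtain k where p: "p = k + q" using 2 le_add_diff_inverse2[of q p] by (metis less_imp_le)
    then have "0 < k" using 2 by simp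
    then have "k * (a + d) < k * (c + b)" using 1 by (rule mult_strict_left_mono[rotated])
    then have "k * (a + d) + (q * a + q * b + q * c + q * d) < k * (c + b) + (q * a + q * b + q * c + q * d)"
      by (rule add_strict_right_mono)
    moreover have "p * a + q * b + (p * d + q * c) = k * (a + d) + (q * a + q * b + q * c + q * d)"
      "p * c + q * d + (p * b + q * a) = k * (c + b) + (q * a + q * b + q * c + q * d)"
      by (simp_all add: p algebra_simps)
    ultimately have "p * a + q * b + (p * d + q * c) < p * c + q * d + (p * b + q * a)" by simp
    then show "p * a + q * b + (p * d + q * c) \<le> p * c + q * d + (p * b + q * a) \<and>
      p * a + q * b + (p * d + q * c) < p * c + q * d + (p * b + q * a)" by simp
  qed
qed

end

lift_definition of_semi :: "'a :: linordered_semidom \<Rightarrow> 'a diff" is "\<lambda>n. (n, 0)" .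

lemma of_semi [simp]: "of_semi 0 = 0" "of_semi 1 = 1" "of_semi (a + b) = of_semi a + of_semi b"
  "of_semi (a * b) = of_semi a * of_semi b" "of_semi a \<le> of_semi b \<longleftrightarrow> a \<le> b"
  by (transfer; simp)+

lemma diff_cases: "\<exists>a b. x = of_semi a - of_semi b"
  unfolding minus_diff_def by transfer auto

definition emb :: "'a :: linordered_semidom \<Rightarrow> 'a diff fract" where "emb n = Fract (of_semi n) 1"

lemma emb [simp]: "emb 0 = 0" "emb 1 = 1" "emb (a + b) = emb a + emb b" "emb (a * b) = emb a * emb b"
  "emb a \<le> emb b \<longleftrightarrow> a \<le> b"
  by (simp_all add: emb_def Zero_fract_def One_fract_def)

lemma emb_less [simp]: "emb a < emb b \<longleftrightarrow> a < b" "emb a = emb b \<longleftrightarrow> a = b"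
  by (auto simp: order.antisym less_le_not_le) (metis order.antisym order.refl emb(5))

text \<open>A positive denominator is a difference of a larger and a smaller number, hence itself a
  number. So every field element has the shape of a rational code.\<close>

lemma fract_cases:
  fixes x :: "'a :: linordered_semidom diff fract"
  shows "\<exists>a b c. 0 < c \<and> x = (emb a - emb b) / emb c"
proof (induction x rule: fract_induct_pos)
  case (Fract p q)
  obtain a b where p: "p = of_semi a - of_semi b" using diff_cases by blast
  obtain c d where q: "q = of_semi c - of_semi d" using diff_cases by blast
  have "0 < q" using Fract by simp
  then have "d < c" unfolding q by (simp add: less_le_not_le)
  then obtain e where c: "c = e + d" using le_add_diff_inverse2[of d c] by (metis less_imp_le)
  then have "0 < e" "q = of_semi e" using \<open>d < c\<close> by (simp_all add: q)
  moreover have "Fract p q = (emb a - emb b) / emb e"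
    using Fract p calculation by (simp add: emb_def)
  ultimately show ?case by blast
qed

section \<open>Rational numbers in models\<close>

context nmodel
begin

lemma sem_closed: "fvt t = {} \<Longrightarrow> sem M e b t = sem M (\<lambda>_. 0) b t"
  by (rule sem_cong) simp

lemma emb_diff: "b \<le> a \<Longrightarrow> emb (a - b) = emb a - emb (b :: 'd)"
  using emb(3)[of "a - b" b] by simp

lemma emb_nonneg [simp]: "0 \<le> emb (n :: 'd)"
  using emb(5)[of 0 n] by simp

lemma emb_pos: "n \<noteq> 0 \<Longrightarrow> 0 < emb (n :: 'd)"
  using emb_less(1)[of 0 n] by simp

text \<open>Carries the discreteness of the numbers into the field, where linear arithmetic can use
  it.\<close>

lemma emb_discrete: "a < b \<longleftrightarrow> emb a + 1 \<le> emb (b :: 'd)"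
  using less_iff_succ_less_eq[of a b] emb(5)[of "a + 1" b] by simp

lemma emb_ge1: "n \<noteq> 0 \<Longrightarrow> 1 \<le> emb (n :: 'd)"
  using emb_discrete[of 0 n] by simp

lemma one_diff: "1 - x = (if x = (0 :: 'd) then 1 else 0)"
proof (cases "x = 0")
  case False
  then have "1 \<le> x" using emb_ge1 emb(5)[of 1 x] by simp
  then show ?thesis using False by simp
qed (use le_add_diff_inverse2[of 0 "1 :: 'd"] in simp)

lemma diff_eq_0: "a - b = (0 :: 'd) \<longleftrightarrow> a \<le> b"
  using le_add_diff_inverse2[of b a] by (metis add_0 diff_zero linear)

section \<open>Integer square root, pairing, and codes of rationals\<close>

definition "isq z = sem M (\<lambda>_. 0) [] isqrt_tm \<bullet> z"

lemma sem_isqrt [simp]: "sem M e [] isqrt_tm \<bullet> z = isq z"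
  using sem_closed[of isqrt_tm e "[]"] by (simp add: isq_def)

lemma isq [simp]: "isq 0 = 0" "isq (z + 1) = isq z + (1 - ((isq z + 1) * (isq z + 1) - (z + 1)))"
  by (simp_all add: isq_def isqrt_tm_def sem_upd_fresh)

text \<open>With \<open>r\<close> the root of \<open>z\<close>, the number \<open>z + 1\<close> is
  at most the square of \<open>r + 1\<close>, so the root never has to rise by more than the one
  unit that the recursion can add.\<close>

lemma isq_bounds: "isq z * isq z \<le> z \<and> z < (isq z + 1) * (isq z + 1)"
proof (induction z rule: int_induct)
  case decid
  show "decid (\<lambda>z. isq z * isq z \<le> z \<and> z < (isq z + 1) * (isq z + 1))"
    by (rule decidI[of _ "\<lambda>_. 0" vN "\<^bold>\<not> (Free vN \<^bold>< isqrt_tm \<cdot> Free vN \<^bold>* (isqrt_tm \<cdot> Free vN)) \<^bold>\<and>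
        Free vN \<^bold>< (isqrt_tm \<cdot> Free vN \<^bold>+ \<^bold>1) \<^bold>* (isqrt_tm \<cdot> Free vN \<^bold>+ \<^bold>1)"])
      (auto simp: not_less)
next
  case (Suc z)
  let ?r = "isq z"
  have b: "emb ?r * emb ?r \<le> emb z" "emb z + 1 \<le> (emb ?r + 1) * (emb ?r + 1)"
    using Suc emb(5)[of "?r * ?r" z] emb_discrete[of z "(?r + 1) * (?r + 1)"] by simp_all
  show ?case
  proof (cases "(?r + 1) * (?r + 1) \<le> z + 1")
    case True
    then have i: "isq (z + 1) = ?r + 1" using isq(2) one_diff diff_eq_0 by simp
    have "emb (z + 1) < emb ((?r + 1 + 1) * (?r + 1 + 1))"
      using b emb_nonneg[of ?r] by (simp add: algebra_simps)
    then show ?thesis using True unfolding i by (simp del: emb)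
  next
    case False
    then have i: "isq (z + 1) = ?r" using isq(2) one_diff diff_eq_0 by simp
    have "emb (?r * ?r) \<le> emb (z + 1)" using b by simp
    then show ?thesis using False unfolding i by (simp del: emb(1-4))
  qed
qed simp

lemma isq_unique:
  assumes "r * r \<le> z" "z < (r + 1) * (r + 1)"
  shows "isq z = r"
proof (rule ccontr)
  have *: False if "a * a \<le> z" "z < (b + 1) * (b + 1)" "b < a" for a b
  proof -
    have "b + 1 \<le> a" using that(3) less_iff_succ_less_eq by blast
    then have "(b + 1) * (b + 1) \<le> a * a" by (intro mult_mono) auto
    then show False using that by (meson leD order.strict_trans1 order.trans)
  qed
  assume "isq z \<noteq> r"
  then show False using * isq_bounds[of z] assms by (metis linorder_neqE)
qed

definition "pair a b = (a + b) * (a + b) + (a :: 'd)"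
definition "fs z = z - isq z * isq z"
definition "sn z = isq z - fs z"

lemma isq_pair: "isq (pair a b) = a + b"
proof (rule isq_unique)
  have "emb ((a + b) * (a + b)) \<le> emb (pair a b)" by (simp add: pair_def)
  then show "(a + b) * (a + b) \<le> pair a b" by (simp del: emb(1-4))
  have "emb (pair a b) < emb ((a + b + 1) * (a + b + 1))"
    by (simp add: pair_def algebra_simps) (use emb_nonneg[of a] emb_nonneg[of b] in linarith)
  then show "pair a b < (a + b + 1) * (a + b + 1)" by (simp del: emb(1-4))
qed

lemma fs_pair [simp]: "fs (pair a b) = a" "sn (pair a b) = b"
proof -
  show "fs (pair a b) = a" unfolding fs_def isq_pair by (simp add: pair_def)
  then show "sn (pair a b) = b" unfolding sn_def isq_pair by simp
qed

lemma sem_pair [simp]: "ap2 (sem M e [] pair_tm) a b = pair a b"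
  by (simp add: pair_tm_def pair_def)

lemma sem_fst [simp]: "sem M e [] fst_tm \<bullet> z = fs z"
  by (simp add: fst_tm_def fs_def)

lemma sem_snd [simp]: "sem M e [] snd_tm \<bullet> z = sn z"
  by (simp add: snd_tm_def sn_def)

definition "vp q = fs (fs q)"
definition "vm q = sn (fs q)"
definition "vd q = sn q + 1"
definition "mk p m d = pair (pair p m) d"

lemma mk [simp]: "vp (mk p m d) = p" "vm (mk p m d) = m" "vd (mk p m d) = d + 1"
  by (simp_all add: vp_def vm_def vd_def mk_def)

lemma sem_q [simp]:
  "tyof [] t = Some Nt \<Longrightarrow> sem M e [] (qp t) = vp (sem M e [] t)"
  "tyof [] t = Some Nt \<Longrightarrow> sem M e [] (qm t) = vm (sem M e [] t)"
  "tyof [] t = Some Nt \<Longrightarrow> sem M e [] (qd t) = vd (sem M e [] t)"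
  by (auto simp: qp_def qm_def qd_def vp_def vm_def vd_def)

lemma sem_mkq [simp]:
  "tyof [] p = Some Nt \<Longrightarrow> tyof [] m = Some Nt \<Longrightarrow> tyof [] d = Some Nt \<Longrightarrow>
    sem M e [] (mkq p m d) = mk (sem M e [] p) (sem M e [] m) (sem M e [] d)"
  by (auto simp: mkq_def mk_def)

definition val :: "'d \<Rightarrow> 'd diff fract" where "val q = (emb (vp q) - emb (vm q)) / emb (vd q)"

lemma vd_pos [simp]: "0 < emb (vd q)" "emb (vd q) \<noteq> 0"
  using emb_nonneg[of "sn q"] by (simp_all add: vd_def add_nonneg_pos less_imp_neq[symmetric])

lemma vd_ge [simp]: "1 \<le> vd q" "vd q \<noteq> 0"
proof -
  have "emb 1 \<le> emb (vd q)" by (simp add: vd_def)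
  then show "1 \<le> vd q" by (simp only: emb(5))
  then show "vd q \<noteq> 0" by auto
qed

text \<open>The field consists of exactly the rationals of the model, so each of its elements can be
  used as a parameter inside the model.\<close>

lemma val_surj: "\<exists>c. val c = x"
proof -
  obtain a b c where "0 < c" and x: "x = (emb a - emb b) / emb (c :: 'd)" using fract_cases by blast
  then obtain d where "c = d + 1" using zero_or_Suc[of c] by auto
  then have "val (mk a b d) = x" using x by (simp add: val_def)
  then show ?thesis by blast
qed

lemma val_0 [simp]: "val 0 = 0"
  by (simp add: val_def vp_def vm_def fs_def sn_def)

lemma sat_qless [simp]:
  "tyof [] q = Some Nt \<Longrightarrow> tyof [] r = Some Nt \<Longrightarrow>
    sat M e [] (qless q r) \<longleftrightarrow> val (sem M e [] q) < val (sem M e [] r)"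
proof -
  have *: "vp a * vd b + vm b * vd a < vp b * vd a + vm a * vd b \<longleftrightarrow> val a < val b" for a b
  proof -
    have "val a < val b \<longleftrightarrow> (emb (vp a) - emb (vm a)) * emb (vd b) < (emb (vp b) - emb (vm b)) * emb (vd a)"
      by (simp add: val_def divide_less_eq less_divide_eq mult.commute)
    also have "\<dots> \<longleftrightarrow> emb (vp a * vd b + vm b * vd a) < emb (vp b * vd a + vm a * vd b)"
      by (simp add: algebra_simps)
    finally show ?thesis by (simp del: emb(1-4))
  qed
  show "tyof [] q = Some Nt \<Longrightarrow> tyof [] r = Some Nt \<Longrightarrow>
    sat M e [] (qless q r) \<longleftrightarrow> val (sem M e [] q) < val (sem M e [] r)"
    by (simp add: qless_def *)
qed

lemma sat_qleq [simp]:
  "tyof [] q = Some Nt \<Longrightarrow> tyof [] r = Some Nt \<Longrightarrow>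
    sat M e [] (qleq q r) \<longleftrightarrow> val (sem M e [] r) \<ge> val (sem M e [] q)"
  by (auto simp: qleq_def)

definition "qadd a b = ap2 (sem M (\<lambda>_. 0) [] qadd_tm) a b"
definition "qneg a = sem M (\<lambda>_. 0) [] qneg_tm \<bullet> a"
definition "qabs a = sem M (\<lambda>_. 0) [] qabs_tm \<bullet> a"
definition "pw n = sem M (\<lambda>_. 0) [] pow2_tm \<bullet> n"
definition "qpow n = sem M (\<lambda>_. 0) [] qpow_tm \<bullet> n"

lemma sem_qadd [simp]: "ap2 (sem M e [] qadd_tm) a b = qadd a b"
  using sem_closed[of qadd_tm e "[]"] by (simp add: qadd_def)

lemma sem_qneg [simp]: "sem M e [] qneg_tm \<bullet> a = qneg a"
  using sem_closed[of qneg_tm e "[]"] by (simp add: qneg_def)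

lemma sem_qabs [simp]: "sem M e [] qabs_tm \<bullet> a = qabs a"
  using sem_closed[of qabs_tm e "[]"] by (simp add: qabs_def)

lemma sem_pow2 [simp]: "sem M e [] pow2_tm \<bullet> a = pw a"
  using sem_closed[of pow2_tm e "[]"] by (simp add: pw_def)

lemma sem_qpow [simp]: "sem M e [] qpow_tm \<bullet> a = qpow a"
  using sem_closed[of qpow_tm e "[]"] by (simp add: qpow_def)

lemma val_qadd [simp]: "val (qadd a b) = val a + val b"
proof -
  \<comment> \<open>Codes hold the denominator minus one. The cut-off subtraction is exact because
    the product of the denominators is at least 1.\<close>
  have "1 \<le> vd a * vd b" using mult_mono[of 1 "vd a" 1 "vd b"] by simp
  then have "vd a * vd b - 1 + 1 = vd a * vd b" by simp
  then have "val (qadd a b) = (emb (vp a) * emb (vd b) + emb (vp b) * emb (vd a)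
      - (emb (vm a) * emb (vd b) + emb (vm b) * emb (vd a))) / (emb (vd a) * emb (vd b))"
    by (simp add: qadd_def qadd_tm_def val_def del: le_add_diff_inverse2)
  then show ?thesis by (simp add: val_def field_simps)
qed

lemma val_qneg [simp]: "val (qneg a) = - val a"
  by (simp add: qneg_def qneg_tm_def val_def vd_def[symmetric] minus_divide_left)

lemma val_qabs [simp]: "val (qabs a) = \<bar>val a\<bar>"
proof -
  have "emb (vp a - vm a) + emb (vm a - vp a) = \<bar>emb (vp a) - emb (vm a)\<bar>"
    by (cases "vp a \<le> vm a") (auto simp: emb_diff not_le less_imp_le abs_if dest: order.asym)
  then show ?thesis
    by (simp add: qabs_def qabs_tm_def val_def vd_def[symmetric])
qed

lemma pw [simp]: "pw 0 = 1" "pw (n + 1) = pw n + pw n"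
  by (simp_all add: pw_def pow2_tm_def sem_upd_fresh)

lemma pw_gt: "n < pw n"
proof (induction n rule: int_induct)
  case decid
  show "decid (\<lambda>n. n < pw n)"
    by (rule decidI[of _ "\<lambda>_. 0" vN "Free vN \<^bold>< pow2_tm \<cdot> Free vN"]) auto
next
  case (Suc n)
  then have "emb n + 1 \<le> emb (pw n)" using emb_discrete by simp
  moreover have "0 \<le> emb n" by simp
  ultimately have "emb n + 1 < emb (pw n) + emb (pw n)" by linarith
  then have "emb (n + 1) < emb (pw (n + 1))" by simp
  then show ?case by (simp del: emb(1-4))
qed simp

definition eps :: "'d \<Rightarrow> 'd diff fract" where "eps n = 1 / emb (pw n)"

lemma val_qpow [simp]: "val (qpow n) = eps n"
proof -
  have "1 \<le> pw n" using pw_gt[of n] less_iff_succ_less_eq[of 0 "pw n"] by (metis add_0 nonneg order.strict_trans1)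
  then show ?thesis by (simp add: qpow_def qpow_tm_def val_def eps_def)
qed

lemma pw_pos: "0 < emb (pw n)"
  using pw_gt[of n] by (metis emb_pos not_neg(1))

lemma eps [simp]: "0 < eps n" "eps 0 = 1" "eps (n + 1) = eps n / 2"
  using pw_pos by (simp_all add: eps_def)

text \<open>Archimedean with respect to the numbers of the model. The numerator of a positive
  fraction is at least 1 by discreteness, and the power \<open>pw c\<close> exceeds the denominator
  \<open>c\<close>.\<close>

lemma eps_archimedean: "0 < x \<Longrightarrow> \<exists>n. eps n < x"
proof -
  assume x: "0 < x"
  obtain a b c where c: "0 < c" and x': "x = (emb a - emb b) / emb (c :: 'd)" using fract_cases by blast
  have c': "0 < emb c" using c emb_pos by simp
  then have "emb b < emb a" using x x' by (simp add: zero_less_divide_iff)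
  then have "1 \<le> emb a - emb b" using emb_discrete[of b a] by simp
  then have "1 / emb c \<le> x" unfolding x' using c' by (simp add: divide_right_mono)
  moreover have "eps c < 1 / emb c" unfolding eps_def using c' pw_gt[of c] pw_pos[of c]
    by (intro divide_strict_left_mono) auto
  ultimately show ?thesis by (metis order.strict_trans2)
qed

end

section \<open>Real numbers and sums in models\<close>

context nmodel
begin

abbreviation app_seq :: "'d \<Rightarrow> 'd \<Rightarrow> 'd"  (infixl "\<star>" 90) where
  "w \<star> i \<equiv> ap M (Nt \<rightarrow> Nt \<rightarrow> Nt) w i"
abbreviation app_op :: "'d \<Rightarrow> 'd \<Rightarrow> 'd"  (infixl "\<odot>" 90) where
  "a \<odot> x \<equiv> ap M ((Nt \<rightarrow> Nt) \<rightarrow> Nt \<rightarrow> Nt) a x"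

definition v :: "'d \<Rightarrow> 'd \<Rightarrow> 'd diff fract" where "v x n = val (x \<bullet> n)"

definition "is_real x \<longleftrightarrow> (\<forall>n i. \<bar>v x n - v x (n + i)\<bar> < eps n)"
definition "eqr x y \<longleftrightarrow> (\<forall>n. \<bar>v x n - v y n\<bar> \<le> eps n + eps n)"
definition "leqr x y \<longleftrightarrow> (\<forall>n. v x n \<le> v y n + (eps n + eps n))"

lemma sat_isreal [simp]:
  "tyof [] t = Some T1 \<Longrightarrow> (''re_n'', Nt) \<notin> fvt t \<Longrightarrow> (''re_i'', Nt) \<notin> fvt t \<Longrightarrow>
    sat M e [] (isreal t) \<longleftrightarrow> is_real (sem M e [] t)"
  by (auto simp: isreal_def is_real_def v_def tyof_lct0 sem_upd_fresh)

lemma sat_eqR [simp]: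
  "tyof [] s = Some T1 \<Longrightarrow> tyof [] t = Some T1 \<Longrightarrow> (''eq_n'', Nt) \<notin> fvt s \<union> fvt t \<Longrightarrow>
    sat M e [] (eqR s t) \<longleftrightarrow> eqr (sem M e [] s) (sem M e [] t)"
  by (auto simp: eqR_def eqr_def v_def tyof_lct0 sem_upd_fresh)

lemma sat_leqR [simp]:
  "tyof [] s = Some T1 \<Longrightarrow> tyof [] t = Some T1 \<Longrightarrow> (''le_n'', Nt) \<notin> fvt s \<union> fvt t \<Longrightarrow>
    sat M e [] (leqR s t) \<longleftrightarrow> leqr (sem M e [] s) (sem M e [] t)"
  by (auto simp: leqR_def leqr_def v_def tyof_lct0 sem_upd_fresh)

lemma sat_lessR [simp]:
  "tyof [] s = Some T1 \<Longrightarrow> tyof [] t = Some T1 \<Longrightarrow> (''le_n'', Nt) \<notin> fvt s \<union> fvt t \<Longrightarrow>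
    sat M e [] (lessR s t) \<longleftrightarrow> \<not> leqr (sem M e [] t) (sem M e [] s)"
  by (auto simp: lessR_def)

definition "rat q = ap M (Nt \<rightarrow> T1) (sem M (\<lambda>_. 0) [] ratR_tm) q"
definition "difr x y = ap M (T1 \<rightarrow> T1) (ap M (T1 \<rightarrow> T1 \<rightarrow> T1) (sem M (\<lambda>_. 0) [] diffR_tm) x) y"
definition "absr x = ap M (T1 \<rightarrow> T1) (sem M (\<lambda>_. 0) [] absR_tm) x"
definition "sumr a w m = ap M (Nt \<rightarrow> T1) (ap M ((Nt \<rightarrow> T1) \<rightarrow> Nt \<rightarrow> T1)
  (ap M ((T1 \<rightarrow> T1) \<rightarrow> (Nt \<rightarrow> T1) \<rightarrow> Nt \<rightarrow> T1) (sem M (\<lambda>_. 0) [] sum_tm) a) w) m"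

lemma sem_ratR [simp]: "ap M (Nt \<rightarrow> T1) (sem M e [] ratR_tm) q = rat q"
  using sem_closed[of ratR_tm e "[]"] by (simp add: rat_def)

lemma sem_diffR [simp]: "ap M (T1 \<rightarrow> T1) (ap M (T1 \<rightarrow> T1 \<rightarrow> T1) (sem M e [] diffR_tm) x) y = difr x y"
  using sem_closed[of diffR_tm e "[]"] by (simp add: difr_def)

lemma sem_absR [simp]: "ap M (T1 \<rightarrow> T1) (sem M e [] absR_tm) q = absr q"
  using sem_closed[of absR_tm e "[]"] by (simp add: absr_def)

lemma sem_sum_tm [simp]: "ap M (Nt \<rightarrow> T1) (ap M ((Nt \<rightarrow> T1) \<rightarrow> Nt \<rightarrow> T1)
    (ap M ((T1 \<rightarrow> T1) \<rightarrow> (Nt \<rightarrow> T1) \<rightarrow> Nt \<rightarrow> T1) (sem M e [] sum_tm) a) w) m = sumr a w m"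
  using sem_closed[of sum_tm e "[]"] by (simp add: sumr_def)

lemma v_rat [simp]: "v (rat q) n = val q"
  by (simp add: v_def rat_def ratR_tm_def)

lemma v_difr [simp]: "v (difr x y) n = v x (n + 1) - v y (n + 1)"
  by (simp add: v_def difr_def diffR_tm_def)

lemma v_absr [simp]: "v (absr x) n = \<bar>v x n\<bar>"
  by (simp add: v_def absr_def absR_tm_def)

definition "in1 x \<longleftrightarrow> is_real x \<and> leqr (rat 0) x \<and> leqr x (rat (mk 1 0 0))"

lemma sat_in01 [simp]:
  "tyof [] t = Some T1 \<Longrightarrow> fvt t \<inter> {(''re_n'', Nt), (''re_i'', Nt), (''le_n'', Nt)} = {} \<Longrightarrow>
    sat M e [] (in01 t) \<longleftrightarrow> in1 (sem M e [] t)"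
  by (auto simp: in01_def in1_def)

definition "fin w m \<longleftrightarrow> (\<forall>i<m. in1 (w \<star> i) \<and> (\<forall>j<i. \<not> eqr (w \<star> j) (w \<star> i)))"

lemma sat_finseq [simp]:
  "tyof [] s = Some (Nt \<rightarrow> T1) \<Longrightarrow> tyof [] t = Some Nt \<Longrightarrow>
    (fvt s \<union> fvt t) \<inter> {(''re_n'', Nt), (''re_i'', Nt), (''le_n'', Nt), (''eq_n'', Nt), (''fi_i'', Nt), (''fi_j'', Nt)} = {} \<Longrightarrow>
    sat M e [] (finseq s t) \<longleftrightarrow> fin (sem M e [] s) (sem M e [] t)"
  by (auto simp: finseq_def fin_def tyof_lct0 sem_upd_fresh)

definition "cont u l w m \<longleftrightarrow> (\<forall>i<l. \<exists>j<m. eqr (u \<star> i) (w \<star> j))"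

lemma sat_contained [simp]:
  "tyof [] s = Some (Nt \<rightarrow> T1) \<Longrightarrow> tyof [] t = Some Nt \<Longrightarrow> tyof [] s' = Some (Nt \<rightarrow> T1) \<Longrightarrow> tyof [] t' = Some Nt \<Longrightarrow>
    (fvt s \<union> fvt t \<union> fvt s' \<union> fvt t') \<inter> {(''eq_n'', Nt), (''su_i'', Nt), (''su_j'', Nt)} = {} \<Longrightarrow>
    sat M e [] (contained s t s' t') \<longleftrightarrow> cont (sem M e [] s) (sem M e [] t) (sem M e [] s') (sem M e [] t')"
  by (auto simp: contained_def cont_def tyof_lct0 sem_upd_fresh)

text \<open>Kept apart from \<open>wit\<close>, which quantifies over finite sequences: closeness is
  arithmetical, so comprehension and search apply to it.\<close>

definition "close_to a b k w m \<longleftrightarrow> \<not> leqr (rat (qpow k)) (absr (difr b (sumr a w m)))"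

definition "wit a b k u l \<longleftrightarrow> fin u l \<and> (\<forall>w m. fin w m \<and> cont u l w m \<longrightarrow> close_to a b k w m)"

lemma sat_witness [simp]:
  "tyof [] a = Some (T1 \<rightarrow> T1) \<Longrightarrow> tyof [] b = Some T1 \<Longrightarrow> tyof [] k = Some Nt \<Longrightarrow>
    tyof [] u = Some (Nt \<rightarrow> T1) \<Longrightarrow> tyof [] l = Some Nt \<Longrightarrow>
    (fvt a \<union> fvt b \<union> fvt k \<union> fvt u \<union> fvt l) \<inter> {(''re_n'', Nt), (''re_i'', Nt), (''le_n'', Nt), (''eq_n'', Nt),
      (''fi_i'', Nt), (''fi_j'', Nt), (''su_i'', Nt), (''su_j'', Nt), (''wi_w'', Nt \<rightarrow> T1), (''wi_m'', Nt)} = {} \<Longrightarrow>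
    sat M e [] (witness a b k u l) \<longleftrightarrow> wit (sem M e [] a) (sem M e [] b) (sem M e [] k) (sem M e [] u) (sem M e [] l)"
  by (auto simp: witness_def wit_def close_to_def tyof_lct0 sem_upd_fresh)

definition "fam a \<longleftrightarrow> (\<forall>x. in1 x \<longrightarrow> is_real (a \<odot> x)) \<and> (\<forall>x y. in1 x \<and> in1 y \<and> eqr x y \<longrightarrow> eqr (a \<odot> x) (a \<odot> y))"
definition "posi a \<longleftrightarrow> (\<forall>x. in1 x \<longrightarrow> leqr (rat 0) (a \<odot> x))"
definition "conv a b \<longleftrightarrow> is_real b \<and> (\<forall>k. \<exists>u l. wit a b k u l)"

lemma sat_family [simp]:
  "sat M e [] (family (Free (''a'', T1 \<rightarrow> T1))) \<longleftrightarrow> fam (e (''a'', T1 \<rightarrow> T1))"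
  "sat M e [] (positive (Free (''a'', T1 \<rightarrow> T1))) \<longleftrightarrow> posi (e (''a'', T1 \<rightarrow> T1))"
  by (auto simp: family_def fam_def Defs.positive_def posi_def tyof_lct0)

lemma sat_converges [simp]:
  "sat M e [] (converges_to (Free (''a'', T1 \<rightarrow> T1)) (Free (''b'', T1))) \<longleftrightarrow> conv (e (''a'', T1 \<rightarrow> T1)) (e (''b'', T1))"
  by (auto simp: converges_to_def conv_def)

text \<open>Internal sequences of field elements, those with a sequence of codes in the model. For
  them sums exist by recursion and comparisons are decidable.\<close>

definition ink :: "('d \<Rightarrow> 'd diff fract) \<Rightarrow> bool" where
  "ink h \<longleftrightarrow> (\<exists>F. \<forall>n. val (F \<bullet> n) = h n)"

abbreviation "vF \<equiv> (''F'', T1)"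
abbreviation "vG \<equiv> (''G'', T1)"

lemma inkI:
  assumes "\<And>n. val (sem M (e(vN := n)) [] t) = h n" "tyof [] t = Some Nt"
  shows "ink h"
  unfolding ink_def
  by (intro exI[of _ "sem M e [] (fn ''n'' Nt (\<lambda>_. t))"]) (use assms in simp)

lemma ink_const: "ink (\<lambda>_. x)"
proof -
  obtain c where "val c = x" using val_surj by blast
  then show ?thesis by (intro inkI[of "(\<lambda>_. 0)(vA := c)" "Free vA"]) simp_all
qed

lemma ink_v: "ink (\<lambda>n. v x n)"
  unfolding ink_def v_def by blast

lemma ink_eps: "ink eps"
  by (rule inkI[of "\<lambda>_. 0" "qpow_tm \<cdot> Free vN"]) simp_all

lemma ink_add: "ink h \<Longrightarrow> ink k \<Longrightarrow> ink (\<lambda>n. h n + k n)"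
proof -
  assume "ink h" "ink k"
  then obtain F G where "\<And>n. val (F \<bullet> n) = h n" "\<And>n. val (G \<bullet> n) = k n" by (auto simp: ink_def)
  then show ?thesis
    by (intro inkI[of "(\<lambda>_. 0)(vF := F, vG := G)" "qadd_tm \<cdot> (Free vF \<cdot> Free vN) \<cdot> (Free vG \<cdot> Free vN)"]) simp_all
qed

lemma ink_neg: "ink h \<Longrightarrow> ink (\<lambda>n. - h n)"
proof -
  assume "ink h"
  then obtain F where "\<And>n. val (F \<bullet> n) = h n" by (auto simp: ink_def)
  then show ?thesis
    by (intro inkI[of "(\<lambda>_. 0)(vF := F)" "qneg_tm \<cdot> (Free vF \<cdot> Free vN)"]) simp_all
qed

lemma ink_diff: "ink h \<Longrightarrow> ink k \<Longrightarrow> ink (\<lambda>n. h n - k n)"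
  using ink_add[OF _ ink_neg, of h k] by simp

lemma ink_emb: "ink (\<lambda>n. emb n * x)"
proof -
  obtain c where c: "val c = x" using val_surj by blast
  have "val (mk (n * vp c) (n * vm c) (vd c - 1)) = emb n * x" for n
    by (simp add: val_def c[symmetric] algebra_simps)
  then show ?thesis
    by (intro inkI[of "(\<lambda>_. 0)(vA := c)" "mkq (Free vN \<^bold>* qp (Free vA)) (Free vN \<^bold>* qm (Free vA)) (qd (Free vA) \<^bold>- \<^bold>1)"])
      simp_all
qed

lemma ink_shift: "ink h \<Longrightarrow> ink (\<lambda>n. h (c + n))"
proof -
  assume "ink h"
  then obtain F where "\<And>n. val (F \<bullet> n) = h n" by (auto simp: ink_def)
  then show ?thesis
    by (intro inkI[of "(\<lambda>_. 0)(vF := F, vA := c)" "Free vF \<cdot> (Free vA \<^bold>+ Free vN)"]) simp_all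
qed

lemma ink_seq: "ink (\<lambda>i. v (a \<odot> (w \<star> i)) p)"
  unfolding v_def
  by (rule inkI[of "(\<lambda>_. 0)((''a'', T1 \<rightarrow> T1) := a, (''w'', Nt \<rightarrow> T1) := w, vB := p)"
      "Free (''a'', T1 \<rightarrow> T1) \<cdot> (Free (''w'', Nt \<rightarrow> T1) \<cdot> Free vN) \<cdot> Free vB"]) simp_all

lemma decid_less: "ink h \<Longrightarrow> ink k \<Longrightarrow> decid (\<lambda>n. h n < k n)"
proof -
  assume "ink h" "ink k"
  then obtain F G where "\<And>n. val (F \<bullet> n) = h n" "\<And>n. val (G \<bullet> n) = k n" by (auto simp: ink_def)
  then show ?thesis
    by (intro decidI[of _ "(\<lambda>_. 0)(vF := F, vG := G)" vN "qless (Free vF \<cdot> Free vN) (Free vG \<cdot> Free vN)"]) simp_all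
qed

lemma decid_not: "decid P \<Longrightarrow> decid (\<lambda>n. \<not> P n)"
proof -
  assume "decid P"
  then obtain F where "\<And>n. F \<bullet> n = 0 \<longleftrightarrow> P n" by (auto simp: decid_def)
  then show ?thesis
    by (intro decidI[of _ "(\<lambda>_. 0)(vF := F)" vN "\<^bold>\<not> (Free vF \<cdot> Free vN \<^bold>= \<^bold>0)"]) simp_all
qed

lemma decid_conj: "decid P \<Longrightarrow> decid Q \<Longrightarrow> decid (\<lambda>n. P n \<and> Q n)"
proof -
  assume "decid P" "decid Q"
  then obtain F G where "\<And>n. F \<bullet> n = 0 \<longleftrightarrow> P n" "\<And>n. G \<bullet> n = 0 \<longleftrightarrow> Q n" by (auto simp: decid_def)
  then show ?thesis
    by (intro decidI[of _ "(\<lambda>_. 0)(vF := F, vG := G)" vN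
        "Free vF \<cdot> Free vN \<^bold>= \<^bold>0 \<^bold>\<and> Free vG \<cdot> Free vN \<^bold>= \<^bold>0"]) simp_all
qed

lemma decid_imp: "decid P \<Longrightarrow> decid Q \<Longrightarrow> decid (\<lambda>n. P n \<longrightarrow> Q n)"
  using decid_not[OF decid_conj[OF _ decid_not], of P Q] by simp

lemma decid_le: "ink h \<Longrightarrow> ink k \<Longrightarrow> decid (\<lambda>n. h n \<le> k n)"
  using decid_not[OF decid_less, of k h] by (simp add: not_less)

lemma decid_eq: "ink h \<Longrightarrow> ink k \<Longrightarrow> decid (\<lambda>n. h n = k n)"
  using decid_conj[OF decid_le decid_le, of h k k h] by (simp add: order.eq_iff)

lemma decid_less_nat: "decid (\<lambda>n. n < c)" "decid (\<lambda>n. c < n)"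
  by (rule decidI[of _ "(\<lambda>_. 0)(vA := c)" vN "Free vN \<^bold>< Free vA"], simp_all)
    (rule decidI[of _ "(\<lambda>_. 0)(vA := c)" vN "Free vA \<^bold>< Free vN"], simp_all)

lemma decid_le_nat: "decid (\<lambda>n. n \<le> c)" "decid (\<lambda>n. c \<le> n)"
  using decid_not[OF decid_less_nat(2)[of c]] decid_not[OF decid_less_nat(1)[of c]] by (simp_all add: not_less)

lemmas decid_intros = decid_le decid_less decid_eq decid_imp decid_conj decid_not decid_less_nat decid_le_nat
  ink_add ink_diff ink_neg ink_const ink_v ink_eps ink_emb ink_seq

text \<open>The number of summands may be nonstandard, so no HOL sum is meant. The recursion
  determines the result among internal sequences, by induction in the model.\<close>

definition Sumk :: "('d \<Rightarrow> 'd diff fract) \<Rightarrow> 'd \<Rightarrow> 'd diff fract" where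
  "Sumk h = (SOME s. ink s \<and> s 0 = 0 \<and> (\<forall>n. s (n + 1) = s n + h n))"

lemma Sumk:
  assumes "ink h"
  shows ink_Sumk: "ink (Sumk h)" and Sumk_0: "Sumk h 0 = 0" and Sumk_Suc: "Sumk h (n + 1) = Sumk h n + h n"
proof -
  obtain F where F: "\<And>n. val (F \<bullet> n) = h n" using assms by (auto simp: ink_def)
  let ?s = "\<lambda>n. val (sem M ((\<lambda>_. 0)(vF := F, vN := n)) []
    (Cst Rec \<cdot> fn ''i'' Nt (\<lambda>i. fn ''r'' Nt (\<lambda>r. qadd_tm \<cdot> r \<cdot> (Free vF \<cdot> i))) \<cdot> \<^bold>0 \<cdot> Free vN))"
  have "ink ?s" by (rule inkI[OF refl]) simp
  moreover have "?s 0 = 0" by simp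
  moreover have "?s (n + 1) = ?s n + h n" for n
    by (simp add: sem_upd_fresh F del: fun_upd_apply) (simp add: F)
  ultimately have "\<exists>s. ink s \<and> s 0 = 0 \<and> (\<forall>n. s (n + 1) = s n + h n)" by blast
  from someI_ex[OF this] show "ink (Sumk h)" "Sumk h 0 = 0" "Sumk h (n + 1) = Sumk h n + h n"
    unfolding Sumk_def[symmetric] by blast+
qed

lemma Sumk_unique:
  assumes "ink h" "ink s" "s 0 = 0" "\<And>n. s (n + 1) = s n + h n"
  shows "s n = Sumk h n"
proof (induction n rule: int_induct)
  case decid
  show ?case using assms ink_Sumk by (intro decid_intros)
qed (use assms Sumk in auto)

lemma v_sumr: "v (sumr a w m) n = Sumk (\<lambda>i. v (a \<odot> (w \<star> i)) (n + m)) m"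
proof -
  let ?e = "(\<lambda>_. 0)((''a'', T1 \<rightarrow> T1) := a, (''w'', Nt \<rightarrow> T1) := w, (''m'', Nt) := m, (''n'', Nt) := n)"
  let ?f = "sem M ?e [] (fn ''i'' Nt (\<lambda>i. fn ''r'' Nt (\<lambda>r. qadd_tm \<cdot> r \<cdot>
    (Free (''a'', T1 \<rightarrow> T1) \<cdot> (Free (''w'', Nt \<rightarrow> T1) \<cdot> i) \<cdot> (Free (''n'', Nt) \<^bold>+ Free (''m'', Nt))))))"
  have f: "ap2 ?f i r = qadd r (a \<odot> (w \<star> i) \<bullet> (n + m))" for i r by simp
  have "v (sumr a w m) n = val (rec ?f 0 m)"
    by (simp add: v_def sumr_def sum_tm_def)
  also have "\<dots> = Sumk (\<lambda>i. v (a \<odot> (w \<star> i)) (n + m)) m"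
  proof (rule Sumk_unique[of _ "\<lambda>j. val (rec ?f 0 j)" m])
    show "ink (\<lambda>i. v (a \<odot> (w \<star> i)) (n + m))" by (rule ink_seq)
    show "ink (\<lambda>j. val (rec ?f 0 j))"
      by (rule inkI[of "(\<lambda>_. 0)((''f'', Nt \<rightarrow> Nt \<rightarrow> Nt) := ?f)" "Cst Rec \<cdot> Free (''f'', Nt \<rightarrow> Nt \<rightarrow> Nt) \<cdot> \<^bold>0 \<cdot> Free vN"]) simp_all
  qed (simp_all add: f v_def del: sem_fn)
  finally show ?thesis .
qed

text \<open>The summands are compared below \<open>m\<close> only, so the induction carries the
  guard \<open>n \<le> m\<close>. The constant \<open>c\<close> is there to collect approximation
  errors.\<close>

lemma Sumk_le:
  assumes ink: "ink h" "ink k" and le: "\<And>i. i < m \<Longrightarrow> h i \<le> k i + c"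
  shows "Sumk h m \<le> Sumk k m + emb m * c"
proof -
  have "n \<le> m \<longrightarrow> Sumk h n \<le> Sumk k n + emb n * c" for n
  proof (induction n rule: int_induct)
    case decid
    show ?case using ink ink_Sumk by (intro decid_intros)
  next
    case 0
    show ?case using ink by (simp add: Sumk_0)
  next
    case (Suc n)
    show ?case
    proof
      assume "n + 1 \<le> m"
      then have "n < m" using less_iff_succ_less_eq by blast
      then show "Sumk h (n + 1) \<le> Sumk k (n + 1) + emb (n + 1) * c"
        using Suc le[of n] by (simp add: Sumk_Suc[OF ink(1)] Sumk_Suc[OF ink(2)] distrib_right less_imp_le)
    qed
  qed
  then show ?thesis by blast
qed

lemma Sumk_mono: "ink h \<Longrightarrow> ink k \<Longrightarrow> (\<And>i. i < m \<Longrightarrow> h i \<le> k i) \<Longrightarrow> Sumk h m \<le> Sumk k m"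
  using Sumk_le[of h k m 0] by simp

lemma Sumk_cong: "ink h \<Longrightarrow> ink k \<Longrightarrow> (\<And>i. i < m \<Longrightarrow> h i = k i) \<Longrightarrow> Sumk h m = Sumk k m"
  by (rule order.antisym; rule Sumk_mono; simp)

lemma Sumk_append:
  assumes ink: "ink h" "ink f" "ink g" and 1: "\<And>i. i < l \<Longrightarrow> h i = f i" and 2: "\<And>j. j < m \<Longrightarrow> h (l + j) = g j"
  shows "Sumk h (l + m) = Sumk f l + Sumk g m"
proof -
  have "n \<le> m \<longrightarrow> Sumk h (l + n) = Sumk f l + Sumk g n" for n
  proof (induction n rule: int_induct)
    case decid
    show ?case using ink ink_Sumk by (intro decid_intros ink_shift)
  next
    case 0
    show ?case using ink 1 by (simp add: Sumk_0 Sumk_cong[of h f])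
  next
    case (Suc n)
    show ?case
    proof
      assume "n + 1 \<le> m"
      then have "n < m" using less_iff_succ_less_eq by blast
      then show "Sumk h (l + (n + 1)) = Sumk f l + Sumk g (n + 1)"
        using Suc 2[of n] ink Sumk_Suc[of h "l + n"] by (simp add: Sumk_Suc add.assoc)
    qed
  qed
  then show ?thesis by blast
qed

section \<open>Limits\<close>

lemma eps_antimono: "m \<le> n \<Longrightarrow> eps n \<le> eps m"
proof -
  have "eps (m + k) \<le> eps m" for k
  proof (induction k rule: int_induct)
    case decid
    show ?case by (intro decid_intros ink_shift)
  next
    case (Suc k)
    have "eps (m + (k + 1)) = eps (m + k) / 2" using eps(3)[of "m + k"] by (simp add: add.assoc)
    then show ?case using Suc eps(1)[of "m + k"] by linarith
  qed simp
  moreover assume "m \<le> n"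
  then obtain k where "n = m + k" using le_add_diff_inverse2[of m n] by (metis add.commute)
  ultimately show ?thesis by blast
qed

lemma eventually_eps: "0 < d \<Longrightarrow> \<forall>\<^sub>F n in at_top. eps n < d"
  using eps_archimedean[of d] eps_antimono
  by (auto simp: eventually_at_top_linorder intro: order.strict_trans1)

lemma is_realD:
  assumes "is_real x" "m \<le> n"
  shows "\<bar>v x m - v x n\<bar> < eps m"
proof -
  obtain k where "n = m + k" using le_add_diff_inverse2[OF assms(2)] by (metis add.commute)
  then show ?thesis using assms by (simp add: is_real_def)
qed

text \<open>Replaces the errors fixed by the representation by an arbitrary slack \<open>d\<close>
  at large indices. Inequalities between reals can then be combined by linear arithmetic at a common
  index.\<close>

lemma leqr_iff:
  assumes "is_real x" "is_real y"
  shows "leqr x y \<longleftrightarrow> (\<forall>d>0. \<forall>\<^sub>F n in at_top. v x n \<le> v y n + d)"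
proof (intro iffI allI impI)
  fix d :: "'d diff fract"
  assume "leqr x y" "0 < d"
  then have "\<forall>\<^sub>F n in at_top. eps n < d / 2" by (intro eventually_eps) simp
  then show "\<forall>\<^sub>F n in at_top. v x n \<le> v y n + d"
  proof eventually_elim
    case (elim n)
    have "v x n \<le> v y n + (eps n + eps n)" using \<open>leqr x y\<close> by (simp add: leqr_def)
    then show ?case using elim by simp
  qed
next
  assume *: "\<forall>d>0. \<forall>\<^sub>F n in at_top. v x n \<le> v y n + d"
  show "leqr x y" unfolding leqr_def
  proof
    fix n
    show "v x n \<le> v y n + (eps n + eps n)"
    proof (rule field_le_epsilon)
      fix d :: "'d diff fract"
      assume "0 < d"
      then have "\<forall>\<^sub>F p in at_top. v x p \<le> v y p + d \<and> n \<le> p"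
        using * by (simp add: eventually_conj eventually_ge_at_top)
      then obtain p where "v x p \<le> v y p + d" "n \<le> p"
        using eventually_happens by fastforce
      then show "v x n \<le> v y n + (eps n + eps n) + d"
        using is_realD[OF assms(1), of n p] is_realD[OF assms(2), of n p] by linarith
    qed
  qed
qed

text \<open>A violation at one index exceeds the total drift of both sequences after it, so a fixed
  gap remains.\<close>

lemma not_leqr:
  assumes "is_real x" "is_real y" "\<not> leqr x y"
  shows "\<exists>d>0. \<forall>\<^sub>F n in at_top. v y n + d \<le> v x n"
proof -
  obtain n where n: "v y n + (eps n + eps n) < v x n" using assms by (auto simp: leqr_def not_le)
  have "\<forall>\<^sub>F p in at_top. v y p + (v x n - v y n - (eps n + eps n)) \<le> v x p"
    using eventually_ge_at_top[of n]
  proof eventually_elim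
    case (elim p)
    then show ?case using is_realD[OF assms(1), of n p] is_realD[OF assms(2), of n p] by linarith
  qed
  then show ?thesis using n by (intro exI[of _ "v x n - v y n - (eps n + eps n)"]) auto
qed

lemma eqr_leqr: "eqr x y \<longleftrightarrow> leqr x y \<and> leqr y x"
  by (auto simp: eqr_def leqr_def abs_le_iff algebra_simps)

lemma eqr_refl [simp]: "eqr x x"
  using eps(1) by (simp add: eqr_def less_imp_le add_nonneg_nonneg)

lemma eqr_sym: "eqr x y \<Longrightarrow> eqr y x"
  by (simp add: eqr_leqr)

lemma leqr_trans:
  assumes "is_real x" "is_real y" "is_real z" "leqr x y" "leqr y z"
  shows "leqr x z"
  unfolding leqr_iff[OF assms(1,3)]
proof (intro allI impI)
  fix d :: "'d diff fract"
  assume "0 < d"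
  then have "\<forall>\<^sub>F n in at_top. v x n \<le> v y n + d / 2" "\<forall>\<^sub>F n in at_top. v y n \<le> v z n + d / 2"
    using assms leqr_iff by simp_all
  then show "\<forall>\<^sub>F n in at_top. v x n \<le> v z n + d" by eventually_elim simp
qed

lemma eqr_trans: "is_real x \<Longrightarrow> is_real y \<Longrightarrow> is_real z \<Longrightarrow> eqr x y \<Longrightarrow> eqr y z \<Longrightarrow> eqr x z"
  using leqr_trans eqr_leqr by blast

lemma is_real_rat [simp]: "is_real (rat q)"
  by (simp add: is_real_def)

lemma in1_cong:
  assumes "in1 x" "is_real y" "eqr x y"
  shows "in1 y"
  using assms leqr_trans[of "rat 0" x y] leqr_trans[of y x "rat (mk 1 0 0)"] by (auto simp: in1_def eqr_leqr)

text \<open>The error of \<open>m\<close> summands read at index \<open>n + m\<close>; it rests on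
  \<open>m\<close> being below its power \<open>pw m\<close>.\<close>

lemma eps_add: "emb m * eps (n + m) \<le> eps n"
proof -
  have e: "eps (n + m) = eps n * eps m"
  proof (induction m rule: int_induct)
    case decid
    \<comment> \<open>Decidability of the induction statement needs an explicit code for the product
      as a function of \<open>m\<close>. Its denominator is \<open>pw n * pw m\<close>, stored minus
      one.\<close>
    have "1 \<le> pw j" for j using pw_gt[of j] less_iff_succ_less_eq[of 0 "pw j"] by (metis add_0 nonneg order.strict_trans1)
    then have "1 \<le> pw n * pw j" for j using mult_mono[of 1 "pw n" 1 "pw j"] by simp
    then have "emb (pw n * pw j - 1) + 1 = emb (pw n) * emb (pw j)" for j using emb_diff[of 1 "pw n * pw j"] by simp
    then have "ink (\<lambda>m. eps n * eps m)"
      unfolding eps_def ink_def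
      by (intro exI[of _ "sem M ((\<lambda>_. 0)(vA := n)) [] (fn ''n'' Nt (\<lambda>m. mkq \<^bold>1 \<^bold>0 (pow2_tm \<cdot> Free vA \<^bold>* (pow2_tm \<cdot> m) \<^bold>- \<^bold>1)))"])
        (simp add: val_def)
    then show ?case by (intro decid_intros ink_shift)
  next
    case (Suc m)
    have "eps (n + (m + 1)) = eps (n + m) / 2" using eps(3)[of "n + m"] by (simp add: add.assoc)
    then show ?case using Suc by simp
  qed simp
  have "emb m < emb (pw m)" using pw_gt by simp
  then have "emb m * eps m \<le> 1" using pw_pos[of m] by (simp add: eps_def)
  then have "eps n * (emb m * eps m) \<le> eps n * 1" by (intro mult_left_mono) (auto simp: less_imp_le)
  then show ?thesis by (simp add: e mult_ac)
qed

text \<open>All summands are read at one index \<open>p\<close>, while \<open>sum_tm\<close> ties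
  the index to the length. At a fixed \<open>p\<close> the sums are additive under
  \<open>append\<close>.\<close>

abbreviation "psum a w m p \<equiv> Sumk (\<lambda>i. v (a \<odot> (w \<star> i)) p) m"

lemma psum_cauchy:
  assumes "\<And>i. i < m \<Longrightarrow> is_real (a \<odot> (w \<star> i))" "n + m \<le> p"
  shows "\<bar>psum a w m (n + m) - psum a w m p\<bar> \<le> eps n"
proof -
  have *: "\<bar>v (a \<odot> (w \<star> i)) (n + m) - v (a \<odot> (w \<star> i)) p\<bar> < eps (n + m)" if "i < m" for i
    using assms that is_realD by blast
  have "psum a w m (n + m) \<le> psum a w m p + emb m * eps (n + m)"
    "psum a w m p \<le> psum a w m (n + m) + emb m * eps (n + m)"
    using * by (intro Sumk_le ink_seq; fastforce simp: abs_less_iff)+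
  then show ?thesis using eps_add[of m n] by linarith
qed

text \<open>A strict inequality between reals leaves a positive gap \<open>d\<close>, and beyond
  some index it does not matter where the approximations are read.\<close>

lemma close_to_iff:
  assumes b: "is_real b" and r: "\<And>i. i < m \<Longrightarrow> is_real (a \<odot> (w \<star> i))"
  shows "close_to a b k w m \<longleftrightarrow> (\<exists>d>0. \<forall>\<^sub>F p in at_top. \<bar>v b p - psum a w m p\<bar> + d \<le> eps k)"
proof
  assume "close_to a b k w m"
  then obtain n where n: "\<bar>v b (n + 1) - psum a w m (n + 1 + m)\<bar> + (eps n + eps n) < eps k"
    by (auto simp: close_to_def leqr_def v_sumr not_le)
  \<comment> \<open>Moving \<open>b\<close> and the sum to index \<open>p\<close> costs
    \<open>eps n / 2\<close> each, which leaves \<open>eps n\<close> of the slack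
    \<open>2 * eps n\<close> as the gap.\<close>
  have "\<forall>\<^sub>F p in at_top. \<bar>v b p - psum a w m p\<bar> + eps n \<le> eps k"
    using eventually_ge_at_top[of "n + 1 + m"] eventually_ge_at_top[of "n + 1"]
  proof eventually_elim
    case (elim p)
    have "\<bar>psum a w m (n + 1 + m) - psum a w m p\<bar> \<le> eps n / 2" using psum_cauchy[OF r elim(1)] by simp
    moreover have "\<bar>v b (n + 1) - v b p\<bar> < eps n / 2" using is_realD[OF b elim(2)] by simp
    ultimately show ?case using n by linarith
  qed
  then show "\<exists>d>0. \<forall>\<^sub>F p in at_top. \<bar>v b p - psum a w m p\<bar> + d \<le> eps k" using eps(1) by blast
next
  assume "\<exists>d>0. \<forall>\<^sub>F p in at_top. \<bar>v b p - psum a w m p\<bar> + d \<le> eps k"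
  then obtain d where d: "0 < d" "\<forall>\<^sub>F p in at_top. \<bar>v b p - psum a w m p\<bar> + d \<le> eps k" by blast
  then obtain P where P: "\<And>p. P \<le> p \<Longrightarrow> \<bar>v b p - psum a w m p\<bar> + d \<le> eps k"
    by (auto simp: eventually_at_top_linorder)
  \<comment> \<open>\<open>close_to\<close> reads \<open>b\<close> at \<open>n + 1\<close> but the
    summands at \<open>n + 1 + m\<close>. Shifting \<open>b\<close> costs \<open>eps n / 2\<close>,
    and with the \<open>2 * eps n\<close> required by \<open>leqr\<close> this stays below
    \<open>d\<close>.\<close>
  have "\<forall>\<^sub>F n in at_top. eps n < d / 4" using d by (intro eventually_eps) simp
  then have "\<forall>\<^sub>F n in at_top. eps n < d / 4 \<and> P \<le> n" by (simp add: eventually_conj eventually_ge_at_top)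
  then obtain n where n: "eps n < d / 4" "P \<le> n" using eventually_happens by fastforce
  have "P \<le> n + 1 + m" using n(2) by (metis add.assoc add_increasing2 nonneg)
  moreover have "\<bar>v b (n + 1) - v b (n + 1 + m)\<bar> < eps n / 2"
    using is_realD[OF b, of "n + 1" "n + 1 + m"] by simp
  ultimately have "\<bar>v b (n + 1) - psum a w m (n + 1 + m)\<bar> + (eps n + eps n) < eps k"
    using P[of "n + 1 + m"] n(1) by linarith
  then show "close_to a b k w m" by (auto simp: close_to_def leqr_def v_sumr not_le)
qed

end

section \<open>Finite sequences in models\<close>

context nmodel
begin

text \<open>The induction statement "no number below \<open>n\<close> has \<open>P\<close>" has a
  bounded number quantifier only, so it is decidable along with \<open>P\<close>.\<close>

lemma least:
  assumes "decid P" "P n"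
  shows "\<exists>m\<le>n. P m \<and> (\<forall>j<m. \<not> P j)"
proof -
  obtain F where F: "\<And>n. F \<bullet> n = 0 \<longleftrightarrow> P n" using assms by (auto simp: decid_def)
  have "\<exists>m. P m \<and> (\<forall>j<m. \<not> P j)"
  proof (rule ccontr)
    assume *: "\<not> (\<exists>m. P m \<and> (\<forall>j<m. \<not> P j))"
    have "\<forall>j<n. \<not> P j" for n
    proof (induction n rule: int_induct)
      case decid
      show ?case
        by (rule decidI[of _ "(\<lambda>_. 0)(vF := F)" vN
            "forall ''j'' Nt (\<lambda>j. j \<^bold>< Free vN \<^bold>\<longrightarrow> \<^bold>\<not> (Free vF \<cdot> j \<^bold>= \<^bold>0))"]) (simp_all add: F)
    next
      case (Suc n)
      then show ?case using * less_Suc by auto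
    qed simp
    then show False using assms(2) less_Suc by blast
  qed
  then show ?thesis using assms(2) not_less by blast
qed

text \<open>The initial segment may have nonstandard length, so its bound must come from inside the
  model: the sum of all values of \<open>F\<close> on it, plus one.\<close>

lemma bounded: "\<exists>N. \<forall>j<m. F \<bullet> j < N"
proof -
  define S where "S = sem M ((\<lambda>_. 0)(vF := F)) [] (fn ''i'' Nt (\<lambda>i. fn ''r'' Nt (\<lambda>r. r \<^bold>+ Free vF \<cdot> i)))"
  let ?B = "\<lambda>n. rec S 0 n"
  have B: "?B (n + 1) = ?B n + F \<bullet> n" for n by (simp add: S_def)
  have "j < n \<longrightarrow> F \<bullet> j \<le> ?B n" for j n
  proof (induction n rule: int_induct)
    case decid
    show ?case
      by (rule decidI[of _ "(\<lambda>_. 0)(vA := j, vF := F, (''S'', Nt \<rightarrow> Nt \<rightarrow> Nt) := S)" vN "Free vA \<^bold>< Free vN \<^bold>\<longrightarrow>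
          \<^bold>\<not> (Cst Rec \<cdot> Free (''S'', Nt \<rightarrow> Nt \<rightarrow> Nt) \<cdot> \<^bold>0 \<cdot> Free vN \<^bold>< Free vF \<cdot> Free vA)"])
        (simp_all add: not_less)
  next
    case (Suc n)
    then show ?case unfolding B less_Suc by (auto intro: add_increasing add_increasing2)
  qed simp
  then have "\<forall>j<m. F \<bullet> j < ?B m + 1" using less_Suc by (auto simp: le_less)
  then show ?thesis by blast
qed

text \<open>\<open>c n\<close> counts the numbers below \<open>n\<close> with \<open>P\<close>, and
  \<open>e\<close> lists the numbers with \<open>P\<close> in order. Composing with \<open>e\<close>
  extracts a subsequence as an object of the model.\<close>

lemma enumerate:
  assumes "decid P"
  obtains c e where "c \<bullet> 0 = 0" "\<And>i. P i \<Longrightarrow> e \<bullet> (c \<bullet> i) = i"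
    "\<And>p n. p < c \<bullet> n \<Longrightarrow> e \<bullet> p < n \<and> P (e \<bullet> p) \<and> c \<bullet> (e \<bullet> p) = p"
    "\<And>i n. i \<le> n \<Longrightarrow> c \<bullet> i \<le> c \<bullet> n" "\<And>i n. P i \<Longrightarrow> i < n \<Longrightarrow> c \<bullet> i < c \<bullet> n"
proof -
  obtain F where F: "\<And>n. F \<bullet> n = 0 \<longleftrightarrow> P n" using assms by (auto simp: decid_def)
  define c where "c = sem M ((\<lambda>_. 0)(vF := F)) [] (fn ''n'' Nt (\<lambda>n.
    Cst Rec \<cdot> fn ''i'' Nt (\<lambda>i. fn ''r'' Nt (\<lambda>r. r \<^bold>+ (\<^bold>1 \<^bold>- Free vF \<cdot> i))) \<cdot> \<^bold>0 \<cdot> n))"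
  have c: "c \<bullet> 0 = 0" "c \<bullet> (i + 1) = c \<bullet> i + (if P i then 1 else 0)" for i
    by (simp_all add: c_def sem_upd_fresh del: fun_upd_apply) (simp_all add: one_diff F)
  have mono: "c \<bullet> i \<le> c \<bullet> n" if "i \<le> n" for i n
  proof -
    have "i \<le> n \<longrightarrow> c \<bullet> i \<le> c \<bullet> n"
    proof (induction n rule: int_induct)
      case decid
      show ?case
        by (rule decidI[of _ "(\<lambda>_. 0)(vA := i, vF := c)" vN "\<^bold>\<not> Free vN \<^bold>< Free vA \<^bold>\<longrightarrow>
            \<^bold>\<not> Free vF \<cdot> Free vN \<^bold>< Free vF \<cdot> Free vA"]) (simp_all add: not_less)
    next
      case (Suc n)
      show ?case
      proof (cases "i = n + 1")
        case False
        then have "i \<le> n + 1 \<Longrightarrow> i \<le> n" using less_Suc by (auto simp: le_less)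
        then show ?thesis using Suc by (auto simp: c(2) intro: add_increasing2)
      qed simp
    qed simp
    then show ?thesis using that by blast
  qed
  have strict: "c \<bullet> i < c \<bullet> n" if "P i" "i < n" for i n
  proof -
    have "c \<bullet> i < c \<bullet> (i + 1)" using that(1) by (simp add: c(2) less_Suc)
    also have "\<dots> \<le> c \<bullet> n" using that(2) less_iff_succ_less_eq mono by blast
    finally show ?thesis .
  qed
  let ?p = "(''p'', Nt)" and ?i = "(''i'', Nt)"
  obtain e where e: "\<And>p i. sat M ((\<lambda>_. 0)(vF := F, vG := c, ?p := p, ?i := i)) []
      (Free vF \<cdot> Free ?i \<^bold>= \<^bold>0 \<^bold>\<and> Free vG \<cdot> Free ?i \<^bold>= Free ?p) \<Longrightarrow>
      sat M ((\<lambda>_. 0)(vF := F, vG := c, ?p := p, ?i := ap M (snd ?p \<rightarrow> Nt) e p)) []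
      (Free vF \<cdot> Free ?i \<^bold>= \<^bold>0 \<^bold>\<and> Free vG \<cdot> Free ?i \<^bold>= Free ?p)"
    using choice[of "Free vF \<cdot> Free ?i \<^bold>= \<^bold>0 \<^bold>\<and> Free vG \<cdot> Free ?i \<^bold>= Free ?p" ?i ?p "(\<lambda>_. 0)(vF := F, vG := c)"]
    by auto
  have e': "P (e \<bullet> (c \<bullet> i))" "c \<bullet> (e \<bullet> (c \<bullet> i)) = c \<bullet> i" if "P i" for i
    using e[of "c \<bullet> i" i] that by (simp_all add: F)
  have ec: "e \<bullet> (c \<bullet> i) = i" if "P i" for i
    using e'[OF that] strict[of i "e \<bullet> (c \<bullet> i)"] strict[of "e \<bullet> (c \<bullet> i)" i] that
    by (cases i "e \<bullet> (c \<bullet> i)" rule: linorder_cases) auto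
  have "p < c \<bullet> n \<longrightarrow> e \<bullet> p < n \<and> P (e \<bullet> p) \<and> c \<bullet> (e \<bullet> p) = p" for p n
  proof (induction n rule: int_induct)
    case decid
    show ?case
      by (rule decidI[of _ "(\<lambda>_. 0)(vA := p, vB := e \<bullet> p, vF := F, vG := c)" vN "Free vA \<^bold>< Free vG \<cdot> Free vN \<^bold>\<longrightarrow>
          Free vB \<^bold>< Free vN \<^bold>\<and> Free vF \<cdot> Free vB \<^bold>= \<^bold>0 \<^bold>\<and> Free vG \<cdot> Free vB \<^bold>= Free vA"]) (simp_all add: F)
  next
    case 0
    then show ?case using c by simp
  next
    case (Suc n)
    then show ?case using ec[of n] by (auto simp: c(2) less_Suc split: if_splits)
  qed
  then show thesis using that c(1) ec mono strict by blast
qed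

lemma ext1: "(\<And>n. f \<bullet> n = g \<bullet> n) \<Longrightarrow> f = g"
  by (rule ap_ext)

text \<open>A case distinction by arithmetic: \<open>1 - (1 - (l - i))\<close> is 1 for
  \<open>i < l\<close> and 0 otherwise, and \<open>1 - (l - i)\<close> is its complement.\<close>

definition append :: "'d \<Rightarrow> 'd \<Rightarrow> 'd \<Rightarrow> 'd" where
  "append f l g = sem M ((\<lambda>_. 0)((''f'', Nt \<rightarrow> T1) := f, (''l'', Nt) := l, (''g'', Nt \<rightarrow> T1) := g)) []
    (fn ''i'' Nt (\<lambda>i. fn ''n'' Nt (\<lambda>n.
      Free (''f'', Nt \<rightarrow> T1) \<cdot> i \<cdot> n \<^bold>* (\<^bold>1 \<^bold>- (\<^bold>1 \<^bold>- (Free (''l'', Nt) \<^bold>- i))) \<^bold>+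
      Free (''g'', Nt \<rightarrow> T1) \<cdot> (i \<^bold>- Free (''l'', Nt)) \<cdot> n \<^bold>* (\<^bold>1 \<^bold>- (Free (''l'', Nt) \<^bold>- i)))))"

lemma append: "append f l g \<star> i = (if i < l then f \<star> i else g \<star> (i - l))"
  by (rule ext1) (auto simp: append_def one_diff diff_eq_0 not_le)

lemma append_less [simp]: "i < l \<Longrightarrow> append f l g \<star> i = f \<star> i"
  by (simp add: append)

lemma append_add [simp]: "append f l g \<star> (l + j) = g \<star> j"
proof -
  have "\<not> l + j < l" using nonneg[of j] by (simp add: not_less)
  then show ?thesis by (simp add: append)
qed

lemma less_add_cases:
  assumes "i < l + (m :: 'd)"
  obtains "i < l" | j where "i = l + j" "j < m"
proof (cases "i < l")
  case False
  then have i: "i = l + (i - l)" using le_add_diff_inverse2[of l i] by (simp add: add.commute)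
  then have "i - l < m" using assms by (metis add_less_cancel_left)
  then show thesis using i that by blast
qed (use that in blast)

lemma fin_in1: "fin w m \<Longrightarrow> i < m \<Longrightarrow> in1 (w \<star> i)"
  by (simp add: fin_def)

lemma in1_real: "in1 x \<Longrightarrow> is_real x"
  by (simp add: in1_def)

lemma fin_append:
  assumes "fin f l" "fin g m" "\<And>i j. i < l \<Longrightarrow> j < m \<Longrightarrow> \<not> eqr (f \<star> i) (g \<star> j)"
  shows "fin (append f l g) (l + m)"
  unfolding fin_def
proof (intro allI impI conjI)
  fix i assume "i < l + m"
  then show "in1 (append f l g \<star> i)"
    by (rule less_add_cases) (use assms fin_in1 in auto)
  fix j assume "j < i"
  from \<open>i < l + m\<close> show "\<not> eqr (append f l g \<star> j) (append f l g \<star> i)"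
  proof (rule less_add_cases)
    assume "i < l"
    then show ?thesis using \<open>j < i\<close> assms(1) by (simp add: fin_def)
  next
    fix i' assume i': "i = l + i'" "i' < m"
    then have "j < l + i'" using \<open>j < i\<close> by simp
    then show ?thesis
    proof (rule less_add_cases)
      assume "j < l"
      then show ?thesis using i' assms(3) by simp
    next
      fix j' assume "j = l + j'" "j' < i'"
      then show ?thesis using i' assms(2) by (simp add: fin_def)
    qed
  qed
qed

lemma psum_append: "psum a (append f l g) (l + m) p = psum a f l p + psum a g m p"
  by (intro Sumk_append ink_seq) simp_all

definition compose :: "'d \<Rightarrow> 'd \<Rightarrow> 'd" where
  "compose w e = sem M ((\<lambda>_. 0)((''w'', Nt \<rightarrow> T1) := w, (''e'', T1) := e)) []
    (fn ''p'' Nt (\<lambda>p. Free (''w'', Nt \<rightarrow> T1) \<cdot> (Free (''e'', T1) \<cdot> p)))"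

lemma compose [simp]: "compose w e \<star> p = w \<star> (e \<bullet> p)"
  by (simp add: compose_def)

lemma cont_refl: "cont u l u l"
  by (auto simp: cont_def)

text \<open>Forms the union of two finite sets without creating repetitions. Equality of reals is
  arithmetical, so the model can select the members of \<open>g\<close> that \<open>f\<close>
  lacks.\<close>

lemma missing:
  assumes "fin f l" "fin g m"
  obtains u r where "fin u r" "\<And>i. i < r \<Longrightarrow> \<exists>j<m. u \<star> i = g \<star> j"
    "\<And>i j. j < l \<Longrightarrow> i < r \<Longrightarrow> \<not> eqr (f \<star> j) (u \<star> i)" "cont g m (append f l u) (l + r)"
proof -
  let ?P = "\<lambda>j. \<not> (\<exists>i<l. eqr (f \<star> i) (g \<star> j))"
  have "decid ?P"
    by (rule decidI[of _ "(\<lambda>_. 0)((''f'', Nt \<rightarrow> T1) := f, (''g'', Nt \<rightarrow> T1) := g, vA := l)" vN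
        "\<^bold>\<not> exists ''i'' Nt (\<lambda>i. i \<^bold>< Free vA \<^bold>\<and> eqR (Free (''f'', Nt \<rightarrow> T1) \<cdot> i) (Free (''g'', Nt \<rightarrow> T1) \<cdot> Free vN))"])
      simp_all
  then obtain c e where c: "\<And>i. ?P i \<Longrightarrow> e \<bullet> (c \<bullet> i) = i"
    "\<And>p n. p < c \<bullet> n \<Longrightarrow> e \<bullet> p < n \<and> ?P (e \<bullet> p) \<and> c \<bullet> (e \<bullet> p) = p"
    "\<And>i n. ?P i \<Longrightarrow> i < n \<Longrightarrow> c \<bullet> i < c \<bullet> n"
    by (rule enumerate) blast
  let ?u = "compose g e" and ?r = "c \<bullet> m"
  show thesis
  proof (rule that)
    show "fin ?u ?r" unfolding fin_def
    proof (intro allI impI conjI)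
      fix i assume i: "i < ?r"
      then show "in1 (?u \<star> i)" using c(2) assms(2) fin_in1 by simp
      fix j assume "j < i"
      then have "j < ?r" using i by simp
      then have "e \<bullet> j \<noteq> e \<bullet> i" "e \<bullet> j < m" "e \<bullet> i < m" using c(2) i \<open>j < i\<close> by (metis order.irrefl)+
      then show "\<not> eqr (?u \<star> j) (?u \<star> i)"
        using assms(2) eqr_sym by (cases "e \<bullet> j" "e \<bullet> i" rule: linorder_cases) (auto simp: fin_def)
    qed
    show "\<exists>j<m. ?u \<star> i = g \<star> j" if "i < ?r" for i using c(2)[OF that] by auto
    show "\<not> eqr (f \<star> j) (?u \<star> i)" if "j < l" "i < ?r" for i j using c(2)[OF that(2)] that(1) by auto
    show "cont g m (append f l ?u) (l + ?r)" unfolding cont_def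
    proof (intro allI impI)
      fix j assume "j < m"
      show "\<exists>i<l + ?r. eqr (g \<star> j) (append f l ?u \<star> i)"
      proof (cases "?P j")
        case True
        then have "c \<bullet> j < ?r" "append f l ?u \<star> (l + c \<bullet> j) = g \<star> j" using c(1,3) \<open>j < m\<close> by simp_all
        then show ?thesis by (intro exI[of _ "l + c \<bullet> j"]) simp
      next
        case False
        then obtain i where "i < l" "eqr (f \<star> i) (g \<star> j)" by blast
        moreover have "i < l + ?r" using \<open>i < l\<close> by (rule order.strict_trans2) (simp add: add_increasing2)
        ultimately show ?thesis using eqr_sym by (intro exI[of _ i]) simp
      qed
    qed
  qed
qed

definition single :: "'d \<Rightarrow> 'd" where
  "single x = sem M ((\<lambda>_. 0)((''x'', T1) := x)) [] (fn ''i'' Nt (\<lambda>i. Free (''x'', T1)))"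

lemma single [simp]: "single x \<star> i = x"
  by (simp add: single_def)

lemma less_1 [simp]: "i < 1 \<longleftrightarrow> i = (0 :: 'd)"
  using less_Suc[of i 0] by simp

lemma fin_single: "in1 x \<Longrightarrow> fin (single x) 1"
  by (simp add: fin_def)

lemma psum_single: "psum a (single x) 1 p = v (a \<odot> x) p"
  using Sumk_Suc[OF ink_seq, of a "single x" p 0] Sumk_0[OF ink_seq, of a "single x" p] by simp

text \<open>Covers \<open>r\<close> summands, each known only up to twice \<open>eps p\<close>;
  \<open>r\<close> stays fixed while \<open>p\<close> grows.\<close>

lemma eventually_emb_eps: "0 < d \<Longrightarrow> \<forall>\<^sub>F p in at_top. emb r * (eps p + eps p) \<le> d"
proof -
  assume d: "0 < d"
  \<comment> \<open>The added 1 keeps the divisor positive for \<open>r = 0\<close>.\<close>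
  have pos: "0 < 2 * (emb r + 1)" by (simp add: add_nonneg_pos)
  then have "\<forall>\<^sub>F p in at_top. eps p < d / (2 * (emb r + 1))" using d by (intro eventually_eps) simp
  then show ?thesis
  proof eventually_elim
    case (elim p)
    then have "eps p * (2 * (emb r + 1)) < d" using pos by (simp add: pos_less_divide_eq)
    moreover have "emb r * (eps p + eps p) = eps p * (2 * (emb r + 1)) - 2 * eps p" by (simp add: algebra_simps)
    ultimately show ?case using eps(1)[of p] by linarith
  qed
qed

section \<open>Positive convergent sums\<close>

context
  fixes a b :: 'd
  assumes fam: "fam a" and pos: "posi a" and conv: "conv a b"
begin

lemma summand_real: "fin w m \<Longrightarrow> i < m \<Longrightarrow> is_real (a \<odot> (w \<star> i))"
  using fam fin_in1 by (auto simp: fam_def)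

lemma b_real: "is_real b"
  using conv by (simp add: conv_def)

lemma psum_nonneg:
  assumes "fin u r" "0 < d"
  shows "\<forall>\<^sub>F p in at_top. - d \<le> psum a u r p"
  using eventually_emb_eps[OF assms(2), of r]
proof eventually_elim
  case (elim p)
  have "0 \<le> v (a \<odot> (u \<star> i)) p + (eps p + eps p)" if "i < r" for i
    using pos assms(1) fin_in1 that unfolding posi_def leqr_def by fastforce
  then have "Sumk (\<lambda>_. 0) r \<le> psum a u r p + emb r * (eps p + eps p)"
    by (intro Sumk_le ink_seq ink_const) auto
  moreover have "0 = Sumk (\<lambda>_. 0) r" by (rule Sumk_unique[of _ "\<lambda>_. 0"]) (auto intro: ink_const)
  ultimately show ?case using elim by linarith
qed

text \<open>Enlarging \<open>f\<close> until it contains a witness set brings the sum close to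
  \<open>b\<close>, and the added summands are not negative.\<close>

lemma psum_le:
  assumes "fin f l" "0 < d"
  shows "\<forall>\<^sub>F p in at_top. psum a f l p \<le> v b p + d"
proof -
  \<comment> \<open>One half of \<open>d\<close> is for the distance to \<open>b\<close>, the other
    for the approximations of the added summands, which may be slightly negative.\<close>
  obtain k where k: "eps k < d / 2" using eps_archimedean[of "d / 2"] assms(2) by auto
  obtain g m where g: "wit a b k g m" using conv unfolding conv_def by blast
  then have "fin g m" by (simp add: wit_def)
  with assms(1) obtain u r where u: "fin u r" "\<And>i j. j < l \<Longrightarrow> i < r \<Longrightarrow> \<not> eqr (f \<star> j) (u \<star> i)"
    "cont g m (append f l u) (l + r)" by (rule missing) blast
  then have fin: "fin (append f l u) (l + r)" using assms(1) by (intro fin_append)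
  then have "close_to a b k (append f l u) (l + r)" using g u(3) by (simp add: wit_def)
  then obtain d' where d': "0 < d'" "\<forall>\<^sub>F p in at_top. \<bar>v b p - (psum a f l p + psum a u r p)\<bar> + d' \<le> eps k"
    using close_to_iff[OF b_real, of "l + r" a "append f l u" k] summand_real[OF fin] by (auto simp: psum_append)
  have "0 < d / 2" using assms(2) by simp
  from d'(2) psum_nonneg[OF u(1) this] show ?thesis
  proof eventually_elim
    case (elim p)
    then show ?case using k d'(1) assms(2) by linarith
  qed
qed

text \<open>
  If \<open>f\<close> already sums up to almost \<open>b\<close>, then what is missing from a sequence \<open>w\<close> containing \<open>f\<close> is
  small, because appended to \<open>f\<close> it gives a sum that is at most \<open>b\<close>. Hence no rearrangement of sums is needed.
\<close>

lemma wit_if_close: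
  assumes f: "fin f l" and cl: "close_to a b (k + 1) f l"
  shows "wit a b k f l"
  unfolding wit_def
proof (intro conjI allI impI)
  fix w m assume w: "fin w m \<and> cont f l w m"
  \<comment> \<open>Enlarging \<open>w\<close> by what it lacks of a witness set \<open>g\<close>
    gives a sum near \<open>b\<close>. The added part \<open>u\<close> is what has to be shown
    small.\<close>
  obtain g n where g: "wit a b (k + 1) g n" using conv unfolding conv_def by blast
  then have "fin g n" by (simp add: wit_def)
  with w obtain u r where u: "fin u r" "\<And>i j. j < m \<Longrightarrow> i < r \<Longrightarrow> \<not> eqr (w \<star> j) (u \<star> i)"
    "cont g n (append w m u) (m + r)" using missing by metis
  then have fin: "fin (append w m u) (m + r)" using w by (intro fin_append) auto
  then have "close_to a b (k + 1) (append w m u) (m + r)" using g u(3) by (simp add: wit_def)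
  then obtain d1 where d1: "0 < d1"
      "\<forall>\<^sub>F p in at_top. \<bar>v b p - (psum a w m p + psum a u r p)\<bar> + d1 \<le> eps k / 2"
    using close_to_iff[OF b_real, of "m + r" a "append w m u" "k + 1"] summand_real[OF fin] by (auto simp: psum_append)
  obtain d2 where d2: "0 < d2" "\<forall>\<^sub>F p in at_top. \<bar>v b p - psum a f l p\<bar> + d2 \<le> eps k / 2"
    using cl close_to_iff[OF b_real, of l a f "k + 1"] summand_real[OF f] by auto
  \<comment> \<open>Every member of \<open>f\<close> equals some member of \<open>w\<close>, and
    \<open>u\<close> avoids those. So \<open>u\<close> may be appended to \<open>f\<close> as
    well.\<close>
  have "\<not> eqr (f \<star> i) (u \<star> j)" if ij: "i < l" "j < r" for i j
  proof
    assume e: "eqr (f \<star> i) (u \<star> j)"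
    obtain j' where j': "j' < m" "eqr (f \<star> i) (w \<star> j')" using w ij by (auto simp: cont_def)
    have "eqr (w \<star> j') (u \<star> j)"
      using eqr_trans[of "w \<star> j'" "f \<star> i" "u \<star> j"] eqr_sym[OF j'(2)] e in1_real fin_in1 w f u(1) ij j'(1) by blast
    then show False using u(2) j'(1) ij(2) by blast
  qed
  then have fin2: "fin (append f l u) (l + r)" using f u(1) by (intro fin_append)
  \<comment> \<open>In the estimate for \<open>u\<close> this slack is absorbed by the gap
    \<open>d2\<close>; in the upper estimate for \<open>w\<close> it may be as large as
    \<open>eps k / 2\<close>.\<close>
  let ?d = "min d2 (eps k / 2)"
  have dpos: "0 < ?d" using d2(1) by simp
  from psum_le[OF fin2 dpos] psum_le[OF conjunct1[OF w] dpos] d1(2) d2(2)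
  have "\<forall>\<^sub>F p in at_top. \<bar>v b p - psum a w m p\<bar> + min d1 (eps k / 2) \<le> eps k"
  proof eventually_elim
    case (elim p)
    have m: "min d1 (eps k / 2) \<le> d1" "min d1 (eps k / 2) \<le> eps k / 2" "?d \<le> d2" "?d \<le> eps k / 2" by simp_all
    have "psum a f l p + psum a u r p \<le> v b p + d2"
      using elim(1) m(3) by (simp only: psum_append)
    then have "v b p - psum a w m p \<le> eps k - d1"
      using elim(3,4) by linarith
    moreover have "psum a w m p - v b p \<le> eps k / 2" using elim(2) m(4) by linarith
    ultimately show ?case using m(1,2) by linarith
  qed
  moreover have "0 < min d1 (eps k / 2)" using d1(1) by simp
  ultimately show "close_to a b k w m"
    using close_to_iff[OF b_real, of m a w k] summand_real[of w m] w by blast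
qed (fact f)

text \<open>With \<open>z\<close> appended the sum is still at most \<open>b\<close>, and
  \<open>f\<close> alone already reaches \<open>b\<close> up to \<open>eps k\<close>.\<close>

lemma outside_small:
  assumes f: "fin f l" and cl: "close_to a b k f l" and z: "in1 z" "\<And>i. i < l \<Longrightarrow> \<not> eqr (f \<star> i) z" and d: "0 < d"
  shows "\<forall>\<^sub>F p in at_top. v (a \<odot> z) p \<le> eps k + d"
proof -
  have fin: "fin (append f l (single z)) (l + 1)" using f z by (intro fin_append fin_single) auto
  obtain d1 where d1: "0 < d1" "\<forall>\<^sub>F p in at_top. \<bar>v b p - psum a f l p\<bar> + d1 \<le> eps k"
    using cl close_to_iff[OF b_real, of l a f k] summand_real[OF f] by auto
  from psum_le[OF fin d] d1(2) show ?thesis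
  proof eventually_elim
    case (elim p)
    have "psum a f l p + v (a \<odot> z) p \<le> v b p + d" using elim(1) by (simp only: psum_append psum_single)
    then show ?case using elim(2) d1(1) by linarith
  qed
qed

end

text \<open>Pairing merges a sequence of finite sequences into one sequence of reals; positions
  beyond the lengths are filled with the real 0.\<close>

lemma flatten:
  obtains z where "\<And>k i. i < L \<bullet> k \<Longrightarrow> z \<star> pair k i = ap M (Nt \<rightarrow> Nt \<rightarrow> T1) \<Phi> k \<star> i"
    "\<And>q. z \<star> q = rat 0 \<or> (\<exists>k i. i < L \<bullet> k \<and> z \<star> q = ap M (Nt \<rightarrow> Nt \<rightarrow> T1) \<Phi> k \<star> i)"
proof -
  let ?P = "(''P'', Nt \<rightarrow> Nt \<rightarrow> T1)" and ?L = "(''L'', T1)"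
  \<comment> \<open>The second factor is 1 if the second component is below the length and 0
    otherwise. Multiplying a code by 0 is safe because the number 0 codes the rational 0.\<close>
  define z where "z = sem M ((\<lambda>_. 0)(?P := \<Phi>, ?L := L)) [] (fn ''q'' Nt (\<lambda>q. fn ''n'' Nt (\<lambda>n.
    Free ?P \<cdot> (fst_tm \<cdot> q) \<cdot> (snd_tm \<cdot> q) \<cdot> n \<^bold>* (\<^bold>1 \<^bold>- ((snd_tm \<cdot> q \<^bold>+ \<^bold>1) \<^bold>- Free ?L \<cdot> (fst_tm \<cdot> q))))))"
  have z: "z \<star> q \<bullet> n = (if sn q < L \<bullet> fs q then ap M (Nt \<rightarrow> Nt \<rightarrow> T1) \<Phi> (fs q) \<star> sn q \<bullet> n else 0)" for q n
    by (auto simp: z_def one_diff diff_eq_0 less_iff_succ_less_eq)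
  have r: "rat 0 \<bullet> n = 0" for n by (simp add: rat_def ratR_tm_def)
  have "z \<star> q = (if sn q < L \<bullet> fs q then ap M (Nt \<rightarrow> Nt \<rightarrow> T1) \<Phi> (fs q) \<star> sn q else rat 0)" for q
    by (rule ext1) (simp add: z r)
  then show thesis by (intro that[of z]) auto
qed

lemma posi_outside:
  assumes "fam a" "posi a" "in1 z" "\<And>d. 0 < d \<Longrightarrow> \<forall>\<^sub>F p in at_top. v (a \<odot> z) p \<le> d"
  shows "eqr (a \<odot> z) (rat 0)"
proof -
  have "is_real (a \<odot> z)" using assms by (simp add: fam_def)
  then have "leqr (a \<odot> z) (rat 0)" using assms by (simp add: leqr_iff)
  then show ?thesis using assms by (simp add: eqr_leqr posi_def)
qed

section \<open>From choice to an enumeration of the support\<close>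

lemma sat_item_ii:
  "sat M e [] item_ii \<longleftrightarrow> (\<forall>a. fam a \<and> posi a \<and> (\<exists>b. conv a b) \<longrightarrow>
    (\<exists>y. (\<forall>n. is_real (y \<star> n)) \<and> (\<forall>z. in1 z \<and> (\<forall>n. \<not> eqr z (y \<star> n)) \<longrightarrow> eqr (a \<odot> z) (rat 0))))"
  by (simp add: item_ii_def)

lemma sat_QF_AC01:
  "sat M e [] QF_AC01 \<longleftrightarrow> (\<forall>Y. (\<forall>n. \<exists>f. ap M T1 (ap M (T1 \<rightarrow> Nt \<rightarrow> Nt) Y f) n = 0) \<longrightarrow>
    (\<exists>F. \<forall>n. ap M T1 (ap M (T1 \<rightarrow> Nt \<rightarrow> Nt) Y (F \<star> n)) n = 0))"
  by (simp add: QF_AC01_def)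

abbreviation "va \<equiv> (''a'', T1 \<rightarrow> T1)"
abbreviation "vb \<equiv> (''b'', T1)"
abbreviation "vf \<equiv> (''f'', T1)"
abbreviation "vk \<equiv> (''k'', Nt)"

text \<open>A finite sequence coded by an object of type 1: the length first, then the values.\<close>

definition seqt :: "tm \<Rightarrow> tm" where
  "seqt f = fn ''sq_i'' Nt (\<lambda>i. fn ''sq_n'' Nt (\<lambda>n. f \<cdot> (pair_tm \<cdot> i \<cdot> n \<^bold>+ \<^bold>1)))"

lemma seqt_simps [simp]:
  "tyof [] f = Some T1 \<Longrightarrow> tyof [] (seqt f) = Some (Nt \<rightarrow> T1)"
  "lct 0 f \<Longrightarrow> lct 0 (seqt f)" "fvt (seqt f) = fvt f - {(''sq_i'', Nt), (''sq_n'', Nt)}"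
  "tyof [] f = Some T1 \<Longrightarrow> (''sq_i'', Nt) \<notin> fvt f \<Longrightarrow> (''sq_n'', Nt) \<notin> fvt f \<Longrightarrow>
    sem M e [] (seqt f) \<star> i \<bullet> n = sem M e [] f \<bullet> (pair i n + 1)"
  by (auto simp: seqt_def sem_upd_fresh)

definition "sq f = sem M ((\<lambda>_. 0)(vf := f)) [] (seqt (Free vf))"

lemma sq [simp]: "sq f \<star> i \<bullet> n = f \<bullet> (pair i n + 1)"
  by (simp add: sq_def)

lemma ext2: "(\<And>i n. f \<star> i \<bullet> n = g \<star> i \<bullet> n) \<Longrightarrow> f = g"
  by (rule ap_ext, rule ap_ext)

text \<open>\<open>QF_AC01\<close> chooses objects of type 1, so every finite sequence needs a code
  of that type.\<close>

lemma sq_surj: "\<exists>f. f \<bullet> 0 = l \<and> sq f = g"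
proof -
  define f where "f = sem M ((\<lambda>_. 0)((''g'', Nt \<rightarrow> T1) := g, (''l'', Nt) := l)) [] (fn ''q'' Nt (\<lambda>q.
    (\<^bold>1 \<^bold>- q) \<^bold>* Free (''l'', Nt) \<^bold>+
    (\<^bold>1 \<^bold>- (\<^bold>1 \<^bold>- q)) \<^bold>* (Free (''g'', Nt \<rightarrow> T1) \<cdot> (fst_tm \<cdot> (q \<^bold>- \<^bold>1)) \<cdot> (snd_tm \<cdot> (q \<^bold>- \<^bold>1)))))"
  have "f \<bullet> 0 = l" by (simp add: f_def one_diff)
  moreover have "q + 1 \<noteq> (0 :: 'd)" for q
    using nonneg[of q] by (metis add_nonneg_eq_0_iff nonneg zero_neq_one)
  then have "f \<bullet> (q + 1) = g \<star> fs q \<bullet> sn q" for q by (simp add: f_def one_diff)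
  then have "sq f = g" by (intro ext2[of "sq f" g]) simp
  ultimately show ?thesis by blast
qed

lemma ac01_imp_ii:
  assumes AC: "sat M e [] QF_AC01"
  shows "sat M e [] item_ii"
  unfolding sat_item_ii
proof (intro allI impI)
  fix a assume "fam a \<and> posi a \<and> (\<exists>b. conv a b)"
  then obtain b where a: "fam a" "posi a" "conv a b" by blast
  let ?e = "(\<lambda>_. 0)(va := a, vb := b)"
  \<comment> \<open>Closeness in place of being a witness keeps the formula arithmetical, and
    \<open>outside_small\<close> asks for no more.\<close>
  let ?\<phi> = "finseq (seqt (Free vf)) (Free vf \<cdot> \<^bold>0) \<^bold>\<and>
    lessR (absR_tm \<cdot> (diffR_tm \<cdot> Free vb \<cdot> (sum_tm \<cdot> Free va \<cdot> seqt (Free vf) \<cdot> (Free vf \<cdot> \<^bold>0)))) (ratR_tm \<cdot> (qpow_tm \<cdot> Free vN))"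
  have sq: "sem M e' [] (seqt (Free vf)) = sq (e' vf)" for e' by (rule ext2) simp
  have \<phi>: "sat M (?e(vf := f, vN := n)) [] ?\<phi> \<longleftrightarrow> fin (sq f) (f \<bullet> 0) \<and> close_to a b n (sq f) (f \<bullet> 0)" for f n
    by (simp add: sq close_to_def)
  obtain Y where Y: "\<And>f n. ap M (snd vN \<rightarrow> Nt) (ap M (snd vf \<rightarrow> snd vN \<rightarrow> Nt) Y f) n =
      (if sat M (?e(vf := f, vN := n)) [] ?\<phi> then 0 else 1)"
    using comprehension2[of ?\<phi> vf vN ?e] by auto
  have "\<exists>f. ap M T1 (ap M (T1 \<rightarrow> Nt \<rightarrow> Nt) Y f) n = 0" for n
  proof -
    obtain u l where u: "wit a b n u l" using a(3) unfolding conv_def by blast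
    obtain f where "f \<bullet> 0 = l" "sq f = u" using sq_surj by blast
    then have "fin (sq f) (f \<bullet> 0) \<and> close_to a b n (sq f) (f \<bullet> 0)"
      using u cont_refl by (simp add: wit_def)
    then show ?thesis using Y[of f n] \<phi> by (intro exI[of _ f]) simp
  qed
  then obtain F where "\<And>n. ap M T1 (ap M (T1 \<rightarrow> Nt \<rightarrow> Nt) Y (F \<star> n)) n = 0"
    using AC unfolding sat_QF_AC01 by blast
  then have F: "fin (sq (F \<star> n)) (F \<star> n \<bullet> 0)" "close_to a b n (sq (F \<star> n)) (F \<star> n \<bullet> 0)" for n
    using Y[of "F \<star> n" n] \<phi>[of "F \<star> n" n] by (simp_all split: if_splits)
  let ?F = "(''F'', Nt \<rightarrow> T1)"
  define P where "P = sem M ((\<lambda>_. 0)(?F := F)) [] (fn ''k'' Nt (\<lambda>k. seqt (Free ?F \<cdot> k)))"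
  have P: "ap M (Nt \<rightarrow> Nt \<rightarrow> T1) P k = sq (F \<star> k)" for k by (rule ext2) (simp add: P_def)
  define L where "L = sem M ((\<lambda>_. 0)(?F := F)) [] (fn ''k'' Nt (\<lambda>k. Free ?F \<cdot> k \<cdot> \<^bold>0))"
  have L: "L \<bullet> k = F \<star> k \<bullet> 0" for k by (simp add: L_def)
  obtain y where y: "\<And>k i. i < L \<bullet> k \<Longrightarrow> y \<star> pair k i = sq (F \<star> k) \<star> i"
    "\<And>q. y \<star> q = rat 0 \<or> (\<exists>k i. i < L \<bullet> k \<and> y \<star> q = sq (F \<star> k) \<star> i)"
    using flatten[of L P thesis] unfolding P by blast
  show "\<exists>y. (\<forall>n. is_real (y \<star> n)) \<and> (\<forall>z. in1 z \<and> (\<forall>n. \<not> eqr z (y \<star> n)) \<longrightarrow> eqr (a \<odot> z) (rat 0))"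
  proof (intro exI[of _ y] conjI allI impI)
    show "is_real (y \<star> q)" for q
      using y(2)[of q] F(1) fin_in1 in1_real L by fastforce
    fix z assume z: "in1 z \<and> (\<forall>n. \<not> eqr z (y \<star> n))"
    show "eqr (a \<odot> z) (rat 0)"
    proof (rule posi_outside)
      fix d :: "'d diff fract" assume "0 < d"
      then have d2: "0 < d / 2" by simp
      obtain k where k: "eps k < d / 2" using eps_archimedean[OF d2] by blast
      have "\<not> eqr (sq (F \<star> k) \<star> i) z" if "i < F \<star> k \<bullet> 0" for i
      proof -
        have "y \<star> pair k i = sq (F \<star> k) \<star> i" using y(1) that L by simp
        then show ?thesis using z eqr_sym by metis
      qed
      then have "\<forall>\<^sub>F p in at_top. v (a \<odot> z) p \<le> eps k + d / 2"
        using z d2 by (intro outside_small[OF a F(1) F(2)]) auto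
      then show "\<forall>\<^sub>F p in at_top. v (a \<odot> z) p \<le> d" by eventually_elim (use k in linarith)
    qed (use a z in auto)
  qed
qed

section \<open>From an enumeration of the support to a modulus\<close>

lemma sat_item_iii:
  "sat M e [] item_iii \<longleftrightarrow> (\<forall>a b. fam a \<and> posi a \<and> conv a b \<longrightarrow>
    (\<exists>P L. \<forall>k. wit a b k (ap M (Nt \<rightarrow> Nt \<rightarrow> T1) P k) (L \<bullet> k)))"
  by (simp add: item_iii_def modulus_def)

text \<open>An index is kept if its entry lies in the unit interval and equals no earlier one. The
  least position of a real in \<open>y\<close> is always kept.\<close>

lemma remove_repetitions:
  assumes y: "\<And>n. is_real (y \<star> n)"
  obtains u c where "\<And>n. fin u (c \<bullet> n)" "\<And>x q n. in1 x \<Longrightarrow> eqr x (y \<star> q) \<Longrightarrow> q < n \<Longrightarrow> \<exists>i<c \<bullet> n. eqr x (u \<star> i)"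
proof -
  let ?P = "\<lambda>i. in1 (y \<star> i) \<and> \<not> (\<exists>j<i. eqr (y \<star> j) (y \<star> i))"
  let ?y = "Free (''y'', Nt \<rightarrow> T1)"
  have "decid ?P"
    by (rule decidI[of _ "(\<lambda>_. 0)((''y'', Nt \<rightarrow> T1) := y)" vN "in01 (?y \<cdot> Free vN) \<^bold>\<and>
        \<^bold>\<not> exists ''j'' Nt (\<lambda>j. j \<^bold>< Free vN \<^bold>\<and> eqR (?y \<cdot> j) (?y \<cdot> Free vN))"]) simp_all
  then obtain c e where c: "\<And>i. ?P i \<Longrightarrow> e \<bullet> (c \<bullet> i) = i"
    "\<And>p n. p < c \<bullet> n \<Longrightarrow> e \<bullet> p < n \<and> ?P (e \<bullet> p) \<and> c \<bullet> (e \<bullet> p) = p"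
    "\<And>i n. i \<le> n \<Longrightarrow> c \<bullet> i \<le> c \<bullet> n" "\<And>i n. ?P i \<Longrightarrow> i < n \<Longrightarrow> c \<bullet> i < c \<bullet> n"
    by (rule enumerate) blast
  show thesis
  proof (rule that)
    show "fin (compose y e) (c \<bullet> n)" for n
      unfolding fin_def
    proof (intro allI impI conjI)
      fix i assume i: "i < c \<bullet> n"
      show "in1 (compose y e \<star> i)" using c(2)[OF i] by simp
      fix j assume "j < i"
      then have j: "j < c \<bullet> n" using i by simp
      \<comment> \<open>\<open>c\<close> is monotone and inverts \<open>e\<close>, so
        \<open>e\<close> is increasing; a kept entry differs from every earlier entry of
        \<open>y\<close>.\<close>
      have "e \<bullet> j < e \<bullet> i"
      proof (rule ccontr)
        assume "\<not> e \<bullet> j < e \<bullet> i"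
        then have "c \<bullet> (e \<bullet> i) \<le> c \<bullet> (e \<bullet> j)" by (intro c(3)) simp
        then show False using c(2)[OF i] c(2)[OF j] \<open>j < i\<close> by simp
      qed
      then show "\<not> eqr (compose y e \<star> j) (compose y e \<star> i)" using c(2)[OF i] by auto
    qed
    show "\<exists>i<c \<bullet> n. eqr x (compose y e \<star> i)" if x: "in1 x" and q: "eqr x (y \<star> q)" "q < n" for x q n
    proof -
      have "decid (\<lambda>q. eqr x (y \<star> q))"
        by (rule decidI[of _ "(\<lambda>_. 0)((''y'', Nt \<rightarrow> T1) := y, (''x'', T1) := x)" vN "eqR (Free (''x'', T1)) (?y \<cdot> Free vN)"])
          simp_all
      from least[OF this q(1)] obtain m where m: "m \<le> q" "eqr x (y \<star> m)" "\<And>j. j < m \<Longrightarrow> \<not> eqr x (y \<star> j)" by blast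
      have "\<not> eqr (y \<star> j) (y \<star> m)" if "j < m" for j
        using eqr_trans[of x "y \<star> m" "y \<star> j"] eqr_sym y in1_real[OF x] m that by blast
      then have "?P m" using in1_cong x y m(2) by blast
      then have "c \<bullet> m < c \<bullet> n" "e \<bullet> (c \<bullet> m) = m" using c m(1) q(2) by auto
      then show ?thesis using m(2) by (intro exI[of _ "c \<bullet> m"]) simp
    qed
  qed
qed

lemma ii_imp_iii:
  assumes ii: "sat M e [] item_ii"
  shows "sat M e [] item_iii"
  unfolding sat_item_iii
proof (intro allI impI)
  fix a b assume "fam a \<and> posi a \<and> conv a b"
  then have a: "fam a" "posi a" "conv a b" by auto
  then obtain y where y: "\<And>n. is_real (y \<star> n)"
      "\<And>z. in1 z \<Longrightarrow> (\<And>n. \<not> eqr z (y \<star> n)) \<Longrightarrow> eqr (a \<odot> z) (rat 0)"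
    using ii unfolding sat_item_ii by metis
  obtain u c where u: "\<And>n. fin u (c \<bullet> n)"
      "\<And>x q n. in1 x \<Longrightarrow> eqr x (y \<star> q) \<Longrightarrow> q < n \<Longrightarrow> \<exists>i<c \<bullet> n. eqr x (u \<star> i)"
    using remove_repetitions[of y] y(1) by blast
  \<comment> \<open>Take a segment of \<open>u\<close> beyond all positions in \<open>y\<close> of
    members of a witness set \<open>g\<close>. What \<open>g\<close> has outside the segment occurs
    nowhere in \<open>y\<close>, so those summands vanish and the segment alone is close to
    \<open>b\<close>.\<close>
  have ex: "\<exists>n. close_to a b (k + 1) u (c \<bullet> n)" for k
  proof -
    obtain g m where g: "wit a b (k + 1) g m" using a(3) unfolding conv_def by blast
    then have fg: "fin g m" by (simp add: wit_def)
    let ?e = "(\<lambda>_. 0)((''g'', Nt \<rightarrow> T1) := g, (''y'', Nt \<rightarrow> T1) := y)" and ?j = "(''j'', Nt)" and ?q = "(''q'', Nt)"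
    let ?\<phi> = "eqR (Free (''g'', Nt \<rightarrow> T1) \<cdot> Free ?j) (Free (''y'', Nt \<rightarrow> T1) \<cdot> Free ?q)"
    obtain G where "\<And>j q. sat M (?e(?j := j, ?q := q)) [] ?\<phi> \<Longrightarrow>
        sat M (?e(?j := j, ?q := ap M (snd ?j \<rightarrow> Nt) G j)) [] ?\<phi>"
      using choice[of ?\<phi> ?q ?j ?e] by auto
    \<comment> \<open>For a member of \<open>g\<close> that does not occur in \<open>y\<close> the
      value of \<open>G\<close> is arbitrary. This does no harm, as \<open>N\<close> only has to
      exceed the positions of the others.\<close>
    then have G: "eqr (g \<star> j) (y \<star> q) \<Longrightarrow> eqr (g \<star> j) (y \<star> (G \<bullet> j))" for j q by simp
    obtain N where N: "\<And>j. j < m \<Longrightarrow> G \<bullet> j < N" using bounded by blast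
    obtain r s where r: "fin r s" "\<And>i. i < s \<Longrightarrow> \<exists>j<m. r \<star> i = g \<star> j"
      "\<And>i j. j < c \<bullet> N \<Longrightarrow> i < s \<Longrightarrow> \<not> eqr (u \<star> j) (r \<star> i)" "cont g m (append u (c \<bullet> N) r) (c \<bullet> N + s)"
      using missing[OF u(1)[of N] fg] by blast
    have zero: "eqr (a \<odot> (r \<star> i)) (rat 0)" if i: "i < s" for i
    proof (rule y(2))
      obtain j where j: "j < m" "r \<star> i = g \<star> j" using r(2) i by blast
      show "in1 (r \<star> i)" using fin_in1 r(1) i by blast
      show "\<not> eqr (r \<star> i) (y \<star> q)" for q
      proof
        assume "eqr (r \<star> i) (y \<star> q)"
        then have "eqr (r \<star> i) (y \<star> (G \<bullet> j))" using G j by simp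
        then obtain i' where "i' < c \<bullet> N" "eqr (r \<star> i) (u \<star> i')"
          using u(2) N j(1) fin_in1[OF r(1) i] by blast
        then show False using r(3) i eqr_sym by blast
      qed
    qed
    have fin: "fin (append u (c \<bullet> N) r) (c \<bullet> N + s)" using u(1) r by (intro fin_append)
    then have "close_to a b (k + 1) (append u (c \<bullet> N) r) (c \<bullet> N + s)" using g r(4) by (simp add: wit_def)
    then obtain d where d: "0 < d"
        "\<forall>\<^sub>F p in at_top. \<bar>v b p - (psum a u (c \<bullet> N) p + psum a r s p)\<bar> + d \<le> eps (k + 1)"
      using close_to_iff[OF b_real[OF a], of "c \<bullet> N + s" a "append u (c \<bullet> N) r" "k + 1"] summand_real[OF a fin]
      by (auto simp: psum_append)
    have d2: "0 < d / 2" using d(1) by simp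
    \<comment> \<open>The missing summands are 0 as reals, hence of absolute value at most
      \<open>2 * eps p\<close> in approximation. Together they eventually cost at most
      \<open>d / 2\<close> of the gap.\<close>
    from d(2) psum_le[OF a u(1)[of N] d2] eventually_emb_eps[OF d2, of s]
    have "\<forall>\<^sub>F p in at_top. \<bar>v b p - psum a u (c \<bullet> N) p\<bar> + d / 2 \<le> eps (k + 1)"
    proof eventually_elim
      case (elim p)
      have "v (a \<odot> (r \<star> i)) p \<le> 0 + (eps p + eps p)" if "i < s" for i
        using zero[OF that] unfolding eqr_leqr leqr_def by simp
      then have "psum a r s p \<le> Sumk (\<lambda>_. 0) s + emb s * (eps p + eps p)"
        by (intro Sumk_le ink_seq ink_const)
      moreover have "0 \<le> v (a \<odot> (r \<star> i)) p + (eps p + eps p)" if "i < s" for i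
        using zero[OF that] unfolding eqr_leqr leqr_def by simp
      then have "Sumk (\<lambda>_. 0) s \<le> psum a r s p + emb s * (eps p + eps p)"
        by (intro Sumk_le ink_seq ink_const)
      moreover have "0 = Sumk (\<lambda>_. 0) s" by (rule Sumk_unique[of _ "\<lambda>_. 0"]) (auto intro: ink_const)
      ultimately have "\<bar>psum a r s p\<bar> \<le> d / 2" using elim(3) by linarith
      then show ?case using elim(1) by linarith
    qed
    then have "close_to a b (k + 1) u (c \<bullet> N)"
      using close_to_iff[OF b_real[OF a], of "c \<bullet> N" a u "k + 1"] summand_real[OF a u(1)[of N]] d2 by blast
    then show ?thesis by blast
  qed
  let ?e = "(\<lambda>_. 0)(va := a, vb := b, (''u'', Nt \<rightarrow> T1) := u, (''c'', T1) := c)"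
  let ?\<phi> = "lessR (absR_tm \<cdot> (diffR_tm \<cdot> Free vb \<cdot> (sum_tm \<cdot> Free va \<cdot> Free (''u'', Nt \<rightarrow> T1) \<cdot> (Free (''c'', T1) \<cdot> Free vN))))
    (ratR_tm \<cdot> (qpow_tm \<cdot> (Free vk \<^bold>+ \<^bold>1)))"
  have \<phi>: "sat M (?e(vk := k, vN := n)) [] ?\<phi> \<longleftrightarrow> close_to a b (k + 1) u (c \<bullet> n)" for k n
    by (simp add: close_to_def)
  \<comment> \<open>The length is found from \<open>k\<close> by search, since closeness is
    arithmetical. It is sought for \<open>k + 1\<close> because \<open>wit_if_close\<close> gives up
    one factor 2.\<close>
  obtain G where "\<And>k n. sat M (?e(vk := k, vN := n)) [] ?\<phi> \<Longrightarrow>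
      sat M (?e(vk := k, vN := ap M (snd vk \<rightarrow> Nt) G k)) [] ?\<phi>"
    using choice[of ?\<phi> vN vk ?e] by auto
  then have "close_to a b (k + 1) u (c \<bullet> n) \<Longrightarrow> close_to a b (k + 1) u (c \<bullet> (G \<bullet> k))" for k n
    unfolding \<phi> by simp
  then have G: "close_to a b (k + 1) u (c \<bullet> (G \<bullet> k))" for k using ex by blast
  \<comment> \<open>The same sequence for every \<open>k\<close>; only the length varies.\<close>
  define P where "P = sem M ((\<lambda>_. 0)((''u'', Nt \<rightarrow> T1) := u)) [] (fn ''k'' Nt (\<lambda>_. Free (''u'', Nt \<rightarrow> T1)))"
  define L where "L = sem M ((\<lambda>_. 0)((''c'', T1) := c, (''G'', T1) := G)) []
    (fn ''k'' Nt (\<lambda>k. Free (''c'', T1) \<cdot> (Free (''G'', T1) \<cdot> k)))"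
  have "wit a b k (ap M (Nt \<rightarrow> Nt \<rightarrow> T1) P k) (L \<bullet> k)" for k
    using wit_if_close[OF a u(1) G[of k]] by (simp add: P_def L_def)
  then show "\<exists>P L. \<forall>k. wit a b k (ap M (Nt \<rightarrow> Nt \<rightarrow> T1) P k) (L \<bullet> k)" by blast
qed

section \<open>From moduli to enumerations of strongly countable sets\<close>

text \<open>The summands depend on a parameter \<open>N\<close>, and induction over \<open>N\<close>
  requires the sum to be internal as a function of it.\<close>

lemma ink_Sumk_param: "ink (\<lambda>N. Sumk (\<lambda>j. val (H \<star> N \<bullet> j)) m)"
proof -
  let ?H = "(''H'', Nt \<rightarrow> T1)"
  let ?e = "(\<lambda>_. 0)(?H := H, (''m'', Nt) := m)"
  let ?f = "fn ''i'' Nt (\<lambda>i. fn ''r'' Nt (\<lambda>r. qadd_tm \<cdot> r \<cdot> (Free ?H \<cdot> Free vN \<cdot> i)))"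
  have "val (sem M (?e(vN := N)) [] (Cst Rec \<cdot> ?f \<cdot> \<^bold>0 \<cdot> Free (''m'', Nt))) = Sumk (\<lambda>j. val (H \<star> N \<bullet> j)) m" for N
  proof -
    define f where "f = sem M (?e(vN := N)) [] ?f"
    have f: "ap2 f i r = qadd r (H \<star> N \<bullet> i)" for i r by (simp add: f_def)
    have "val (sem M (?e(vN := N)) [] (Cst Rec \<cdot> ?f \<cdot> \<^bold>0 \<cdot> Free (''m'', Nt))) = val (rec f 0 m)" by (simp add: f_def)
    also have "\<dots> = Sumk (\<lambda>j. val (H \<star> N \<bullet> j)) m"
    proof (rule Sumk_unique[of _ "\<lambda>j. val (rec f 0 j)" m])
      show "ink (\<lambda>j. val (H \<star> N \<bullet> j))" unfolding ink_def by blast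
      show "ink (\<lambda>j. val (rec f 0 j))"
        by (rule inkI[of "(\<lambda>_. 0)((''f'', Nt \<rightarrow> Nt \<rightarrow> Nt) := f)" "Cst Rec \<cdot> Free (''f'', Nt \<rightarrow> Nt \<rightarrow> Nt) \<cdot> \<^bold>0 \<cdot> Free vN"])
          simp_all
    qed (simp_all add: f)
    finally show ?thesis .
  qed
  then show ?thesis by (rule inkI) simp
qed

text \<open>Up to \<open>i\<close> the two sums agree, so the induction starts at
  \<open>i + 1\<close>, just behind the changed summand.\<close>

lemma Sumk_spike:
  assumes ink: "ink h" "ink k" and j: "i < m" and eq: "\<And>j. j < m \<Longrightarrow> j \<noteq> i \<Longrightarrow> k j = h j"
  shows "Sumk k m = Sumk h m + (k i - h i)"
proof -
  have "i + 1 + n \<le> m \<longrightarrow> Sumk k (i + 1 + n) = Sumk h (i + 1 + n) + (k i - h i)" for n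
  proof (induction n rule: int_induct)
    case decid
    have "decid (\<lambda>n. i + 1 + n \<le> m)"
      by (rule decidI[of _ "(\<lambda>_. 0)(vA := i, vB := m)" vN "\<^bold>\<not> (Free vB \<^bold>< Free vA \<^bold>+ \<^bold>1 \<^bold>+ Free vN)"])
        (simp_all add: not_less)
    then show ?case using ink ink_Sumk by (intro decid_intros ink_shift)
  next
    case 0
    have "Sumk k i = Sumk h i" using j by (intro Sumk_cong ink eq) auto
    then show ?case using ink by (simp add: Sumk_Suc)
  next
    case (Suc n)
    show ?case
    proof
      assume le: "i + 1 + (n + 1) \<le> m"
      then have "i + 1 + n < m" using less_iff_succ_less_eq[of "i + 1 + n" m] by (simp add: add.assoc)
      moreover have "i < i + 1 + n" using less_iff_succ_less_eq[of i "i + 1 + n"] by (simp add: add_increasing2)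
      ultimately have "k (i + 1 + n) = h (i + 1 + n)" "i + 1 + n \<le> m" using eq[of "i + 1 + n"] by auto
      then show "Sumk k (i + 1 + (n + 1)) = Sumk h (i + 1 + (n + 1)) + (k i - h i)"
        using Suc Sumk_Suc[OF ink(1), of "i + 1 + n"] Sumk_Suc[OF ink(2), of "i + 1 + n"] by (simp add: add.assoc)
    qed
  qed
  moreover obtain n where "m = i + 1 + n"
    using j less_iff_succ_less_eq[of i m] le_add_diff_inverse2[of "i + 1" m] by (metis add.commute)
  ultimately show ?thesis by blast
qed

section \<open>Strongly countable sets, and reals coded by cuts\<close>

definition "elem_of x A \<longleftrightarrow> is_real x \<and> ap M T2 A x = 1"

definition "sub01 A \<longleftrightarrow> (\<forall>x. is_real x \<longrightarrow> ap M T2 A x = 0 \<or> ap M T2 A x = 1) \<and>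
  (\<forall>x y. is_real x \<and> is_real y \<and> eqr x y \<longrightarrow> ap M T2 A x = ap M T2 A y) \<and> (\<forall>x. elem_of x A \<longrightarrow> in1 x)"

definition "counts Y A \<longleftrightarrow> (\<forall>x y. in1 x \<and> in1 y \<and> eqr x y \<longrightarrow> ap M T2 Y x = ap M T2 Y y) \<and>
  (\<forall>x y. elem_of x A \<and> elem_of y A \<and> ap M T2 Y x = ap M T2 Y y \<longrightarrow> eqr x y) \<and>
  (\<forall>n. \<exists>x. elem_of x A \<and> ap M T2 Y x = n)"

lemma sat_cocode1:
  "sat M e [] cocode1 \<longleftrightarrow> (\<forall>A. sub01 A \<and> (\<exists>Y. counts Y A) \<longrightarrow>
    (\<exists>z. (\<forall>n. is_real (z \<star> n)) \<and> (\<forall>x. elem_of x A \<longrightarrow> (\<exists>n. eqr x (z \<star> n)))))"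
  by (simp add: cocode1_def subset01_def strongly_countable_def enumerable_def elt_def
      sub01_def counts_def elem_of_def)

definition "bin f \<longleftrightarrow> (\<forall>i. f \<bullet> i = 0 \<or> f \<bullet> i = 1)"

lemma sat_binary [simp]:
  "tyof [] t = Some T1 \<Longrightarrow> (''bin_i'', Nt) \<notin> fvt t \<Longrightarrow> sat M e [] (binary t) \<longleftrightarrow> bin (sem M e [] t)"
  by (auto simp: binary_def bin_def tyof_lct0 sem_upd_fresh)

lemma sat_IND1:
  "sat M e [] IND1 \<longleftrightarrow> (\<forall>Y. (\<forall>n. \<exists>f. bin f \<and> ap M T2 (ap M (Nt \<rightarrow> T2) Y n) f = 0 \<and>
      (\<forall>g. bin g \<and> ap M T2 (ap M (Nt \<rightarrow> T2) Y n) g = 0 \<longrightarrow> g = f)) \<longrightarrow>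
    (\<forall>n. \<exists>w. \<forall>i<n. bin (w \<star> i) \<and> ap M T2 (ap M (Nt \<rightarrow> T2) Y i) (w \<star> i) = 0))"
  by (simp add: IND1_def sat_eqt[OF ext] lc_eqt del: eqt.simps)

text \<open>
  A real \<open>x\<close> is coded by the characteristic function of the rationals \<open>q \<le> x\<close>, which, unlike \<open>x\<close> itself,
  is determined by the value of \<open>x\<close>.
\<close>

definition "is_cut f x \<longleftrightarrow> (\<forall>q. (f \<bullet> q = 1 \<longleftrightarrow> leqr (rat q) x) \<and> (f \<bullet> q = 0 \<or> f \<bullet> q = 1))"

lemma cut_exists: "\<exists>f. is_cut f x"
proof -
  let ?x = "(''x'', T1)"
  \<comment> \<open>Comprehension answers 0 for true, so it is applied to the negation to get the
    value 1 at rationals below \<open>x\<close>.\<close>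
  obtain F where "\<And>q. ap M (snd vN \<rightarrow> Nt) F q =
      (if sat M ((\<lambda>_. 0)(?x := x, vN := q)) [] (\<^bold>\<not> leqR (ratR_tm \<cdot> Free vN) (Free ?x)) then 0 else 1)"
    using comprehension[of "\<^bold>\<not> leqR (ratR_tm \<cdot> Free vN) (Free ?x)" vN "(\<lambda>_. 0)(?x := x)"] by auto
  then have "is_cut F x" by (simp add: is_cut_def)
  then show ?thesis by blast
qed

text \<open>Supplies the uniqueness that \<open>IND1\<close> demands: identity of functions,
  although the reals are only equal as reals.\<close>

lemma cut_unique:
  assumes "is_cut f x" "is_cut g y" "is_real x" "is_real y" "eqr x y"
  shows "f = g"
proof (rule ext1)
  fix q
  have "leqr (rat q) x \<longleftrightarrow> leqr (rat q) y"
    using assms(5) leqr_trans[OF is_real_rat assms(3,4), of q] leqr_trans[OF is_real_rat assms(4,3), of q]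
    unfolding eqr_leqr by blast
  then show "f \<bullet> q = g \<bullet> q" using assms by (metis is_cut_def)
qed

lemma cut_eqr: "is_cut f x \<Longrightarrow> is_real x \<Longrightarrow> is_real y \<Longrightarrow> eqr x y \<Longrightarrow> is_cut f y"
  using cut_exists[of y] cut_unique by metis

text \<open>The \<open>n\<close>-th approximation is a rational in the cut that leaves it when
  \<open>eps (n + 1)\<close> is added. Such a rational is found by search, uniformly in the
  cut.\<close>

lemma decode:
  obtains D where "\<And>f x. is_cut f x \<Longrightarrow> is_real x \<Longrightarrow> is_real (D \<odot> f) \<and> eqr x (D \<odot> f)"
proof -
  let ?q = "(''q'', Nt)"
  let ?\<phi> = "Free vf \<cdot> Free ?q \<^bold>= \<^bold>1 \<^bold>\<and> Free vf \<cdot> (qadd_tm \<cdot> Free ?q \<cdot> (qpow_tm \<cdot> (Free vN \<^bold>+ \<^bold>1))) \<^bold>= \<^bold>0"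
  obtain D where "\<And>f n q. sat M ((\<lambda>_. 0)(vf := f, vN := n, ?q := q)) [] ?\<phi> \<Longrightarrow>
      sat M ((\<lambda>_. 0)(vf := f, vN := n, ?q := ap M (snd vN \<rightarrow> Nt) (ap M (snd vf \<rightarrow> snd vN \<rightarrow> Nt) D f) n)) [] ?\<phi>"
    using choice2[of ?\<phi> vf vN ?q "\<lambda>_. 0"] by auto
  then have D: "f \<bullet> q = 1 \<and> f \<bullet> qadd q (qpow (n + 1)) = 0 \<Longrightarrow>
      f \<bullet> (D \<odot> f \<bullet> n) = 1 \<and> f \<bullet> qadd (D \<odot> f \<bullet> n) (qpow (n + 1)) = 0" for f n q
    by simp
  show thesis
  proof (rule that[of D])
    fix f x assume is_cut: "is_cut f x" and x: "is_real x"
    have c: "f \<bullet> q = 1 \<longleftrightarrow> leqr (rat q) x" "f \<bullet> q = 0 \<longleftrightarrow> \<not> leqr (rat q) x" for q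
      using is_cut unfolding is_cut_def by (metis zero_neq_one)+
    have ex: "\<exists>q. f \<bullet> q = 1 \<and> f \<bullet> qadd q (qpow (n + 1)) = 0" for n
    proof -
      \<comment> \<open>\<open>eps (n + 1)\<close> is four times \<open>eps ?k\<close>. Starting
        \<open>eps ?k\<close> below the approximation, the step lands three times
        \<open>eps ?k\<close> above it, safely beyond the real.\<close>
      let ?k = "n + 1 + 1 + 1"
      obtain q where q: "val q = v x ?k - eps ?k" using val_surj by blast
      have "leqr (rat q) x" unfolding leqr_iff[OF is_real_rat x]
      proof (intro allI impI)
        fix d :: "'d diff fract" assume "0 < d"
        show "\<forall>\<^sub>F p in at_top. v (rat q) p \<le> v x p + d" using eventually_ge_at_top[of ?k]
        proof eventually_elim
          case (elim p)
          then show ?case using is_realD[OF x elim] \<open>0 < d\<close> unfolding v_rat q by linarith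
        qed
      qed
      moreover have "\<not> leqr (rat (qadd q (qpow (n + 1)))) x"
      proof
        assume "leqr (rat (qadd q (qpow (n + 1)))) x"
        then have "val q + eps (n + 1) \<le> v x ?k + (eps ?k + eps ?k)" by (simp add: leqr_def del: eps)
        moreover have "\<forall>\<^sub>F p in at_top. val q + eps (n + 1) \<le> v x p + eps ?k / 2"
          using \<open>leqr (rat (qadd q (qpow (n + 1)))) x\<close> eps(1)[of ?k] leqr_iff[OF is_real_rat x]
          by (simp del: eps)
        then have "\<forall>\<^sub>F p in at_top. val q + eps (n + 1) \<le> v x p + eps ?k / 2 \<and> ?k \<le> p"
          by (simp add: eventually_conj eventually_ge_at_top)
        then obtain p where "val q + eps (n + 1) \<le> v x p + eps ?k / 2" "?k \<le> p"
          using eventually_happens by fastforce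
        moreover have "eps (n + 1) = 4 * eps ?k" by simp
        ultimately show False using is_realD[OF x, of ?k p] q eps(1)[of ?k] by linarith
      qed
      ultimately show ?thesis using is_cut by (auto simp: is_cut_def)
    qed
    define d where "d = (\<lambda>n. v (D \<odot> f) n)"
    have Df: "leqr (rat (D \<odot> f \<bullet> n)) x" "\<not> leqr (rat (qadd (D \<odot> f \<bullet> n) (qpow (n + 1)))) x" for n
      using D[of f _ n] ex[of n] unfolding c by blast+
    have dv: "v (rat (D \<odot> f \<bullet> n)) p = d n" "v (rat (qadd (D \<odot> f \<bullet> n) (qpow (n + 1)))) p = d n + eps (n + 1)" for n p
      unfolding v_rat by (simp_all add: d_def v_def del: eps)
    have lower: "d n \<le> v x p + (eps p + eps p)" for n p
      using Df(1)[of n] unfolding leqr_def dv by blast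
    have upper: "\<exists>e>0. \<forall>\<^sub>F p in at_top. v x p + e \<le> d n + eps (n + 1)" for n
      using not_leqr[OF is_real_rat x Df(2)[of n]] unfolding dv by blast
    \<comment> \<open>Each \<open>d m\<close> is at most the real, which in turn is below
      \<open>d n + eps (n + 1)\<close> by a gap that absorbs the approximation error.\<close>
    have near: "d m < d n + eps (n + 1)" for m n
    proof -
      obtain e where e: "0 < e" "\<forall>\<^sub>F p in at_top. v x p + e \<le> d n + eps (n + 1)" using upper by blast
      have "\<forall>\<^sub>F p in at_top. eps p < e / 2" using e by (intro eventually_eps) simp
      with e(2) have "\<forall>\<^sub>F p in at_top. v x p + e \<le> d n + eps (n + 1) \<and> eps p < e / 2" by (rule eventually_conj)
      then obtain p where "v x p + e \<le> d n + eps (n + 1)" "eps p < e / 2" using eventually_happens by fastforce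
      then show ?thesis using lower[of m p] by linarith
    qed
    have real: "is_real (D \<odot> f)" unfolding is_real_def
    proof (intro allI)
      fix n i
      have "d n < d (n + i) + eps (n + i + 1)" "d (n + i) < d n + eps (n + 1)" by (rule near)+
      moreover have "eps (n + i + 1) \<le> eps (n + 1)" "eps (n + 1) < eps n"
        using eps(1)[of n] eps_antimono[of n "n + i"] by (simp_all add: add_increasing2)
      ultimately show "\<bar>v (D \<odot> f) n - v (D \<odot> f) (n + i)\<bar> < eps n" unfolding d_def by linarith
    qed
    have "leqr (D \<odot> f) x" using lower by (simp add: leqr_def d_def)
    moreover have "leqr x (D \<odot> f)" unfolding leqr_def
    proof
      fix n
      obtain e where e: "0 < e" "\<forall>\<^sub>F p in at_top. v x p + e \<le> d n + eps (n + 1)" using upper by blast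
      then have "\<forall>\<^sub>F p in at_top. v x p + e \<le> d n + eps (n + 1) \<and> n \<le> p"
        by (simp add: eventually_conj eventually_ge_at_top)
      then obtain p where p: "v x p + e \<le> d n + eps (n + 1)" "n \<le> p" using eventually_happens by fastforce
      have "eps (n + 1) < eps n" using eps(1)[of n] by simp
      then show "v x n \<le> v (D \<odot> f) n + (eps n + eps n)"
        using p(1) e(1) is_realD[OF x p(2)] by (simp only: d_def)
    qed
    ultimately show "is_real (D \<odot> f) \<and> eqr x (D \<odot> f)" using real by (simp add: eqr_leqr)
  qed
qed

text \<open>A member of \<open>A\<close> with a given \<open>Y\<close>-value is unique up to
  equality of reals, so its cut is unique as a binary function. \<open>IND1\<close> is applied to
  the cuts and the result is decoded.\<close>

lemma initial_segment:
  assumes IND: "sat M e [] IND1" and A: "sub01 A" and Y: "counts Y A"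
  obtains w where "\<And>i. i < l \<Longrightarrow> elem_of (w \<star> i) A \<and> ap M T2 Y (w \<star> i) = i"
proof -
  obtain D where D: "\<And>f x. is_cut f x \<Longrightarrow> is_real x \<Longrightarrow> is_real (D \<odot> f) \<and> eqr x (D \<odot> f)"
    by (rule decode) blast
  let ?D = "(''D'', T1 \<rightarrow> T1)" and ?A = "(''A'', T2)" and ?Y = "(''Y'', T2)"
  let ?e = "(\<lambda>_. 0)(?D := D, ?A := A, ?Y := Y)" and ?d = "Free ?D \<cdot> Free vf"
  \<comment> \<open>Referring to the decoded real avoids a quantifier over reals, so the condition
    on the cut is arithmetical.\<close>
  let ?\<phi> = "isreal ?d \<^bold>\<and> Free ?A \<cdot> ?d \<^bold>= \<^bold>1 \<^bold>\<and> Free ?Y \<cdot> ?d \<^bold>= Free vN \<^bold>\<and>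
    forall ''q'' Nt (\<lambda>q. (Free vf \<cdot> q \<^bold>= \<^bold>1 \<^bold>\<longleftrightarrow> leqR (ratR_tm \<cdot> q) ?d) \<^bold>\<and> (Free vf \<cdot> q \<^bold>= \<^bold>0 \<^bold>\<or> Free vf \<cdot> q \<^bold>= \<^bold>1))"
  have \<phi>: "sat M (?e(vN := n, vf := f)) [] ?\<phi> \<longleftrightarrow> elem_of (D \<odot> f) A \<and> ap M T2 Y (D \<odot> f) = n \<and> is_cut f (D \<odot> f)" for n f
    by (simp add: elem_of_def is_cut_def)
  obtain Z where "\<And>n f. ap M (snd vf \<rightarrow> Nt) (ap M (snd vN \<rightarrow> snd vf \<rightarrow> Nt) Z n) f =
      (if sat M (?e(vN := n, vf := f)) [] ?\<phi> then 0 else 1)"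
    using comprehension2[of ?\<phi> vN vf ?e] by auto
  then have Z: "ap M T2 (ap M (Nt \<rightarrow> T2) Z n) f = 0 \<longleftrightarrow>
      elem_of (D \<odot> f) A \<and> ap M T2 Y (D \<odot> f) = n \<and> is_cut f (D \<odot> f)" for n f
    unfolding \<phi> by simp
  have "\<exists>f. bin f \<and> ap M T2 (ap M (Nt \<rightarrow> T2) Z n) f = 0 \<and>
      (\<forall>g. bin g \<and> ap M T2 (ap M (Nt \<rightarrow> T2) Z n) g = 0 \<longrightarrow> g = f)" for n
  proof -
    obtain x where x: "elem_of x A" "ap M T2 Y x = n" using Y unfolding counts_def by blast
    obtain f where f: "is_cut f x" using cut_exists by blast
    have xr: "is_real x" using x by (simp add: elem_of_def)
    have Df: "is_real (D \<odot> f)" "eqr x (D \<odot> f)" using D[OF f xr] by auto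
    have el: "elem_of (D \<odot> f) A" using A x(1) Df xr unfolding sub01_def elem_of_def by metis
    then have "in1 x" "in1 (D \<odot> f)" using A x(1) by (auto simp: sub01_def)
    then have "ap M T2 Y (D \<odot> f) = n" using Y x(2) Df(2) unfolding counts_def by metis
    moreover have "is_cut f (D \<odot> f)" using cut_eqr f xr Df by blast
    moreover have "bin f" using f unfolding is_cut_def bin_def by blast
    moreover have "g = f" if "ap M T2 (ap M (Nt \<rightarrow> T2) Z n) g = 0" for g
    proof -
      have g: "elem_of (D \<odot> g) A" "ap M T2 Y (D \<odot> g) = n" "is_cut g (D \<odot> g)" using that Z by auto
      then have "eqr (D \<odot> g) (D \<odot> f)" using Y el calculation(1) unfolding counts_def by metis
      then show ?thesis using cut_unique[OF g(3) calculation(2)] g(1) Df(1) by (simp add: elem_of_def)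
    qed
    ultimately show ?thesis using Z el by blast
  qed
  then obtain u where u: "\<forall>i<l. bin (u \<star> i) \<and> ap M T2 (ap M (Nt \<rightarrow> T2) Z i) (u \<star> i) = 0"
    using IND unfolding sat_IND1 by blast
  define w where "w = sem M ((\<lambda>_. 0)(?D := D, (''u'', Nt \<rightarrow> T1) := u)) [] (fn ''i'' Nt (\<lambda>i. Free ?D \<cdot> (Free (''u'', Nt \<rightarrow> T1) \<cdot> i)))"
  have "w \<star> i = D \<odot> (u \<star> i)" for i by (simp add: w_def)
  then show thesis using u Z by (intro that[of w]) auto
qed

lemma iii_imp_cocode:
  assumes IND: "sat M e [] IND1" and iii: "sat M e [] item_iii"
  shows "sat M e [] cocode1"
  unfolding sat_cocode1
proof (intro allI impI)
  fix A assume "sub01 A \<and> (\<exists>Y. counts Y A)"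
  then obtain Y where A: "sub01 A" and Y: "counts Y A" by blast
  let ?A = "(''A'', T2)" and ?Y = "(''Y'', T2)"
  \<comment> \<open>Multiplying the code by the value 0 or 1 of the characteristic function is the
    case distinction, again because 0 codes the rational 0.\<close>
  define a where "a = sem M ((\<lambda>_. 0)(?A := A, ?Y := Y)) [] (fn ''x'' T1 (\<lambda>x. fn ''n'' Nt (\<lambda>n.
    qpow_tm \<cdot> (Free ?Y \<cdot> x \<^bold>+ \<^bold>1) \<^bold>* (Free ?A \<cdot> x))))"
  have a0: "v (a \<odot> x) n = val (qpow (ap M T2 Y x + 1) * ap M T2 A x)" for x n
    by (simp add: a_def v_def)
  have a: "v (a \<odot> x) n = (if elem_of x A then eps (ap M T2 Y x + 1) else 0)" if "is_real x" for x n
    using A that unfolding a0 sub01_def elem_of_def by auto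
  have A_cong: "elem_of x A \<longleftrightarrow> elem_of y A" if "is_real x" "is_real y" "eqr x y" for x y
    using A that unfolding sub01_def elem_of_def by metis
  have A_in1: "elem_of x A \<Longrightarrow> in1 x" for x using A by (simp add: sub01_def)
  have Y_cong: "ap M T2 Y x = ap M T2 Y y" if "in1 x" "in1 y" "eqr x y" for x y
    using Y that unfolding counts_def by blast
  have Y_inj: "eqr x y" if "elem_of x A" "elem_of y A" "ap M T2 Y x = ap M T2 Y y" for x y
    using Y that unfolding counts_def by blast
  have real_a: "is_real (a \<odot> x)" for x by (simp add: is_real_def a0)
  have fam: "fam a" unfolding fam_def
  proof (intro conjI allI impI)
    fix x y assume "in1 x \<and> in1 y \<and> eqr x y"
    then have xy: "is_real x" "is_real y" "eqr x y" "ap M T2 Y x = ap M T2 Y y"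
      using in1_real Y_cong[of x y] by blast+
    then have "v (a \<odot> x) n = v (a \<odot> y) n" for n
      using a[OF xy(1)] a[OF xy(2)] A_cong[OF xy(1-3)] by simp
    then show "eqr (a \<odot> x) (a \<odot> y)" by (simp add: eqr_def less_imp_le add_nonneg_nonneg)
  qed (rule real_a)
  have nonneg_a: "0 \<le> v (a \<odot> x) n" if "is_real x" for x n
    using a[OF that] eps(1) by (simp add: less_imp_le del: eps(3))
  have posi: "posi a"
    using nonneg_a in1_real by (simp add: posi_def leqr_def less_imp_le add_nonneg_nonneg)
  define b where "b = rat (mk 1 0 0)"
  have vb: "v b n = 1" for n by (simp add: b_def val_def)
  have bound: "1 - eps l \<le> psum a J m p \<and> psum a J m p \<le> 1"
    if J: "fin J m" and l: "\<And>N. N < l \<Longrightarrow> \<exists>j<m. elem_of (J \<star> j) A \<and> ap M T2 Y (J \<star> j) = N" for J m l p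
  proof -
    let ?J = "(''J'', Nt \<rightarrow> T1)"
    \<comment> \<open>The last factor is 1 for \<open>Y\<close>-values below \<open>N\<close> and 0
      otherwise. \<open>N\<close> is an argument of \<open>H\<close> because the induction below
      runs over it.\<close>
    define H where "H = sem M ((\<lambda>_. 0)(?A := A, ?Y := Y, ?J := J)) [] (fn ''N'' Nt (\<lambda>N. fn ''j'' Nt (\<lambda>j.
      qpow_tm \<cdot> (Free ?Y \<cdot> (Free ?J \<cdot> j) \<^bold>+ \<^bold>1) \<^bold>* (Free ?A \<cdot> (Free ?J \<cdot> j)) \<^bold>*
      (\<^bold>1 \<^bold>- (Free ?Y \<cdot> (Free ?J \<cdot> j) \<^bold>+ \<^bold>1 \<^bold>- N)))))"
    define h where "h = (\<lambda>N j. val (H \<star> N \<bullet> j))"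
    have ink_h: "ink (h N)" for N unfolding h_def ink_def by blast
    \<comment> \<open>The part of the sum that comes from elements with \<open>Y\<close>-value below \<open>N\<close>; there is at most one with value \<open>N\<close>.\<close>
    define R where "R = (\<lambda>N. Sumk (h N) m)"
    have ink_R: "ink R" unfolding R_def h_def by (rule ink_Sumk_param)
    have Jr: "is_real (J \<star> j)" if "j < m" for j using J that fin_in1 in1_real by blast
    have h: "h N j = (if elem_of (J \<star> j) A \<and> ap M T2 Y (J \<star> j) < N then eps (ap M T2 Y (J \<star> j) + 1) else 0)"
      if "j < m" for N j
      using A Jr[OF that] unfolding h_def H_def sub01_def elem_of_def
      by (auto simp: one_diff diff_eq_0 less_iff_succ_less_eq)
    have step: "R (N + 1) = (if \<exists>j<m. elem_of (J \<star> j) A \<and> ap M T2 Y (J \<star> j) = N then R N + eps (N + 1) else R N)" for N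
    proof (cases "\<exists>j<m. elem_of (J \<star> j) A \<and> ap M T2 Y (J \<star> j) = N")
      case True
      then obtain j where j: "j < m" "elem_of (J \<star> j) A" "ap M T2 Y (J \<star> j) = N" by blast
      have "h (N + 1) i = h N i" if i: "i < m" "i \<noteq> j" for i
      proof -
        have "\<not> (elem_of (J \<star> i) A \<and> ap M T2 Y (J \<star> i) = N)"
          using J i j Y_inj[of "J \<star> i" "J \<star> j"] eqr_sym[of "J \<star> i" "J \<star> j"]
          by (cases i j rule: linorder_cases) (auto simp: fin_def)
        then show ?thesis using h[OF i(1)] by (auto simp: less_Suc simp del: eps(3))
      qed
      then have "R (N + 1) = R N + (h (N + 1) j - h N j)"
        unfolding R_def by (intro Sumk_spike ink_h j(1))
      then show ?thesis using True h[OF j(1)] j by (auto simp: less_Suc simp del: eps(3))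
    next
      case False
      then have "R (N + 1) = R N" unfolding R_def
        using h by (intro Sumk_cong ink_h) (auto simp: less_Suc)
      then show ?thesis using False by auto
    qed
    have R0: "R 0 = 0"
    proof -
      have "R 0 = Sumk (\<lambda>_. 0) m" unfolding R_def using h by (intro Sumk_cong ink_h ink_const) simp
      also have "\<dots> = 0" by (rule Sumk_unique[of _ "\<lambda>_. 0", symmetric]) (auto intro: ink_const)
      finally show ?thesis .
    qed
    \<comment> \<open>The powers \<open>eps 1\<close> to \<open>eps N\<close> add up to
      \<open>1 - eps N\<close>, and each value below \<open>N\<close> contributes at most
      once.\<close>
    have R_le: "R N \<le> 1 - eps N" for N
    proof (induction N rule: int_induct)
      case decid
      show ?case by (intro decid_intros ink_R)
    next
      case (Suc N)
      have "R (N + 1) \<le> R N + eps (N + 1)" using step[of N] eps(1)[of "N + 1"] by (simp del: eps)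
      then show ?case using Suc by simp
    qed (simp add: R0)
    have R_ge: "N \<le> l \<longrightarrow> 1 - eps N \<le> R N" for N
    proof (induction N rule: int_induct)
      case decid
      show ?case by (intro decid_intros ink_R)
    next
      case (Suc N)
      show ?case
      proof
        assume "N + 1 \<le> l"
        then have "N < l" using less_iff_succ_less_eq by blast
        then have "R (N + 1) = R N + eps (N + 1)" using step[of N] l by simp
        then show "1 - eps (N + 1) \<le> R (N + 1)" using Suc \<open>N < l\<close> by (simp add: less_imp_le)
      qed
    qed (simp add: R0)
    define F where "F = sem M ((\<lambda>_. 0)(?Y := Y, ?J := J)) [] (fn ''j'' Nt (\<lambda>j. Free ?Y \<cdot> (Free ?J \<cdot> j)))"
    \<comment> \<open>Beyond all \<open>Y\<close>-values that occur in \<open>J\<close> the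
      restriction to values below \<open>N\<close> excludes nothing, and \<open>R N\<close> is the
      full sum.\<close>
    obtain N where "\<And>j. j < m \<Longrightarrow> F \<bullet> j < N" using bounded by blast
    then have N: "ap M T2 Y (J \<star> j) < N" if "j < m" for j using that by (simp add: F_def)
    have "psum a J m p = R N" unfolding R_def
      using h N a Jr by (intro Sumk_cong ink_h ink_seq) simp
    then have "psum a J m p \<le> 1" using R_le[of N] eps(1)[of N] by linarith
    moreover have "R l \<le> psum a J m p" unfolding R_def
    proof (intro Sumk_mono ink_h ink_seq)
      fix j assume j: "j < m"
      show "h l j \<le> v (a \<odot> (J \<star> j)) p"
        using h[OF j, of l] a[OF Jr[OF j], of p] nonneg_a[OF Jr[OF j], of p] by (auto split: if_splits)
    qed
    ultimately show ?thesis using R_ge[of l] by simp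
  qed
  have conv: "conv a b" unfolding conv_def
  proof (intro conjI allI)
    show b_real: "is_real b" by (simp add: b_def)
    fix k
    \<comment> \<open>The values 0 to \<open>k\<close> leave an error of at most
      \<open>eps (k + 1)\<close>, half of \<open>eps k\<close>; the other half is the gap that
      \<open>close_to_iff\<close> asks for.\<close>
    obtain w where w: "\<And>i. i < k + 1 \<Longrightarrow> elem_of (w \<star> i) A \<and> ap M T2 Y (w \<star> i) = i"
      using initial_segment[OF IND A Y, of "k + 1"] by blast
    have "wit a b k w (k + 1)" unfolding wit_def
    proof (intro conjI allI impI)
      show "fin w (k + 1)" unfolding fin_def
      proof (intro allI impI conjI)
        fix i assume i: "i < k + 1"
        then show "in1 (w \<star> i)" using w A_in1 by blast
        fix j assume j: "j < i"
        then have "j < k + 1" using i by simp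
        then show "\<not> eqr (w \<star> j) (w \<star> i)"
          using w[OF i] w[of j] j Y_cong[of "w \<star> j" "w \<star> i"] A_in1 by auto
      qed
      fix J m assume J: "fin J m \<and> cont w (k + 1) J m"
      have sum: "1 - eps (k + 1) \<le> psum a J m p \<and> psum a J m p \<le> 1" for p
      proof (rule bound)
        show "fin J m" using J by blast
        fix N assume N: "N < k + 1"
        then obtain j where j: "j < m" "eqr (w \<star> N) (J \<star> j)" using J by (auto simp: cont_def)
        have wN: "elem_of (w \<star> N) A" "ap M T2 Y (w \<star> N) = N" using w[OF N] by auto
        moreover have "in1 (J \<star> j)" using J j(1) fin_in1 by blast
        ultimately show "\<exists>j<m. elem_of (J \<star> j) A \<and> ap M T2 Y (J \<star> j) = N"
          using j A_cong[of "w \<star> N" "J \<star> j"] Y_cong[of "w \<star> N" "J \<star> j"] A_in1 in1_real by metis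
      qed
      have "\<bar>v b p - psum a J m p\<bar> + eps (k + 1) \<le> eps k" for p
        unfolding vb using sum[of p] eps(3)[of k] by linarith
      then have "\<forall>\<^sub>F p in at_top. \<bar>v b p - psum a J m p\<bar> + eps (k + 1) \<le> eps k"
        by (intro always_eventually allI)
      then show "close_to a b k J m"
        unfolding close_to_iff[of b m a J k, OF b_real real_a] using eps(1) by blast
    qed
    then show "\<exists>u l. wit a b k u l" by blast
  qed
  obtain P L where PL: "\<And>k. wit a b k (ap M (Nt \<rightarrow> Nt \<rightarrow> T1) P k) (L \<bullet> k)"
    using iii fam posi conv unfolding sat_item_iii by metis
  obtain z where z: "\<And>k i. i < L \<bullet> k \<Longrightarrow> z \<star> pair k i = ap M (Nt \<rightarrow> Nt \<rightarrow> T1) P k \<star> i"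
    "\<And>q. z \<star> q = rat 0 \<or> (\<exists>k i. i < L \<bullet> k \<and> z \<star> q = ap M (Nt \<rightarrow> Nt \<rightarrow> T1) P k \<star> i)"
    using flatten[of L P thesis] by blast
  show "\<exists>z. (\<forall>n. is_real (z \<star> n)) \<and> (\<forall>x. elem_of x A \<longrightarrow> (\<exists>n. eqr x (z \<star> n)))"
  proof (rule exI[of _ z], intro conjI allI impI)
    show "is_real (z \<star> q)" for q
      using z(2)[of q] PL fin_in1 in1_real unfolding wit_def by fastforce
    fix x assume x: "elem_of x A"
    \<comment> \<open>The summand at \<open>x\<close> is then \<open>2 * eps k\<close>, while
      \<open>outside_small\<close> would bound it by \<open>eps k + eps k / 2\<close> if
      \<open>x\<close> were not listed at stage \<open>k\<close>.\<close>
    define k where "k = ap M T2 Y x + 1 + 1"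
    let ?f = "ap M (Nt \<rightarrow> Nt \<rightarrow> T1) P k"
    show "\<exists>n. eqr x (z \<star> n)"
    proof (rule ccontr)
      assume no: "\<not> (\<exists>n. eqr x (z \<star> n))"
      have out: "\<not> eqr (?f \<star> i) x" if "i < L \<bullet> k" for i
        using no z(1)[OF that] eqr_sym by metis
      have f: "fin ?f (L \<bullet> k)" "close_to a b k ?f (L \<bullet> k)"
        using PL[of k] cont_refl by (auto simp: wit_def)
      have "0 < eps k / 2" by (simp del: eps(3))
      then have "\<forall>\<^sub>F p in at_top. v (a \<odot> x) p \<le> eps k + eps k / 2"
        using outside_small[OF fam posi conv f A_in1[OF x] out] by blast
      then have "\<forall>\<^sub>F p in at_top :: 'd filter. eps (ap M T2 Y x + 1) \<le> eps k + eps k / 2"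
        using x a by (simp add: elem_of_def del: eps)
      then have "eps (ap M T2 Y x + 1) \<le> eps k + eps k / 2" by simp
      moreover have "eps (ap M T2 Y x + 1) = 2 * eps k" by (simp add: k_def)
      ultimately show False using eps(1)[of k] by linarith
    qed
  qed
qed

end

section \<open>Return from models to derivability\<close>

lemma sentences_ACA: "\<gamma> \<in> ACA0w \<union> {IND1} \<Longrightarrow> sentence \<gamma>"
proof -
  have s: "sentence IND1" "sentence exists2"
    by (auto simp: sentence_def IND1_def exists2_def binary_def wf_eqt)
  have "\<gamma> \<in> closures \<phi> \<Longrightarrow> sentence \<gamma>" for \<phi> by (auto simp: closures_def)
  moreover have "\<gamma> \<in> basic_axioms \<Longrightarrow> sentence \<gamma>"
    by (auto simp: basic_axioms_def sentence_def)
  moreover have "\<gamma> \<in> combinator_axioms \<Longrightarrow> sentence \<gamma>"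
    by (auto simp: combinator_axioms_def sentence_def wf_eqt)
  moreover have "\<gamma> \<in> recursor_axioms \<Longrightarrow> sentence \<gamma>"
    by (auto simp: recursor_axioms_def sentence_def)
  moreover have "\<gamma> \<in> extensionality_axioms \<Longrightarrow> sentence \<gamma>"
    by (auto simp: extensionality_axioms_def sentence_def wf_eqt)
  ultimately show "\<gamma> \<in> ACA0w \<union> {IND1} \<Longrightarrow> sentence \<gamma>"
    using s by (auto simp: ACA0w_def RCA0w_def QF_induction_def QF_AC10_def)
qed

text \<open>Any counterexample would make \<open>the_model\<close> one too, and
  \<open>the_model\<close> is an \<open>nmodel\<close> because the operations on \<open>elem\<close>
  were taken from it.\<close>

lemma no_counterexample: "\<not> counterexample M"
proof
  assume "counterexample M"
  then have c: "counterexample the_model" unfolding the_model_def by (rule someI)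
  then have "aca_model the_model" by unfold_locales (auto simp: counterexample_def)
  then interpret nmodel the_model by (rule nmodel_the_model)
  have "sat the_model e [] IND1" for e using c by (auto simp: counterexample_def valid_def)
  then have "valid the_model \<phi>" if "\<phi> \<in> claims" for \<phi>
    using that ac01_imp_ii ii_imp_iii iii_imp_cocode by (auto simp: claims_def valid_def)
  then show False using c by (auto simp: counterexample_def)
qed

theorem theorem4p7:
  shows "(ACA0w \<union> {IND1} \<turnstile> QF_AC01 \<^bold>\<longrightarrow> item_ii) \<and>
    (ACA0w \<union> {IND1} \<turnstile> item_ii \<^bold>\<longrightarrow> item_iii) \<and>
    (ACA0w \<union> {IND1} \<turnstile> item_iii \<^bold>\<longrightarrow> cocode1)"
proof -
  have "ACA0w \<union> {IND1} \<turnstile> \<phi>" if "\<phi> \<in> claims" for \<phi>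
  proof (rule completeness)
    show "RCA0w \<subseteq> ACA0w \<union> {IND1}" by (auto simp: ACA0w_def)
    show "wf [] \<phi>" using that by (auto simp: claims_def wf_items)
    show "valid M \<phi>" if "extensional M" "\<And>\<gamma>. \<gamma> \<in> ACA0w \<union> {IND1} \<Longrightarrow> valid M \<gamma>" for M :: "elem str"
      using that \<open>\<phi> \<in> claims\<close> no_counterexample[of M] unfolding counterexample_def by blast
  qed (rule sentences_ACA)
  then show ?thesis by (simp add: claims_def)
qed

end
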